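(* Let $\varphi$ be a growth function on $\mathbb{R}^n\times[0,\infty)$ satisfying the uniformly locally dominated convergence condition. Then, for all $q\in[1,q(\varphi)')$ and $s\in[m(\varphi),\infty)\cap\mathbb{Z}_+$, the spaces $\mathcal{L}_{\varphi,q,s}(\mathbb{R}^n)$ and $\mathcal{L}_{\varphi,1,m(\varphi)}(\mathbb{R}^n)$ coincide with equivalent norms; that is, with elements of $\mathcal{L}_{\varphi,q,s}(\mathbb{R}^n)$ taken modulo $\mathcal{P}_s(\mathbb{R}^n)$ and elements of $\mathcal{L}_{\varphi,1,m(\varphi)}(\mathbb{R}^n)$ taken modulo $\mathcal{P}_{m(\varphi)}(\mathbb{R}^n)$, the natural map $f+\mathcal{P}_{m(\varphi)}(\mathbb{R}^n)\mapsto f+\mathcal{P}_s(\mathbb{R}^n)$ is a bijection from $\mathcal{L}_{\varphi,1,m(\varphi)}(\mathbb{R}^n)$ onto $\mathcal{L}_{\varphi,q,s}(\mathbb{R}^n)$, and $\|f\|_{\mathcal{L}_{\varphi,q,s}(\mathbb{R}^n)}\sim\|f\|_{\mathcal{L}_{\varphi,1,m(\varphi)}(\mathbb{R}^n)}$ for $f\in\mathcal{L}_{\varphi,1,m(\varphi)}(\mathbb{R}^n)$ with implicit constants independent of $f$.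
   Context: Notation: $\mathbb{Z}_+=\{0,1,2,\dots\}$; $\chi_E$ is the characteristic function of $E$; $|E|$ is Lebesgue measure; $\lfloor r\rfloor$ is the largest integer not exceeding $r$; $r'$ denotes the conjugate index of $r\in[1,\infty]$, $1/r+1/r'=1$ (so $1'=\infty$); $A\sim B$ means that each is bounded by a positive constant times the other. Orlicz function: $\Phi:[0,\infty)\to[0,\infty)$ nondecreasing, $\Phi(0)=0$, $\Phi(t)>0$ for $t\in(0,\infty)$, $\lim_{t\to\infty}\Phi(t)=\infty$. Uniform types: let $\varphi:\mathbb{R}^n\times[0,\infty)\to[0,\infty)$ be such that $\varphi(x,\cdot)$ is an Orlicz function for every $x$. $\varphi$ is of uniformly upper type $p$ (resp. uniformly lower type $p$), $p\in[0,\infty)$, if there is $C>0$ such that $\varphi(x,\sigma t)\le C\sigma^p\varphi(x,t)$ for all $x\in\mathbb{R}^n$, $t\in[0,\infty)$ and $\sigma\in[1,\infty)$ (resp. $\sigma\in[0,1]$). $i(\varphi):=\sup\{p\in(0,\infty):\varphi\text{ is of uniformly lower type }p\}$. Muckenhoupt condition: $\varphi\in\mathbb{A}_q(\mathbb{R}^n)$, $q\in[1,\infty)$, means that $\varphi$ is uniformly locally integrable, i.e. for all compact $K\subset\mathbb{R}^n$, $\int_K\sup_{t\in(0,\infty)}\{\varphi(x,t)[\int_K\varphi(y,t)\,dy]^{-1}\}\,dx<\infty$, and that $$\sup_{t\in(0,\infty)}\sup_{B}\frac{1}{|B|^q}\int_B\varphi(x,t)\,dx\left\{\int_B[\varphi(y,t)]^{-q'/q}\,dy\right\}^{q/q'}<\infty\quad(q\in(1,\infty)),$$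 $$\sup_{t\in(0,\infty)}\sup_{B}\frac1{|B|}\int_B\varphi(x,t)\,dx\left(\operatorname{ess\,sup}_{y\in B}[\varphi(y,t)]^{-1}\right)<\infty\quad(q=1),$$ with $B$ running over all balls. $\mathbb{A}_\infty(\mathbb{R}^n)=\bigcup_{q\in[1,\infty)}\mathbb{A}_q(\mathbb{R}^n)$; $q(\varphi):=\inf\{q\in[1,\infty):\varphi\in\mathbb{A}_q(\mathbb{R}^n)\}$. Growth function: $\varphi:\mathbb{R}^n\times[0,\infty)\to[0,\infty)$ such that (i) $\varphi(x,\cdot)$ is an Orlicz function for all $x$ and $\varphi(\cdot,t)$ is measurable for all $t$; (ii) $\varphi\in\mathbb{A}_\infty(\mathbb{R}^n)$; (iii) $\varphi$ is of uniformly lower type $p$ for some $p\in(0,1]$ and of uniformly upper type $1$. Set $m(\varphi):=\lfloor n(\frac{q(\varphi)}{i(\varphi)}-1)\rfloor$. Uniformly locally dominated convergence condition: for every compact $K\subset\mathbb{R}^n$ and every sequence $\{f_m\}_{m}$ of measurable functions with $f_m(x)\to f(x)$ for almost every $x\in\mathbb{R}^n$, if there is a nonnegative measurable $g$ with $|f_m(x)|\le g(x)$ for all $m$ and almost every $x\in\mathbb{R}^n$ and $\sup_{t>0}\int_Kg(x)\frac{\varphi(x,t)}{\int_K\varphi(y,t)\,dy}\,dx<\infty$, then $\sup_{t>0}\int_K|f_m(x)-f(x)|\frac{\varphi(x,t)}{\int_K\varphi(y,t)\,dy}\,dx\to0$ as $m\to\infty$. For a ball $B$, $\|\chi_B\|_{L^\varphi(\mathbb{R}^n)}:=\inf\{\lambda\in(0,\infty):\int_B\varphi(x,1/\lambda)\,dx\le1\}$.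 $\mathcal{P}_s(\mathbb{R}^n)$ is the set of polynomials on $\mathbb{R}^n$ of degree at most $s$. For a locally integrable $g$ and a ball $B$, $P_B^sg$ is the unique $P\in\mathcal{P}_s(\mathbb{R}^n)$ with $\int_B[g(x)-P(x)]Q(x)\,dx=0$ for all $Q\in\mathcal{P}_s(\mathbb{R}^n)$. For $q\in[1,\infty)$ and $s\in\mathbb{Z}_+$, the Musielak-Orlicz Campanato space $\mathcal{L}_{\varphi,q,s}(\mathbb{R}^n)$ is the space of locally integrable $f$ with $$\|f\|_{\mathcal{L}_{\varphi,q,s}(\mathbb{R}^n)}:=\sup_{B\subset\mathbb{R}^n}\frac{1}{\|\chi_B\|_{L^\varphi(\mathbb{R}^n)}}\left\{\int_B\left[\frac{|f(x)-P_B^sf(x)|}{\varphi(x,\|\chi_B\|_{L^\varphi(\mathbb{R}^n)}^{-1})}\right]^q\varphi\left(x,\|\chi_B\|_{L^\varphi(\mathbb{R}^n)}^{-1}\right)dx\right\}^{1/q}<\infty,$$ supremum over all balls $B$; by convention $f\in\mathcal{L}_{\varphi,q,s}(\mathbb{R}^n)$ is identified with $f+\mathcal{P}_s(\mathbb{R}^n)$. *)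

theory Defs
  imports "HOL-Analysis.Analysis" "HOL-Probability.Essential_Supremum"
begin

text \<open>
  Functions \<open>\<phi> : \<real>\<^sup>n \<times> [0,\<infinity>) \<rightarrow> [0,\<infinity>)\<close> are represented by curried functions whose second argument ranges
  over all reals; only its values at \<open>t \<ge> 0\<close> are ever used. The dimension \<open>n\<close> is \<open>CARD('n)\<close>.
  Measurability and integrals refer to Lebesgue measure. Integrals of nonnegative functions are
  taken in \<open>[0,\<infinity>]\<close>.
\<close>

definition orlicz_function :: "(real \<Rightarrow> real) \<Rightarrow> bool" where
  "orlicz_function \<Phi> \<longleftrightarrow>
     (\<forall>t\<ge>0. 0 \<le> \<Phi> t) \<and> mono_on {0..} \<Phi> \<and> \<Phi> 0 = 0 \<and> (\<forall>t>0. 0 < \<Phi> t) \<and>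
     filterlim \<Phi> at_top at_top"

definition uniformly_upper_type :: "real \<Rightarrow> (real^'n \<Rightarrow> real \<Rightarrow> real) \<Rightarrow> bool" where
  "uniformly_upper_type p \<phi> \<longleftrightarrow>
     (\<exists>C>0. \<forall>x. \<forall>t\<ge>0. \<forall>\<sigma>\<ge>1. \<phi> x (\<sigma> * t) \<le> C * \<sigma> powr p * \<phi> x t)"

definition uniformly_lower_type :: "real \<Rightarrow> (real^'n \<Rightarrow> real \<Rightarrow> real) \<Rightarrow> bool" where
  "uniformly_lower_type p \<phi> \<longleftrightarrow>
     (\<exists>C>0. \<forall>x. \<forall>t\<ge>0. \<forall>\<sigma>\<in>{0..1}. \<phi> x (\<sigma> * t) \<le> C * \<sigma> powr p * \<phi> x t)"

definition lower_type_index :: "(real^'n \<Rightarrow> real \<Rightarrow> real) \<Rightarrow> real" where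
  "lower_type_index \<phi> = Sup {p. 0 < p \<and> uniformly_lower_type p \<phi>}"

definition ennreal_powr :: "ennreal \<Rightarrow> real \<Rightarrow> ennreal" where
  \<comment> \<open>only used with exponent \<open>a > 0\<close>\<close>
  "ennreal_powr x a = (if x = top then top else ennreal (enn2real x powr a))"

definition conjugate_index :: "real \<Rightarrow> ereal" where
  "conjugate_index r = (if r = 1 then \<infinity> else ereal (r / (r - 1)))"

definition normalized :: "(real^'n \<Rightarrow> real \<Rightarrow> real) \<Rightarrow> (real^'n) set \<Rightarrow> real^'n \<Rightarrow> real \<Rightarrow> ennreal" where
  "normalized \<phi> K x t = ennreal (\<phi> x t) / (\<integral>\<^sup>+y\<in>K. ennreal (\<phi> y t) \<partial>lebesgue)"

text \<open>
  The supremum over the uncountable set of all \<open>t\<close> below need not be measurable in \<open>x\<close>, in which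
  case the integral is a lower integral. For \<open>\<phi>\<close> of uniformly upper type 1 that supremum is
  comparable with the (measurable) supremum over rational \<open>t\<close>, so finiteness does not depend on
  this reading.
\<close>

definition uniformly_locally_integrable :: "(real^'n \<Rightarrow> real \<Rightarrow> real) \<Rightarrow> bool" where
  "uniformly_locally_integrable \<phi> \<longleftrightarrow>
     (\<forall>K. compact K \<longrightarrow> (\<integral>\<^sup>+x\<in>K. (SUP t\<in>{0<..}. normalized \<phi> K x t) \<partial>lebesgue) < top)"

definition muckenhoupt_quantity ::
  "real \<Rightarrow> (real^'n \<Rightarrow> real \<Rightarrow> real) \<Rightarrow> real \<Rightarrow> (real^'n) set \<Rightarrow> ennreal" where
  "muckenhoupt_quantity q \<phi> t B =
     (if q = 1 then
        ennreal (1 / measure lebesgue B) * (\<integral>\<^sup>+x\<in>B. ennreal (\<phi> x t) \<partial>lebesgue) *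
        esssup (restrict_space lebesgue B) (\<lambda>y. ennreal (inverse (\<phi> y t)))
      else let q' = q / (q - 1) in
        ennreal (1 / measure lebesgue B powr q) * (\<integral>\<^sup>+x\<in>B. ennreal (\<phi> x t) \<partial>lebesgue) *
        ennreal_powr (\<integral>\<^sup>+y\<in>B. ennreal (\<phi> y t powr (- (q' / q))) \<partial>lebesgue) (q / q'))"

definition muckenhoupt :: "real \<Rightarrow> (real^'n \<Rightarrow> real \<Rightarrow> real) \<Rightarrow> bool" where
  "muckenhoupt q \<phi> \<longleftrightarrow>
     uniformly_locally_integrable \<phi> \<and>
     (SUP t\<in>{0<..}. SUP (z, r)\<in>UNIV \<times> {0<..}. muckenhoupt_quantity q \<phi> t (ball z r)) < top"

definition muckenhoupt_infty :: "(real^'n \<Rightarrow> real \<Rightarrow> real) \<Rightarrow> bool" where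
  "muckenhoupt_infty \<phi> \<longleftrightarrow> (\<exists>q\<ge>1. muckenhoupt q \<phi>)"

definition muckenhoupt_index :: "(real^'n \<Rightarrow> real \<Rightarrow> real) \<Rightarrow> real" where
  "muckenhoupt_index \<phi> = Inf {q. 1 \<le> q \<and> muckenhoupt q \<phi>}"

definition growth_function :: "(real^'n \<Rightarrow> real \<Rightarrow> real) \<Rightarrow> bool" where
  "growth_function \<phi> \<longleftrightarrow>
     (\<forall>x. orlicz_function (\<phi> x)) \<and>
     (\<forall>t\<ge>0. (\<lambda>x. \<phi> x t) \<in> borel_measurable lebesgue) \<and>
     muckenhoupt_infty \<phi> \<and>
     (\<exists>p. 0 < p \<and> p \<le> 1 \<and> uniformly_lower_type p \<phi>) \<and>
     uniformly_upper_type 1 \<phi>"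

text \<open>
  For growth functions \<open>q(\<phi>) \<ge> 1\<close> and \<open>0 < i(\<phi>) \<le> 1\<close>, so the floor is nonnegative and \<^const>\<open>nat\<close>
  truncates nothing.
\<close>

definition moment_index :: "(real^'n \<Rightarrow> real \<Rightarrow> real) \<Rightarrow> nat" where
  "moment_index \<phi> =
     nat \<lfloor>real CARD('n) * (muckenhoupt_index \<phi> / lower_type_index \<phi> - 1)\<rfloor>"

text \<open>
  Stated for real-valued sequences. The complex-valued version is equivalent: apply this one to
  \<open>\<bar>f\<^sub>m - f\<bar>\<close> with limit \<open>0\<close> and majorant \<open>2 g\<close>. The limit function is measurable automatically, Lebesgue
  measure being complete.
\<close>

definition uniformly_locally_dominated_convergence :: "(real^'n \<Rightarrow> real \<Rightarrow> real) \<Rightarrow> bool" where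
  "uniformly_locally_dominated_convergence \<phi> \<longleftrightarrow>
     (\<forall>(K :: (real^'n) set) (F :: nat \<Rightarrow> real^'n \<Rightarrow> real) (f :: real^'n \<Rightarrow> real).
        compact K \<and> (\<forall>m. F m \<in> borel_measurable lebesgue) \<and>
        (AE x in lebesgue. (\<lambda>m. F m x) \<longlonglongrightarrow> f x) \<and>
        (\<exists>g. g \<in> borel_measurable lebesgue \<and> (\<forall>x. 0 \<le> g x) \<and>
             (\<forall>m. AE x in lebesgue. \<bar>F m x\<bar> \<le> g x) \<and>
             (SUP t\<in>{0<..}. \<integral>\<^sup>+x\<in>K. ennreal (g x) * normalized \<phi> K x t \<partial>lebesgue) < top)
        \<longrightarrow> (\<lambda>m. SUP t\<in>{0<..}. \<integral>\<^sup>+x\<in>K. ennreal \<bar>F m x - f x\<bar> * normalized \<phi> K x t \<partial>lebesgue)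
              \<longlonglongrightarrow> 0)"

definition chi_norm :: "(real^'n \<Rightarrow> real \<Rightarrow> real) \<Rightarrow> (real^'n) set \<Rightarrow> real" where
  "chi_norm \<phi> B = Inf {l. 0 < l \<and> (\<integral>\<^sup>+x\<in>B. ennreal (\<phi> x (1 / l)) \<partial>lebesgue) \<le> 1}"

text \<open>
  Functions in the Campanato spaces take values in a type \<open>'b\<close> of sort
  \<open>{real_normed_field, euclidean_space}\<close>; the instances are the real and the complex numbers.
  Polynomials have coefficients in \<open>'b\<close>; \<open>\<alpha>\<close> ranges over multi-indices.
\<close>

definition polys_le :: "nat \<Rightarrow> (real^'n \<Rightarrow> 'b::{real_normed_field, euclidean_space}) set" where
  "polys_le s =
     range (\<lambda>c x. \<Sum>\<alpha> | (\<Sum>i\<in>UNIV. \<alpha> i) \<le> s. (\<Prod>i\<in>UNIV. (x $ i) ^ \<alpha> i) *\<^sub>R c (\<alpha> :: 'n \<Rightarrow> nat))"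

lemma finite_multi_indices_le: "finite {\<alpha> :: 'n::finite \<Rightarrow> nat. (\<Sum>i\<in>UNIV. \<alpha> i) \<le> s}"
proof (rule finite_subset)
  show "{\<alpha> :: 'n \<Rightarrow> nat. (\<Sum>i\<in>UNIV. \<alpha> i) \<le> s} \<subseteq> PiE UNIV (\<lambda>_. {..s})"
  proof
    fix \<alpha> :: "'n \<Rightarrow> nat"
    assume "\<alpha> \<in> {\<alpha>. (\<Sum>i\<in>UNIV. \<alpha> i) \<le> s}"
    then have *: "(\<Sum>i\<in>UNIV. \<alpha> i) \<le> s" by simp
    have "\<alpha> i \<le> s" for i
      by (rule order_trans[OF member_le_sum *]) simp_all
    then show "\<alpha> \<in> PiE UNIV (\<lambda>_. {..s})" by (simp add: PiE_iff)
  qed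
  show "finite (PiE (UNIV :: 'n set) (\<lambda>_. {..s}))"
    by (rule finite_PiE) simp_all
qed

definition locally_integrable :: "(real^'n \<Rightarrow> 'b::{real_normed_field, euclidean_space}) \<Rightarrow> bool" where
  "locally_integrable f \<longleftrightarrow> (\<forall>K. compact K \<longrightarrow> set_integrable lebesgue K f)"

definition poly_proj ::
  "nat \<Rightarrow> (real^'n) set \<Rightarrow> (real^'n \<Rightarrow> 'b) \<Rightarrow> real^'n \<Rightarrow> 'b::{real_normed_field, euclidean_space}" where
  "poly_proj s B g =
     (THE P. P \<in> polys_le s \<and> (\<forall>Q\<in>polys_le s. (LINT x:B|lebesgue. (g x - P x) * Q x) = 0))"

definition campanato_norm ::
  "(real^'n \<Rightarrow> real \<Rightarrow> real) \<Rightarrow> real \<Rightarrow> nat \<Rightarrow>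
   (real^'n \<Rightarrow> 'b::{real_normed_field, euclidean_space}) \<Rightarrow> ennreal" where
  "campanato_norm \<phi> q s f =
     (SUP (z, r)\<in>UNIV \<times> {0<..}. let B = ball z r; N = chi_norm \<phi> B in
        ennreal (1 / N) *
        ennreal_powr
          (\<integral>\<^sup>+x\<in>B. ennreal ((norm (f x - poly_proj s B f x) / \<phi> x (1 / N)) powr q * \<phi> x (1 / N))
             \<partial>lebesgue)
          (1 / q))"

definition campanato ::
  "(real^'n \<Rightarrow> real \<Rightarrow> real) \<Rightarrow> real \<Rightarrow> nat \<Rightarrow>
   (real^'n \<Rightarrow> 'b::{real_normed_field, euclidean_space}) set" where
  "campanato \<phi> q s = {f. locally_integrable f \<and> campanato_norm \<phi> q s f < top}"

text \<open>
  Equality modulo \<open>\<P>\<^sub>s\<close> of elements of \<open>\<L>\<^bsub>\<phi>,q,s\<^esub>\<close>. Locally integrable functions are identified, as usual,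
  when they agree almost everywhere.
\<close>

definition campanato_rel ::
  "(real^'n \<Rightarrow> real \<Rightarrow> real) \<Rightarrow> real \<Rightarrow> nat \<Rightarrow>
   ((real^'n \<Rightarrow> 'b::{real_normed_field, euclidean_space}) \<times> (real^'n \<Rightarrow> 'b)) set" where
  "campanato_rel \<phi> q s =
     {(f, g). f \<in> campanato \<phi> q s \<and> g \<in> campanato \<phi> q s \<and>
              (\<exists>P\<in>polys_le s. AE x in lebesgue. g x = f x + P x)}"

end

theory Submission
  imports Defs
begin

text \<open>
  Write \<open>N(B)\<close> for the norm of the characteristic function of the ball \<open>B\<close>. For \<open>q = 1\<close> the weight cancels,
  and the Campanato norm is the least \<open>K\<close> such that \<open>f\<close> has an approximating polynomial on every ball \<open>B\<close>
  with \<open>L\<^sup>1\<close> error at most \<open>K N(B)\<close>. The theorem splits into two independent facts about such functions.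
  
  Changing \<open>q\<close>. Put \<open>w = \<phi>(\<cdot>, 1/N(B\<^sub>0))\<close> for a fixed ball \<open>B\<^sub>0\<close>; this weight has mass comparable to \<open>1\<close> on
  \<open>B\<^sub>0\<close>. The upper type \<open>1\<close> gives \<open>N(B) \<lesssim> N(B\<^sub>0) w(B)\<close> for \<open>B \<subseteq> B\<^sub>0\<close>, so inside \<open>B\<^sub>0\<close> the function \<open>f\<close> has
  \<open>L\<^sup>1\<close> oscillation at most a constant times \<open>w(B)\<close>: it belongs to the weighted space BMO of
  Muckenhoupt and Wheeden. Their version of the John--Nirenberg inequality says that then also
  \<open>\<integral> \<bar>f - P\<bar>\<^sup>q w\<^bsup>1-q\<^esup> \<lesssim> w(B\<^sub>0)\<close> as soon as \<open>w\<close> is in the Muckenhoupt class of the exponent conjugate to \<open>q\<close>,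
  and this is what \<open>q < q(\<phi>)'\<close> provides. It is proved here by a Calderon--Zygmund stopping time on dyadic
  cubes (\<open>energy_improves\<close>, \<open>john_nirenberg\<close>) and carried over to balls in
  \<open>weighted_john_nirenberg_balls\<close>. The converse estimate is Hoelder's inequality.
  
  Changing the degree. By the Muckenhoupt condition and the lower type, \<open>N\<close> grows at most like
  \<open>N(\<lambda>B) \<lesssim> \<lambda>\<^bsup>nr/p\<^esup> N(B)\<close> for suitable \<open>r\<close> near \<open>q(\<phi>)\<close> and \<open>p\<close> near \<open>i(\<phi>)\<close>. The definition of \<open>m = m(\<phi>)\<close> makes
  \<open>nr/p < n + m + 1\<close> possible. For approximating polynomials \<open>P\<^sub>k\<close> on the balls \<open>2\<^sup>kB\<close>, the coefficients of
  degree \<open>j\<close> of \<open>P\<^bsub>k+1\<^esub> - P\<^sub>k\<close> are of size \<open>2\<^bsup>-k(n+j)\<^esup> N(2\<^sup>kB)\<close>, so for \<open>j > m\<close> they sum to a geometric series.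
  Hence all the polynomials \<open>P\<^sub>B\<close> have, modulo degree \<open>m\<close>, one common limit \<open>R\<close>, and \<open>f - R\<close> is approximated by
  polynomials of degree \<open>m\<close> (\<open>degree_reduction\<close>). The same decay shows that a polynomial which is itself
  approximable to that precision by polynomials of degree \<open>m\<close> has degree at most \<open>m\<close> (\<open>rigidity\<close>): this
  gives injectivity modulo polynomials, and forces \<open>R\<close> into degree \<open>m\<close> when \<open>f\<close> already lies in the smaller space.
\<close>

section \<open>Polynomials of bounded degree\<close>

definition multi_indices :: "nat \<Rightarrow> ('n::finite \<Rightarrow> nat) set" where
  "multi_indices s = {\<alpha>. (\<Sum>i\<in>UNIV. \<alpha> i) \<le> s}"

definition monomial :: "('n::finite \<Rightarrow> nat) \<Rightarrow> real^'n \<Rightarrow> real" where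
  "monomial \<alpha> x = (\<Prod>i\<in>UNIV. (x $ i) ^ \<alpha> i)"

lemma finite_multi_indices [simp]: "finite (multi_indices s)"
  unfolding multi_indices_def by (rule finite_multi_indices_le)

lemma multi_indices_mono: "s \<le> t \<Longrightarrow> multi_indices s \<subseteq> multi_indices t"
  by (auto simp: multi_indices_def)

lemma polys_le_iff:
  "p \<in> polys_le s \<longleftrightarrow> (\<exists>c. \<forall>x. p x = (\<Sum>\<alpha>\<in>multi_indices s. monomial \<alpha> x *\<^sub>R c \<alpha>))"
  unfolding polys_le_def multi_indices_def monomial_def by (auto simp: fun_eq_iff)

lemma polys_leE:
  assumes "p \<in> polys_le s"
  obtains c where "\<And>x. p x = (\<Sum>\<alpha>\<in>multi_indices s. monomial \<alpha> x *\<^sub>R c \<alpha>)"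
  using assms by (auto simp: polys_le_iff)

lemma polys_le_zero: "(\<lambda>x. 0) \<in> polys_le s"
  unfolding polys_le_iff by (rule exI[of _ "\<lambda>_. 0"]) simp

lemma polys_le_add:
  assumes "p \<in> polys_le s" "q \<in> polys_le s"
  shows "(\<lambda>x. p x + q x) \<in> polys_le s"
proof -
  obtain c d where "\<And>x. p x = (\<Sum>\<alpha>\<in>multi_indices s. monomial \<alpha> x *\<^sub>R c \<alpha>)"
    "\<And>x. q x = (\<Sum>\<alpha>\<in>multi_indices s. monomial \<alpha> x *\<^sub>R d \<alpha>)"
    using assms by (metis polys_leE)
  then show ?thesis
    unfolding polys_le_iff
    by (intro exI[of _ "\<lambda>\<alpha>. c \<alpha> + d \<alpha>"]) (simp add: scaleR_add_right sum.distrib)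
qed

lemma polys_le_scaleR:
  assumes "p \<in> polys_le s"
  shows "(\<lambda>x. a *\<^sub>R p x) \<in> polys_le s"
proof -
  obtain c where "\<And>x. p x = (\<Sum>\<alpha>\<in>multi_indices s. monomial \<alpha> x *\<^sub>R c \<alpha>)"
    using assms by (metis polys_leE)
  then show ?thesis
    unfolding polys_le_iff
    by (intro exI[of _ "\<lambda>\<alpha>. a *\<^sub>R c \<alpha>"]) (simp add: scaleR_sum_right mult.commute)
qed

lemma polys_le_uminus: "p \<in> polys_le s \<Longrightarrow> (\<lambda>x. - p x) \<in> polys_le s"
  using polys_le_scaleR[of p s "-1"] by simp

lemma polys_le_diff: "p \<in> polys_le s \<Longrightarrow> q \<in> polys_le s \<Longrightarrow> (\<lambda>x. p x - q x) \<in> polys_le s"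
  using polys_le_add[OF _ polys_le_uminus, of p s q] by simp

lemma polys_le_sum:
  assumes "\<And>i. i \<in> I \<Longrightarrow> p i \<in> polys_le s"
  shows "(\<lambda>x. \<Sum>i\<in>I. p i x) \<in> polys_le s"
  using assms by (induction I rule: infinite_finite_induct) (auto intro: polys_le_zero polys_le_add)

lemma polys_le_monomial:
  assumes "\<alpha> \<in> multi_indices s"
  shows "(\<lambda>x. monomial \<alpha> x *\<^sub>R a) \<in> polys_le s"
  unfolding polys_le_iff
proof (intro exI allI)
  fix x
  show "monomial \<alpha> x *\<^sub>R a = (\<Sum>\<beta>\<in>multi_indices s. monomial \<beta> x *\<^sub>R (if \<beta> = \<alpha> then a else 0))"
    using assms by (subst sum.cong[OF refl, where h = "\<lambda>\<beta>. if \<beta> = \<alpha> then monomial \<alpha> x *\<^sub>R a else 0"])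
      (auto)
qed

lemma polys_le_mono: "s \<le> t \<Longrightarrow> polys_le s \<subseteq> polys_le t"
proof
  fix p :: "real^'n \<Rightarrow> 'b::{real_normed_field, euclidean_space}"
  assume "s \<le> t" "p \<in> polys_le s"
  then obtain c where c: "\<And>x. p x = (\<Sum>\<alpha>\<in>multi_indices s. monomial \<alpha> x *\<^sub>R c \<alpha>)"
    by (metis polys_leE)
  have "(\<lambda>x. \<Sum>\<alpha>\<in>multi_indices s. monomial \<alpha> x *\<^sub>R c \<alpha>) \<in> polys_le t"
    using multi_indices_mono[OF \<open>s \<le> t\<close>] by (intro polys_le_sum polys_le_monomial) auto
  then show "p \<in> polys_le t"
    unfolding c[abs_def, symmetric] by (simp add: c[symmetric])
qed

lemma polys_le_const: "(\<lambda>x. a) \<in> polys_le s"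
  using polys_le_monomial[of "\<lambda>_. 0" s a] by (simp add: multi_indices_def monomial_def)

lemma monomial_add: "monomial (\<lambda>i. \<alpha> i + \<beta> i) x = monomial \<alpha> x * monomial \<beta> x"
  by (simp add: monomial_def power_add prod.distrib)

lemma polys_le_mult:
  fixes q :: "real^'n \<Rightarrow> real" and p :: "real^'n \<Rightarrow> 'b::{real_normed_field, euclidean_space}"
  assumes "q \<in> polys_le a" "p \<in> polys_le b"
  shows "(\<lambda>x. q x *\<^sub>R p x) \<in> polys_le (a + b)"
proof -
  obtain c d where q: "\<And>x. q x = (\<Sum>\<alpha>\<in>multi_indices a. monomial \<alpha> x *\<^sub>R c \<alpha>)"
    and p: "\<And>x. p x = (\<Sum>\<alpha>\<in>multi_indices b. monomial \<alpha> x *\<^sub>R d \<alpha>)"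
    using assms by (metis polys_leE)
  have "q x *\<^sub>R p x = (\<Sum>\<alpha>\<in>multi_indices a. \<Sum>\<beta>\<in>multi_indices b.
      monomial (\<lambda>i. \<alpha> i + \<beta> i) x *\<^sub>R (c \<alpha> *\<^sub>R d \<beta>))" for x
    unfolding q p scaleR_sum_left unfolding scaleR_sum_right
    by (simp add: monomial_add ac_simps)
  moreover have "(\<lambda>x. \<Sum>\<alpha>\<in>multi_indices a. \<Sum>\<beta>\<in>multi_indices b.
      monomial (\<lambda>i. \<alpha> i + \<beta> i) x *\<^sub>R (c \<alpha> *\<^sub>R d \<beta>)) \<in> polys_le (a + b)"
    by (intro polys_le_sum polys_le_monomial) (auto simp: multi_indices_def sum.distrib)
  ultimately show ?thesis by simp
qed

text \<open>
  The class is invariant under translations and dilations, which is what reduces every estimate on a ball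
  to one on the unit ball. Each coordinate of an affine map is a polynomial of degree 1, so a monomial
  becomes a product of such factors.
\<close>

lemma polys_le_affine:
  fixes p :: "real^'n \<Rightarrow> 'b::{real_normed_field, euclidean_space}"
  assumes "p \<in> polys_le s"
  shows "(\<lambda>x. p (z + \<rho> *\<^sub>R x)) \<in> polys_le s"
proof -
  have coord: "(\<lambda>x::real^'n. x $ i) \<in> polys_le 1" for i
  proof -
    have "(\<lambda>x::real^'n. x $ i) = (\<lambda>x. monomial (\<lambda>j. if j = i then 1 else 0) x *\<^sub>R (1::real))"
    proof
      fix x :: "real^'n"
      have "(\<Prod>j\<in>UNIV. (x $ j) ^ (if j = i then 1 else 0)) = (\<Prod>j\<in>UNIV. if j = i then x $ j else 1)"
        by (intro prod.cong) auto
      then show "x $ i = monomial (\<lambda>j. if j = i then 1 else 0) x *\<^sub>R (1::real)"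
        by (simp add: monomial_def)
    qed
    moreover have "\<dots> \<in> polys_le 1"
      by (intro polys_le_monomial) (simp add: multi_indices_def)
    ultimately show ?thesis by simp
  qed
  have lin: "(\<lambda>x::real^'n. (z + \<rho> *\<^sub>R x) $ i) \<in> polys_le 1" for i
    using polys_le_add[OF polys_le_const[of "z $ i"] polys_le_scaleR[OF coord, of \<rho> i]] by simp
  have pow: "(\<lambda>x::real^'n. ((z + \<rho> *\<^sub>R x) $ i) ^ k) \<in> polys_le k" for i k
  proof (induction k)
    case 0 show ?case by (simp add: polys_le_const)
  next
    case (Suc k)
    show ?case using polys_le_mult[OF lin[of i] Suc] by simp
  qed
  have "(\<lambda>x::real^'n. \<Prod>i\<in>S. ((z + \<rho> *\<^sub>R x) $ i) ^ \<alpha> i) \<in> polys_le (\<Sum>i\<in>S. \<alpha> i)"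
    if "finite S" for S and \<alpha> :: "'n \<Rightarrow> nat"
    using that
  proof (induction S rule: finite_induct)
    case empty show ?case by (simp add: polys_le_const)
  next
    case (insert i S)
    show ?case using polys_le_mult[OF pow[of i "\<alpha> i"] insert.IH] insert.hyps by simp
  qed
  then have mon: "(\<lambda>x::real^'n. monomial \<alpha> (z + \<rho> *\<^sub>R x)) \<in> polys_le (\<Sum>i\<in>UNIV. \<alpha> i)" for \<alpha> :: "'n \<Rightarrow> nat"
    unfolding monomial_def by simp
  obtain c where p: "\<And>x. p x = (\<Sum>\<alpha>\<in>multi_indices s. monomial \<alpha> x *\<^sub>R c \<alpha>)"
    using assms by (metis polys_leE)
  have "(\<lambda>x. \<Sum>\<alpha>\<in>multi_indices s. monomial \<alpha> (z + \<rho> *\<^sub>R x) *\<^sub>R c \<alpha>) \<in> polys_le s"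
  proof (intro polys_le_sum)
    fix \<alpha> :: "'n \<Rightarrow> nat" assume "\<alpha> \<in> multi_indices s"
    then have "polys_le ((\<Sum>i\<in>UNIV. \<alpha> i) + 0) \<subseteq> (polys_le s :: (real^'n \<Rightarrow> 'b) set)"
      by (intro polys_le_mono) (simp add: multi_indices_def)
    with polys_le_mult[OF mon polys_le_const]
    show "(\<lambda>x. monomial \<alpha> (z + \<rho> *\<^sub>R x) *\<^sub>R c \<alpha>) \<in> polys_le s" by blast
  qed
  then show ?thesis by (simp add: p[symmetric])
qed

lemma continuous_on_monomial: "continuous_on S (monomial \<alpha>)"
  unfolding monomial_def by (intro continuous_intros)

lemma continuous_on_polys_le:
  assumes "p \<in> polys_le s" shows "continuous_on S p"
proof -
  obtain c where "\<And>x. p x = (\<Sum>\<alpha>\<in>multi_indices s. monomial \<alpha> x *\<^sub>R c \<alpha>)"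
    using assms by (metis polys_leE)
  then have "p = (\<lambda>x. \<Sum>\<alpha>\<in>multi_indices s. monomial \<alpha> x *\<^sub>R c \<alpha>)" by auto
  then show ?thesis
    by (auto intro!: continuous_intros continuous_on_monomial)
qed

lemma monomial_scaleR: "monomial \<alpha> (t *\<^sub>R x) = t ^ (\<Sum>i\<in>UNIV. \<alpha> i) * monomial \<alpha> x"
  by (simp add: monomial_def power_mult_distrib prod.distrib power_sum)

text \<open>
  On every line through \<open>z\<close> the polynomial becomes a one-variable polynomial over the field \<open>'b\<close> with
  infinitely many roots.
\<close>

lemma polys_le_eq_zeroI:
  fixes p :: "real^'n \<Rightarrow> 'b::{real_normed_field, euclidean_space}"
  assumes p: "p \<in> polys_le s" and \<rho>: "0 < \<rho>" and zero: "\<And>x. x \<in> ball z \<rho> \<Longrightarrow> p x = 0"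
  shows "p x = 0"
proof -
  define v where "v = x - z"
  obtain c where c: "\<And>y. p (z + 1 *\<^sub>R y) = (\<Sum>\<alpha>\<in>multi_indices s. monomial \<alpha> y *\<^sub>R c \<alpha>)"
    using polys_leE[OF polys_le_affine[OF p, of z 1]] by blast
  define d where
    "d j = (\<Sum>\<alpha>\<in>multi_indices s. if (\<Sum>i\<in>UNIV. \<alpha> i) = j then monomial \<alpha> v *\<^sub>R c \<alpha> else 0)" for j
  have line: "p (z + t *\<^sub>R v) = (\<Sum>j\<le>s. d j * of_real t ^ j)" for t
  proof -
    have "(\<Sum>j\<le>s. d j * of_real t ^ j) = (\<Sum>j\<le>s. \<Sum>\<alpha>\<in>multi_indices s.
        if (\<Sum>i\<in>UNIV. \<alpha> i) = j then of_real t ^ j * monomial \<alpha> v *\<^sub>R c \<alpha> else 0)"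
      unfolding d_def sum_distrib_right by (intro sum.cong refl) (simp add: mult.commute)
    also have "\<dots> = (\<Sum>\<alpha>\<in>multi_indices s. \<Sum>j\<le>s.
        if (\<Sum>i\<in>UNIV. \<alpha> i) = j then of_real t ^ j * monomial \<alpha> v *\<^sub>R c \<alpha> else 0)"
      by (rule sum.swap)
    also have "\<dots> = (\<Sum>\<alpha>\<in>multi_indices s. monomial \<alpha> (t *\<^sub>R v) *\<^sub>R c \<alpha>)"
      by (intro sum.cong refl)
        (simp add: multi_indices_def monomial_scaleR flip: of_real_power scaleR_conv_of_real)
    finally show ?thesis using c[of "t *\<^sub>R v"] by simp
  qed
  obtain e where e: "0 < e" "\<And>t. \<bar>t\<bar> < e \<Longrightarrow> z + t *\<^sub>R v \<in> ball z \<rho>"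
  proof (rule that[of "\<rho> / (norm v + 1)"])
    show "0 < \<rho> / (norm v + 1)" using \<rho> by (simp add: add_nonneg_pos)
    fix t :: real assume "\<bar>t\<bar> < \<rho> / (norm v + 1)"
    then have "\<bar>t\<bar> * (norm v + 1) < \<rho>"
      by (subst (asm) pos_less_divide_eq) (auto simp: add_nonneg_pos)
    moreover have "\<bar>t\<bar> * norm v \<le> \<bar>t\<bar> * (norm v + 1)" by (intro mult_left_mono) auto
    ultimately show "z + t *\<^sub>R v \<in> ball z \<rho>" by (simp add: dist_norm)
  qed
  have "infinite ((of_real :: real \<Rightarrow> 'b) ` {0<..<e})"
    using \<open>0 < e\<close> by (simp add: finite_image_iff inj_on_def)
  moreover have "of_real ` {0<..<e} \<subseteq> {w::'b. (\<Sum>j\<le>s. d j * w ^ j) = 0}"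
    using e zero line by (auto simp: subset_iff) (metis abs_of_pos)
  ultimately have "infinite {w::'b. (\<Sum>j\<le>s. d j * w ^ j) = 0}"
    using finite_subset by blast
  then have "\<forall>j\<le>s. d j = 0" using polyfun_rootbound[where c = d and n = s] by blast
  then have "p (z + 1 *\<^sub>R v) = 0" unfolding line by (intro sum.neutral) auto
  then show ?thesis by (simp add: v_def)
qed

section \<open>Reproducing kernels and polynomial projections\<close>

lemma integrable_on_ball_continuous:
  fixes g :: "real^'n \<Rightarrow> 'b::euclidean_space"
  assumes "continuous_on UNIV g"
  shows "integrable (lebesgue_on (ball z \<rho>)) g"
proof -
  obtain a b where ab: "ball z \<rho> \<subseteq> cbox a b"
    using bounded_subset_cbox_symmetric[OF bounded_ball] by metis
  have "integrable (lebesgue_on (cbox a b)) g"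
    using assms by (intro continuous_imp_integrable) (auto intro: continuous_on_subset)
  then have "set_integrable lebesgue (cbox a b) g"
    by (simp add: integrable_restrict_space set_integrable_def)
  then have "set_integrable lebesgue (ball z \<rho>) g"
    by (rule set_integrable_subset) (use ab in auto)
  then show ?thesis
    by (simp add: integrable_restrict_space set_integrable_def)
qed

lemma continuous_zero_on_ball:
  fixes r :: "real^'n \<Rightarrow> real"
  assumes c: "continuous_on UNIV r" and int: "(LINT x|lebesgue_on (ball z \<rho>). r x * r x) = 0"
    and x: "x \<in> ball z \<rho>"
  shows "r x = 0"
proof (rule ccontr)
  assume nz: "r x \<noteq> 0"
  have "AE y in lebesgue_on (ball z \<rho>). r y * r y = 0"
    using int by (subst (asm) integral_nonneg_eq_0_iff_AE)
      (auto intro!: integrable_on_ball_continuous continuous_intros c)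
  then have "AE y in lebesgue. y \<in> ball z \<rho> \<longrightarrow> r y = 0"
    by (simp add: AE_restrict_space_iff)
  then obtain Z where Z: "Z \<in> null_sets lebesgue" "{y. \<not> (y \<in> ball z \<rho> \<longrightarrow> r y = 0)} \<subseteq> Z"
    by (auto simp: eventually_ae_filter)
  define U where "U = ball z \<rho> \<inter> r -` (- {0})"
  have "open U" unfolding U_def
    using c by (intro open_Int open_ball open_vimage) (auto)
  moreover have "x \<in> U" using x nz by (simp add: U_def)
  ultimately obtain e where "0 < e" "ball x e \<subseteq> U" by (metis openE)
  moreover have "U \<subseteq> Z" using Z(2) by (auto simp: U_def)
  ultimately have "negligible (ball x e)"
    using Z(1) by (meson negligible_iff_null_sets negligible_subset order_trans)
  then have "measure lebesgue (ball x e) = 0" by (rule negligible_imp_measure0)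
  then show False using \<open>0 < e\<close> by (simp add: content_ball unit_ball_vol_pos less_imp_neq[symmetric])
qed

text \<open>
  Gram--Schmidt in a form that avoids orthonormal bases: the symmetric kernel
  \<open>\<Sum> k i j (h i) (h j)\<close> represents the \<open>L\<^sup>2\<close>-orthogonal projection onto the span of the functions \<open>h i\<close>. Adding one
  more function \<open>h d\<close> with residual \<open>r\<close> changes the kernel by \<open>r \<otimes> r / \<integral>r\<^sup>2\<close>. Keeping the coefficients \<open>k\<close> explicit
  yields coefficient bounds for polynomials and the projections at the same time.
\<close>

lemma reproducing_kernel:
  fixes h :: "'i \<Rightarrow> real^'n \<Rightarrow> real" and z :: "real^'n" and \<rho> :: real
  defines "G f g \<equiv> LINT x|lebesgue_on (ball z \<rho>). f x * g x"
  assumes "finite I" and "\<And>i. i \<in> I \<Longrightarrow> continuous_on UNIV (h i)"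
  shows "\<exists>k. (\<forall>i\<in>I. \<forall>j\<in>I. k i j = k j i) \<and>
    (\<forall>l\<in>I. \<forall>x\<in>ball z \<rho>. h l x = (\<Sum>i\<in>I. \<Sum>j\<in>I. k i j * h i x * G (h j) (h l)))"
  using assms(2,3)
proof (induction I rule: finite_induct)
  case empty show ?case by simp
next
  case (insert d I)
  obtain k where sym: "\<And>i j. i \<in> I \<Longrightarrow> j \<in> I \<Longrightarrow> k i j = k j i"
    and rep: "\<And>l x. l \<in> I \<Longrightarrow> x \<in> ball z \<rho> \<Longrightarrow>
      h l x = (\<Sum>i\<in>I. \<Sum>j\<in>I. k i j * h i x * G (h j) (h l))"
    using insert.IH[OF insert.prems] by blast
  have cont: "continuous_on UNIV (h i)" if "i \<in> insert d I" for i
    using insert.prems that by blast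
  have Gsym: "G f g = G g f" for f g by (simp add: G_def mult.commute)
  have Gint: "integrable (lebesgue_on (ball z \<rho>)) (\<lambda>x. f x * g x)"
    if "continuous_on UNIV f" "continuous_on UNIV g" for f g :: "real^'n \<Rightarrow> real"
    using that by (intro integrable_on_ball_continuous continuous_intros)
  define a where "a i = (\<Sum>j\<in>I. k i j * G (h j) (h d))" for i
  \<comment> \<open>The part of \<open>h d\<close> orthogonal to the span of the previous functions.\<close>
  define r where "r x = h d x - (\<Sum>i\<in>I. a i * h i x)" for x
  have contr: "continuous_on UNIV r"
    unfolding r_def[abs_def] by (auto intro!: continuous_intros cont)
  have Gr: "G r g = G (h d) g - (\<Sum>i\<in>I. a i * G (h i) g)" if "continuous_on UNIV g" for g
  proof -
    have "G r g = (LINT x|lebesgue_on (ball z \<rho>). h d x * g x - (\<Sum>i\<in>I. a i * (h i x * g x)))"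
      unfolding G_def r_def by (intro Bochner_Integration.integral_cong refl)
        (simp add: left_diff_distrib sum_distrib_right mult.assoc)
    also have "\<dots> = G (h d) g - (\<Sum>i\<in>I. a i * G (h i) g)"
      unfolding G_def using that cont by (simp add: Gint)
    finally show ?thesis .
  qed
  have orth: "G r (h l) = 0" if l: "l \<in> I" for l
  proof -
    have "G (h d) (h l) = (LINT x|lebesgue_on (ball z \<rho>).
        (\<Sum>i\<in>I. \<Sum>j\<in>I. k i j * G (h j) (h l) * (h d x * h i x)))"
      unfolding G_def using l
      by (intro Bochner_Integration.integral_cong refl)
        (simp add: rep[unfolded G_def] sum_distrib_left ac_simps)
    also have "\<dots> = (\<Sum>i\<in>I. \<Sum>j\<in>I. k i j * G (h j) (h l) * G (h d) (h i))"
      unfolding G_def using cont by (simp add: Gint)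
    also have "\<dots> = (\<Sum>j\<in>I. \<Sum>i\<in>I. k i j * G (h j) (h l) * G (h d) (h i))"
      by (rule sum.swap)
    also have "\<dots> = (\<Sum>j\<in>I. a j * G (h j) (h l))"
      unfolding a_def sum_distrib_right
      by (intro sum.cong refl) (simp add: sym Gsym[of "h d"])
    finally show ?thesis using l cont by (simp add: Gr)
  qed
  have rr: "G r (h d) = G r r"
  proof -
    have "G r r = G (h d) r - (\<Sum>i\<in>I. a i * G (h i) r)" by (rule Gr[OF contr])
    moreover have "G (h i) r = 0" if "i \<in> I" for i using orth[OF that] by (subst Gsym)
    ultimately show ?thesis by (subst Gsym) simp
  qed
  have hd: "h d x = r x + (\<Sum>i\<in>I. \<Sum>j\<in>I. k i j * h i x * G (h j) (h d))" for x
    unfolding r_def a_def by (simp add: sum_distrib_right sum_distrib_left ac_simps)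
  define b where "b i = (if i = d then 1 else - a i)" for i
  have rb: "r x = (\<Sum>i\<in>insert d I. b i * h i x)" for x
  proof -
    have "(\<Sum>i\<in>I. b i * h i x) = (\<Sum>i\<in>I. - (a i * h i x))"
      using insert.hyps by (intro sum.cong) (auto simp: b_def)
    then show ?thesis using insert.hyps by (simp add: r_def b_def sum_negf)
  qed
  have Gb: "G r g = (\<Sum>i\<in>insert d I. b i * G (h i) g)" if "continuous_on UNIV g" for g
  proof -
    have "(\<Sum>i\<in>I. b i * G (h i) g) = (\<Sum>i\<in>I. - (a i * G (h i) g))"
      using insert.hyps by (intro sum.cong) (auto simp: b_def)
    then show ?thesis using insert.hyps Gr[OF that] by (simp add: b_def sum_negf)
  qed
  define k0 where "k0 i j = (if i \<in> I \<and> j \<in> I then k i j else 0)" for i j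
  define \<nu> where "\<nu> = G r r"
  define k' where "k' i j = k0 i j + b i * b j / \<nu>" for i j
  \<comment> \<open>If the residual vanishes, the old kernel still works: division by zero then adds nothing to it.\<close>
  have zero: "r x = 0" if "\<nu> = 0" "x \<in> ball z \<rho>" for x
    by (rule continuous_zero_on_ball[OF contr that(1)[unfolded \<nu>_def G_def] that(2)])
  have K0: "(\<Sum>i\<in>insert d I. \<Sum>j\<in>insert d I. k0 i j * h i x * g j) =
      (\<Sum>i\<in>I. \<Sum>j\<in>I. k i j * h i x * g j)" for x g
  proof -
    have [simp]: "k0 i d = 0" "k0 d i = 0" for i using insert.hyps by (auto simp: k0_def)
    have "(\<Sum>i\<in>insert d I. \<Sum>j\<in>insert d I. k0 i j * h i x * g j) =
        (\<Sum>i\<in>I. \<Sum>j\<in>I. k0 i j * h i x * g j)"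
      using insert.hyps by simp
    also have "\<dots> = (\<Sum>i\<in>I. \<Sum>j\<in>I. k i j * h i x * g j)"
      by (intro sum.cong refl) (simp add: k0_def)
    finally show ?thesis .
  qed
  have "h l x = (\<Sum>i\<in>insert d I. \<Sum>j\<in>insert d I. k' i j * h i x * G (h j) (h l))"
    if l: "l \<in> insert d I" and x: "x \<in> ball z \<rho>" for l x
  proof -
    have "(\<Sum>i\<in>insert d I. \<Sum>j\<in>insert d I. k' i j * h i x * G (h j) (h l)) =
        (\<Sum>i\<in>insert d I. \<Sum>j\<in>insert d I. k0 i j * h i x * G (h j) (h l)) +
        (\<Sum>i\<in>insert d I. \<Sum>j\<in>insert d I. (b i * h i x) * (b j * G (h j) (h l)) / \<nu>)"
      unfolding sum.distrib[symmetric] k'_def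
      by (intro sum.cong refl) (simp add: algebra_simps)
    also have "(\<Sum>i\<in>insert d I. \<Sum>j\<in>insert d I. (b i * h i x) * (b j * G (h j) (h l)) / \<nu>) =
        r x * G r (h l) / \<nu>"
      unfolding rb[of x] Gb[OF cont[OF l]] sum_product sum_divide_distrib ..
    finally have *: "(\<Sum>i\<in>insert d I. \<Sum>j\<in>insert d I. k' i j * h i x * G (h j) (h l)) =
        (\<Sum>i\<in>I. \<Sum>j\<in>I. k i j * h i x * G (h j) (h l)) + r x * G r (h l) / \<nu>"
      unfolding K0 .
    show ?thesis
    proof (cases "l = d")
      case True
      then show ?thesis unfolding * using hd[of x] zero[OF _ x] rr by (auto simp: \<nu>_def)
    next
      case False
      then have "l \<in> I" using l by simp
      then show ?thesis unfolding * using orth x by (simp add: rep[symmetric])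
    qed
  qed
  moreover have "k' i j = k' j i" for i j
    by (auto simp: k'_def k0_def sym)
  ultimately show ?case by blast
qed

lemma integral_ball_affine:
  fixes g :: "real^'n \<Rightarrow> real"
  assumes g: "continuous_on UNIV g" and \<rho>: "0 < \<rho>"
  shows "(LINT x|lebesgue_on (ball z \<rho>). g ((1/\<rho>) *\<^sub>R (x - z))) =
    \<rho> ^ CARD('n) * (LINT x|lebesgue_on (ball 0 1). g x)"
proof -
  define T where "T = (\<lambda>x::real^'n. z + (\<Sum>j\<in>Basis. (\<rho> * (x \<bullet> j)) *\<^sub>R j))"
  define F where "F x = indicator (ball z \<rho>) x *\<^sub>R g ((1/\<rho>) *\<^sub>R (x - z))" for x
  have T: "T x = z + \<rho> *\<^sub>R x" for x
    unfolding T_def scaleR_scaleR[symmetric] scaleR_sum_right[symmetric] euclidean_representation ..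
  have leb: "lebesgue = density (distr lebesgue lebesgue T) (\<lambda>_. ennreal (\<rho> ^ CARD('n)))"
    using lebesgue_affine_euclidean[of "\<lambda>_. \<rho>" z] \<rho> by (simp add: T_def)
  have Tm [measurable]: "T \<in> lebesgue \<rightarrow>\<^sub>M lebesgue"
    using lebesgue_affine_measurable[of "\<lambda>_. \<rho>" z] \<rho> by (simp add: T_def)
  have "F \<in> borel_measurable borel"
    unfolding F_def using g
    by (intro borel_measurable_scaleR borel_measurable_indicator)
      (auto intro!: borel_measurable_continuous_onI continuous_intros continuous_on_compose2[OF g])
  then have Fm [measurable]: "F \<in> borel_measurable lebesgue"
    by (simp add: measurable_completion)
  have "(LINT x|lebesgue_on (ball z \<rho>). g ((1/\<rho>) *\<^sub>R (x - z))) = integral\<^sup>L lebesgue F"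
    by (simp add: integral_restrict_space F_def[abs_def])
  also have "\<dots> = integral\<^sup>L (density (distr lebesgue lebesgue T) (\<lambda>_. ennreal (\<rho> ^ CARD('n)))) F"
    using leb by simp
  also have "\<dots> = (LINT x|lebesgue. \<rho> ^ CARD('n) *\<^sub>R F (T x))"
    using \<rho> by (subst integral_density) (simp_all add: integral_distr)
  also have "\<dots> = \<rho> ^ CARD('n) * (LINT x|lebesgue_on (ball 0 1). g x)"
  proof -
    have "F (T x) = indicator (ball 0 1) x *\<^sub>R g x" for x
      using \<rho> by (simp add: F_def T dist_norm indicator_def)
    then show ?thesis by (simp add: integral_restrict_space)
  qed
  finally show ?thesis .
qed

text \<open>
  Monomials adapted to the ball of centre \<open>z\<close> and radius \<open>\<rho>\<close>; they are bounded by 1 there.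
\<close>

definition scaled_monomial :: "real^'n \<Rightarrow> real \<Rightarrow> ('n \<Rightarrow> nat) \<Rightarrow> real^'n \<Rightarrow> real" where
  "scaled_monomial z \<rho> \<alpha> x = monomial \<alpha> ((1/\<rho>) *\<^sub>R (x - z))"

lemma continuous_on_scaled_monomial: "continuous_on S (scaled_monomial z \<rho> \<alpha>)"
  unfolding scaled_monomial_def[abs_def]
  by (intro continuous_on_compose2[OF continuous_on_monomial] continuous_intros) auto

lemma abs_monomial_le: "\<bar>monomial \<alpha> x\<bar> \<le> norm x ^ (\<Sum>i\<in>UNIV. \<alpha> i)"
proof -
  have "\<bar>monomial \<alpha> x\<bar> = (\<Prod>i\<in>UNIV. \<bar>x $ i\<bar> ^ \<alpha> i)"
    by (simp add: monomial_def abs_prod power_abs)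
  also have "\<dots> \<le> (\<Prod>i\<in>UNIV. norm x ^ \<alpha> i)"
    by (intro prod_mono conjI power_mono component_le_norm_cart) auto
  finally show ?thesis by (simp add: power_sum)
qed

lemma abs_scaled_monomial_le:
  assumes "0 < \<rho>" "x \<in> ball z (R * \<rho>)"
  shows "\<bar>scaled_monomial z \<rho> \<alpha> x\<bar> \<le> R ^ (\<Sum>i\<in>UNIV. \<alpha> i)"
proof -
  have "norm ((1/\<rho>) *\<^sub>R (x - z)) \<le> R"
    using assms by (simp add: dist_norm norm_minus_commute divide_simps mult.commute)
  then show ?thesis unfolding scaled_monomial_def
    by (intro order_trans[OF abs_monomial_le] power_mono) auto
qed

lemma polys_le_scaled:
  fixes p :: "real^'n \<Rightarrow> 'b::{real_normed_field, euclidean_space}"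
  assumes "p \<in> polys_le s" "0 < \<rho>"
  obtains c where "\<And>x. p x = (\<Sum>\<alpha>\<in>multi_indices s. scaled_monomial z \<rho> \<alpha> x *\<^sub>R c \<alpha>)"
proof -
  obtain c where c: "\<And>y. p (z + \<rho> *\<^sub>R y) = (\<Sum>\<alpha>\<in>multi_indices s. monomial \<alpha> y *\<^sub>R c \<alpha>)"
    using polys_leE[OF polys_le_affine[OF assms(1), of z \<rho>]] by blast
  show ?thesis
    using c[of "(1/\<rho>) *\<^sub>R (_ - z)"] assms(2) by (intro that[of c]) (simp add: scaled_monomial_def)
qed

lemma polys_le_scaled_sum:
  assumes "A \<subseteq> multi_indices s"
  shows "(\<lambda>x. \<Sum>\<alpha>\<in>A. scaled_monomial z \<rho> \<alpha> x *\<^sub>R c \<alpha>) \<in> polys_le s"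
proof -
  have "(\<lambda>y. \<Sum>\<alpha>\<in>A. monomial \<alpha> y *\<^sub>R c \<alpha>) \<in> polys_le s"
    using assms by (intro polys_le_sum polys_le_monomial) auto
  from polys_le_affine[OF this, of "- (1/\<rho>) *\<^sub>R z" "1/\<rho>"]
  show ?thesis by (simp add: scaled_monomial_def scaleR_diff_right)
qed

lemma integrable_scaled_monomial:
  fixes f :: "real^'n \<Rightarrow> 'b::{real_normed_field, euclidean_space}"
  assumes f: "integrable (lebesgue_on (ball z \<rho>)) f" and "0 < \<rho>"
  shows "integrable (lebesgue_on (ball z \<rho>)) (\<lambda>x. scaled_monomial z \<rho> \<alpha> x *\<^sub>R f x)"
proof (rule Bochner_Integration.integrable_bound[OF f])
  show "(\<lambda>x. scaled_monomial z \<rho> \<alpha> x *\<^sub>R f x) \<in> borel_measurable (lebesgue_on (ball z \<rho>))"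
    using borel_measurable_integrable[OF f] borel_measurable_integrable[OF
      integrable_on_ball_continuous[OF continuous_on_scaled_monomial]]
    by (rule borel_measurable_scaleR[rotated])
  have "\<bar>scaled_monomial z \<rho> \<alpha> x\<bar> * norm (f x) \<le> norm (f x)" if "x \<in> ball z \<rho>" for x
    using abs_scaled_monomial_le[of \<rho> x z 1 \<alpha>] that assms(2)
    by (intro mult_left_le_one_le) auto
  then show "AE x in lebesgue_on (ball z \<rho>). norm (scaled_monomial z \<rho> \<alpha> x *\<^sub>R f x) \<le> norm (f x)"
    by (intro AE_I2) simp
qed

text \<open>
  One and the same coefficient matrix serves all balls, since Gram matrices only scale by \<open>\<rho>\<^sup>n\<close>. This is the source of
  all constants below being independent of the ball.
\<close>

lemma scaled_reproducing_kernel: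
  "\<exists>k. (\<forall>i\<in>multi_indices s. \<forall>j\<in>multi_indices s. k i j = k j i) \<and>
    (\<forall>(z::real^'n) \<rho>. 0 < \<rho> \<longrightarrow> (\<forall>l\<in>multi_indices s. \<forall>x\<in>ball z \<rho>.
      scaled_monomial z \<rho> l x = (\<Sum>i\<in>multi_indices s. \<Sum>j\<in>multi_indices s. k i j / \<rho> ^ CARD('n) *
        scaled_monomial z \<rho> i x *
        (LINT y|lebesgue_on (ball z \<rho>). scaled_monomial z \<rho> j y * scaled_monomial z \<rho> l y))))"
proof -
  obtain k where sym: "\<forall>i\<in>multi_indices s. \<forall>j\<in>multi_indices s. k i j = k j i"
    and rep: "\<And>l x. l \<in> multi_indices s \<Longrightarrow> x \<in> ball (0::real^'n) 1 \<Longrightarrow>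
      monomial l x = (\<Sum>i\<in>multi_indices s. \<Sum>j\<in>multi_indices s. k i j * monomial i x *
        (LINT y|lebesgue_on (ball 0 1). monomial j y * monomial l y))"
    using reproducing_kernel[of "multi_indices s" monomial "0::real^'n" 1,
      OF finite_multi_indices continuous_on_monomial] by blast
  show ?thesis
  proof (intro exI[of _ k] conjI sym allI impI ballI)
    fix z x :: "real^'n" and \<rho> :: real and l :: "'n \<Rightarrow> nat"
    assume \<rho>: "0 < \<rho>" and l: "l \<in> multi_indices s" and x: "x \<in> ball z \<rho>"
    have "(1/\<rho>) *\<^sub>R (x - z) \<in> ball 0 1" using \<rho> x by (simp add: dist_norm norm_minus_commute)
    note rep = rep[OF l this]
    have "(LINT y|lebesgue_on (ball z \<rho>). scaled_monomial z \<rho> j y * scaled_monomial z \<rho> l y) =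
        \<rho> ^ CARD('n) * (LINT y|lebesgue_on (ball 0 1). monomial j y * monomial l y)" for j
      unfolding scaled_monomial_def
      by (rule integral_ball_affine[OF _ \<rho>]) (intro continuous_intros continuous_on_monomial)
    then show "scaled_monomial z \<rho> l x = (\<Sum>i\<in>multi_indices s. \<Sum>j\<in>multi_indices s.
        k i j / \<rho> ^ CARD('n) * scaled_monomial z \<rho> i x *
        (LINT y|lebesgue_on (ball z \<rho>). scaled_monomial z \<rho> j y * scaled_monomial z \<rho> l y))"
      using \<rho> rep by (simp add: scaled_monomial_def mult.assoc)
  qed
qed

text \<open>
  The map \<open>c\<close> sends a function to the coefficients of its projection onto polynomials. The third condition
  says that functions orthogonal to all polynomials have zero projection; it gives uniqueness of the
  projection. The last condition is an identity on the whole space, and not only on the ball.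
\<close>

definition projection_coefficients ::
  "nat \<Rightarrow> real \<Rightarrow> real^'n \<Rightarrow> real \<Rightarrow>
   ((real^'n \<Rightarrow> 'b::{real_normed_field, euclidean_space}) \<Rightarrow> ('n \<Rightarrow> nat) \<Rightarrow> 'b) \<Rightarrow> bool" where
  "projection_coefficients s C z \<rho> c \<longleftrightarrow>
    (\<forall>f. integrable (lebesgue_on (ball z \<rho>)) f \<longrightarrow>
      (\<forall>\<alpha>\<in>multi_indices s. norm (c f \<alpha>) \<le> C / \<rho> ^ CARD('n) * (LINT x|lebesgue_on (ball z \<rho>). norm (f x))) \<and>
      (\<forall>\<beta>\<in>multi_indices s. (LINT x|lebesgue_on (ball z \<rho>). scaled_monomial z \<rho> \<beta> x *\<^sub>R
        (f x - (\<Sum>\<alpha>\<in>multi_indices s. scaled_monomial z \<rho> \<alpha> x *\<^sub>R c f \<alpha>))) = 0) \<and>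
      ((\<forall>\<beta>\<in>multi_indices s. (LINT x|lebesgue_on (ball z \<rho>). scaled_monomial z \<rho> \<beta> x *\<^sub>R f x) = 0) \<longrightarrow>
        (\<forall>\<alpha>. c f \<alpha> = 0))) \<and>
    (\<forall>p\<in>polys_le s. \<forall>x. p x = (\<Sum>\<alpha>\<in>multi_indices s. scaled_monomial z \<rho> \<alpha> x *\<^sub>R c p \<alpha>))"

lemma projection_coefficients_exist:
  "\<exists>C>0. \<forall>(z::real^'n) \<rho>. 0 < \<rho> \<longrightarrow>
    (\<exists>c :: (real^'n \<Rightarrow> 'b::{real_normed_field, euclidean_space}) \<Rightarrow> ('n \<Rightarrow> nat) \<Rightarrow> 'b.
      projection_coefficients s C z \<rho> c)"
proof -
  let ?I = "multi_indices s :: ('n \<Rightarrow> nat) set" and ?e = "scaled_monomial :: real^'n \<Rightarrow> _"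
  let ?L = "\<lambda>(z::real^'n) \<rho>. lebesgue_on (ball z \<rho>)"
  obtain k where sym: "\<And>i j. i \<in> ?I \<Longrightarrow> j \<in> ?I \<Longrightarrow> k i j = k j i"
    and rep: "\<And>z \<rho> l x. 0 < \<rho> \<Longrightarrow> l \<in> ?I \<Longrightarrow> x \<in> ball z \<rho> \<Longrightarrow>
      ?e z \<rho> l x = (\<Sum>i\<in>?I. \<Sum>j\<in>?I. k i j / \<rho> ^ CARD('n) * ?e z \<rho> i x * (LINT y|?L z \<rho>. ?e z \<rho> j y * ?e z \<rho> l y))"
    using scaled_reproducing_kernel[of s, where 'n = 'n] by blast
  define C where "C = 1 + (\<Sum>i\<in>?I. \<Sum>j\<in>?I. \<bar>k i j\<bar>)"
  have C: "0 < C" unfolding C_def by (intro add_pos_nonneg sum_nonneg) auto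
  show ?thesis
  proof (intro exI[of _ C] conjI C allI impI)
    fix z :: "real^'n" and \<rho> :: real
    assume \<rho>: "0 < \<rho>"
    define N where "N = \<rho> ^ CARD('n)"
    have N: "0 < N" using \<rho> by (simp add: N_def)
    define J where "J f \<beta> = (LINT x|?L z \<rho>. ?e z \<rho> \<beta> x *\<^sub>R f x)" for f :: "real^'n \<Rightarrow> 'b" and \<beta>
    define G where "G \<alpha> \<beta> = (LINT x|?L z \<rho>. ?e z \<rho> \<alpha> x * ?e z \<rho> \<beta> x)" for \<alpha> \<beta>
    define c where "c f \<alpha> = (\<Sum>\<beta>\<in>?I. (k \<alpha> \<beta> / N) *\<^sub>R J f \<beta>)" for f :: "real^'n \<Rightarrow> 'b" and \<alpha>
    have rep: "?e z \<rho> l x = (\<Sum>i\<in>?I. \<Sum>j\<in>?I. k i j / N * ?e z \<rho> i x * G j l)"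
      if "l \<in> ?I" "x \<in> ball z \<rho>" for l x
      using rep[OF \<rho> that] by (simp add: N_def G_def)
    have int: "integrable (?L z \<rho>) (\<lambda>x. ?e z \<rho> \<alpha> x *\<^sub>R f x)" if "integrable (?L z \<rho>) f"
      for f :: "real^'n \<Rightarrow> 'b" and \<alpha>
      by (rule integrable_scaled_monomial[OF that \<rho>])
    have intG: "integrable (?L z \<rho>) (\<lambda>x. ?e z \<rho> \<alpha> x * ?e z \<rho> \<beta> x)" for \<alpha> \<beta>
      by (intro integrable_on_ball_continuous continuous_intros continuous_on_scaled_monomial)
    have coeff: "c p \<alpha> = (\<Sum>\<gamma>\<in>?I. (\<Sum>\<beta>\<in>?I. k \<alpha> \<beta> / N * G \<beta> \<gamma>) *\<^sub>R d \<gamma>)"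
      if "\<And>x. p x = (\<Sum>\<gamma>\<in>?I. ?e z \<rho> \<gamma> x *\<^sub>R d \<gamma>)" for p d \<alpha>
    proof -
      have "J p \<beta> = (\<Sum>\<gamma>\<in>?I. G \<beta> \<gamma> *\<^sub>R d \<gamma>)" for \<beta>
        unfolding J_def that G_def by (simp add: scaleR_sum_right intG)
      then show ?thesis
        unfolding c_def by (simp add: scaleR_sum_right scaleR_sum_left)
          (subst sum.swap, simp)
    qed
    show "\<exists>c :: (real^'n \<Rightarrow> 'b) \<Rightarrow> ('n \<Rightarrow> nat) \<Rightarrow> 'b. projection_coefficients s C z \<rho> c"
      unfolding projection_coefficients_def
    proof (intro exI[of _ c] conjI allI impI ballI)
      fix f :: "real^'n \<Rightarrow> 'b" and \<alpha>
      assume f: "integrable (?L z \<rho>) f" and \<alpha>: "\<alpha> \<in> ?I"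
      have J: "norm (J f \<beta>) \<le> (LINT x|?L z \<rho>. norm (f x))" for \<beta>
      proof -
        have "\<bar>?e z \<rho> \<beta> x\<bar> * norm (f x) \<le> norm (f x)" if "x \<in> ball z \<rho>" for x
          using abs_scaled_monomial_le[of \<rho> x z 1 \<beta>] that \<rho>
          by (intro mult_left_le_one_le) auto
        then have "(LINT x|?L z \<rho>. norm (?e z \<rho> \<beta> x *\<^sub>R f x)) \<le> (LINT x|?L z \<rho>. norm (f x))"
          using f by (intro integral_mono integrable_norm int) auto
        then show ?thesis
          unfolding J_def by (rule order_trans[OF integral_norm_bound])
      qed
      have "norm (c f \<alpha>) \<le> (\<Sum>\<beta>\<in>?I. norm ((k \<alpha> \<beta> / N) *\<^sub>R J f \<beta>))"
        unfolding c_def by (rule norm_sum)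
      also have "\<dots> \<le> (\<Sum>\<beta>\<in>?I. (\<bar>k \<alpha> \<beta>\<bar> / N) * (LINT x|?L z \<rho>. norm (f x)))"
        using N by (intro sum_mono) (auto intro!: mult_left_mono divide_right_mono J)
      also have "\<dots> = (\<Sum>\<beta>\<in>?I. \<bar>k \<alpha> \<beta>\<bar>) / N * (LINT x|?L z \<rho>. norm (f x))"
        by (simp add: sum_distrib_right sum_divide_distrib)
      also have "\<dots> \<le> C / N * (LINT x|?L z \<rho>. norm (f x))"
      proof -
        have "(\<Sum>\<beta>\<in>?I. \<bar>k \<alpha> \<beta>\<bar>) \<le> (\<Sum>i\<in>?I. \<Sum>j\<in>?I. \<bar>k i j\<bar>)"
          using \<alpha> by (intro member_le_sum[of \<alpha> ?I "\<lambda>i. \<Sum>j\<in>?I. \<bar>k i j\<bar>"]) (auto intro: sum_nonneg)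
        then show ?thesis
          using N by (intro mult_right_mono divide_right_mono Bochner_Integration.integral_nonneg)
            (auto simp: C_def)
      qed
      finally show "norm (c f \<alpha>) \<le> C / \<rho> ^ CARD('n) * (LINT x|?L z \<rho>. norm (f x))"
        by (simp add: N_def)
    next
      fix f :: "real^'n \<Rightarrow> 'b" and \<gamma>
      assume f: "integrable (?L z \<rho>) f" and \<gamma>: "\<gamma> \<in> ?I"
      have "J f \<gamma> = (LINT x|?L z \<rho>. (\<Sum>i\<in>?I. \<Sum>j\<in>?I. (k i j / N * G j \<gamma>) *\<^sub>R (?e z \<rho> i x *\<^sub>R f x)))"
        unfolding J_def
      proof (intro Bochner_Integration.integral_cong refl)
        fix x assume "x \<in> space (?L z \<rho>)"
        then have "?e z \<rho> \<gamma> x *\<^sub>R f x =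
            (\<Sum>i\<in>?I. \<Sum>j\<in>?I. k i j / N * ?e z \<rho> i x * G j \<gamma>) *\<^sub>R f x"
          by (subst rep[OF \<gamma>]) simp_all
        then show "?e z \<rho> \<gamma> x *\<^sub>R f x =
            (\<Sum>i\<in>?I. \<Sum>j\<in>?I. (k i j / N * G j \<gamma>) *\<^sub>R (?e z \<rho> i x *\<^sub>R f x))"
          by (simp add: scaleR_sum_left ac_simps)
      qed
      also have "\<dots> = (\<Sum>i\<in>?I. \<Sum>j\<in>?I. (k i j / N * G j \<gamma>) *\<^sub>R J f i)"
        unfolding J_def using f by (simp add: int del: scaleR_scaleR)
      also have "\<dots> = (\<Sum>j\<in>?I. \<Sum>i\<in>?I. (k i j / N * G j \<gamma>) *\<^sub>R J f i)" by (rule sum.swap)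
      also have "\<dots> = (\<Sum>j\<in>?I. G \<gamma> j *\<^sub>R c f j)"
        unfolding c_def scaleR_sum_right
        by (intro sum.cong refl) (simp add: sym G_def mult.commute)
      finally have "J f \<gamma> = (\<Sum>j\<in>?I. G \<gamma> j *\<^sub>R c f j)" .
      moreover have "(LINT x|?L z \<rho>. ?e z \<rho> \<gamma> x *\<^sub>R (f x - (\<Sum>\<alpha>\<in>?I. ?e z \<rho> \<alpha> x *\<^sub>R c f \<alpha>))) =
          J f \<gamma> - (\<Sum>j\<in>?I. G \<gamma> j *\<^sub>R c f j)"
        unfolding J_def G_def scaleR_diff_right scaleR_sum_right scaleR_scaleR
        using f by (simp add: int intG)
      ultimately show "(LINT x|?L z \<rho>. ?e z \<rho> \<gamma> x *\<^sub>R (f x - (\<Sum>\<alpha>\<in>?I. ?e z \<rho> \<alpha> x *\<^sub>R c f \<alpha>))) = 0"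
        by simp
    next
      fix f :: "real^'n \<Rightarrow> 'b" and \<alpha>
      assume "\<forall>\<beta>\<in>?I. (LINT x|?L z \<rho>. ?e z \<rho> \<beta> x *\<^sub>R f x) = 0"
      then show "c f \<alpha> = 0" by (simp add: c_def J_def)
    next
      fix p :: "real^'n \<Rightarrow> 'b" and x
      assume p: "p \<in> polys_le s"
      then obtain d where d: "\<And>x. p x = (\<Sum>\<alpha>\<in>?I. ?e z \<rho> \<alpha> x *\<^sub>R d \<alpha>)"
        using polys_le_scaled[OF p \<rho>] by blast
      define q where "q x = p x - (\<Sum>\<alpha>\<in>?I. ?e z \<rho> \<alpha> x *\<^sub>R c p \<alpha>)" for x
      have "q \<in> polys_le s"
        unfolding q_def[abs_def] by (intro polys_le_diff p polys_le_scaled_sum) simp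
      moreover have "q y = 0" if y: "y \<in> ball z \<rho>" for y
      proof -
        have "(\<Sum>\<alpha>\<in>?I. ?e z \<rho> \<alpha> y *\<^sub>R c p \<alpha>) =
            (\<Sum>\<alpha>\<in>?I. \<Sum>\<gamma>\<in>?I. (\<Sum>\<beta>\<in>?I. k \<alpha> \<beta> / N * ?e z \<rho> \<alpha> y * G \<beta> \<gamma>) *\<^sub>R d \<gamma>)"
          unfolding coeff[OF d] scaleR_sum_right
          by (intro sum.cong refl) (simp add: sum_distrib_left ac_simps)
        also have "\<dots> = (\<Sum>\<gamma>\<in>?I. ?e z \<rho> \<gamma> y *\<^sub>R d \<gamma>)"
          by (subst sum.swap, intro sum.cong refl, subst rep[OF _ y], assumption)
            (simp add: scaleR_sum_left)
        finally show ?thesis by (simp add: q_def d)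
      qed
      ultimately have "q x = 0" by (rule polys_le_eq_zeroI[OF _ \<rho>])
      then show "p x = (\<Sum>\<alpha>\<in>?I. ?e z \<rho> \<alpha> x *\<^sub>R c p \<alpha>)" by (simp add: q_def)
    qed
  qed
qed


lemma projection_coefficientsD:
  assumes "projection_coefficients s C z \<rho> c"
  shows "\<And>f \<alpha>. integrable (lebesgue_on (ball z \<rho>)) f \<Longrightarrow> \<alpha> \<in> multi_indices s \<Longrightarrow>
      norm (c f \<alpha>) \<le> C / \<rho> ^ CARD('n) * (LINT x|lebesgue_on (ball z \<rho>). norm (f (x :: real^'n)))"
    and "\<And>f \<beta>. integrable (lebesgue_on (ball z \<rho>)) f \<Longrightarrow> \<beta> \<in> multi_indices s \<Longrightarrow>
      (LINT x|lebesgue_on (ball z \<rho>). scaled_monomial z \<rho> \<beta> x *\<^sub>R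
        (f x - (\<Sum>\<alpha>\<in>multi_indices s. scaled_monomial z \<rho> \<alpha> x *\<^sub>R c f \<alpha>))) = 0"
    and "\<And>f \<alpha>. integrable (lebesgue_on (ball z \<rho>)) f \<Longrightarrow> 
      \<forall>\<beta>\<in>multi_indices s. (LINT x|lebesgue_on (ball z \<rho>). scaled_monomial z \<rho> \<beta> x *\<^sub>R f x) = 0 \<Longrightarrow>
      c f \<alpha> = 0"
    and "\<And>p x. p \<in> polys_le s \<Longrightarrow>
      p x = (\<Sum>\<alpha>\<in>multi_indices s. scaled_monomial z \<rho> \<alpha> x *\<^sub>R c p \<alpha>)"
proof -
  note * = assms[unfolded projection_coefficients_def]
  note ** = conjunct1[OF *, rule_format]
  show "norm (c f \<alpha>) \<le> C / \<rho> ^ CARD('n) * (LINT x|lebesgue_on (ball z \<rho>). norm (f x))"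
    if "integrable (lebesgue_on (ball z \<rho>)) f" "\<alpha> \<in> multi_indices s" for f \<alpha>
    by (rule bspec[OF conjunct1[OF **[OF that(1)]] that(2)])
  show "(LINT x|lebesgue_on (ball z \<rho>). scaled_monomial z \<rho> \<beta> x *\<^sub>R
        (f x - (\<Sum>\<alpha>\<in>multi_indices s. scaled_monomial z \<rho> \<alpha> x *\<^sub>R c f \<alpha>))) = 0"
    if "integrable (lebesgue_on (ball z \<rho>)) f" "\<beta> \<in> multi_indices s" for f \<beta>
    by (rule bspec[OF conjunct1[OF conjunct2[OF **[OF that(1)]]] that(2)])
  show "c f \<alpha> = 0" if "integrable (lebesgue_on (ball z \<rho>)) f"
    "\<forall>\<beta>\<in>multi_indices s. (LINT x|lebesgue_on (ball z \<rho>). scaled_monomial z \<rho> \<beta> x *\<^sub>R f x) = 0" for f \<alpha>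
    by (rule spec[OF mp[OF conjunct2[OF conjunct2[OF **[OF that(1)]]] that(2)]])
  show "p x = (\<Sum>\<alpha>\<in>multi_indices s. scaled_monomial z \<rho> \<alpha> x *\<^sub>R c p \<alpha>)"
    if "p \<in> polys_le s" for p x
    by (rule spec[OF bspec[OF conjunct2[OF *] that]])
qed

lemma nn_integral_ball_eq:
  fixes f :: "real^'n \<Rightarrow> 'b::{real_normed_field, euclidean_space}"
  assumes "integrable (lebesgue_on (ball z \<rho>)) f"
  shows "(\<integral>\<^sup>+x\<in>ball z \<rho>. ennreal (norm (f x)) \<partial>lebesgue) =
    ennreal (LINT x|lebesgue_on (ball z \<rho>). norm (f x))"
  using nn_integral_eq_integral[OF integrable_norm[OF assms]]
  by (simp add: nn_integral_restrict_space)

lemma integral_ball_le: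
  fixes f :: "real^'n \<Rightarrow> 'b::{real_normed_field, euclidean_space}"
  assumes "integrable (lebesgue_on (ball z \<rho>)) f" "0 \<le> M"
    "(\<integral>\<^sup>+x\<in>ball z \<rho>. ennreal (norm (f x)) \<partial>lebesgue) \<le> ennreal M"
  shows "(LINT x|lebesgue_on (ball z \<rho>). norm (f x)) \<le> M"
  using assms(3) unfolding nn_integral_ball_eq[OF assms(1)] using assms(2) by simp

lemma integrable_polys_le:
  "p \<in> polys_le s \<Longrightarrow> integrable (lebesgue_on (ball z \<rho>)) p"
  by (intro integrable_on_ball_continuous continuous_on_polys_le)

text \<open>
  Equivalence of norms on a finite-dimensional space, with the correct scaling in \<open>\<rho>\<close>.
\<close>

lemma polys_le_coefficients:
  "\<exists>C>0. \<forall>(z::real^'n) \<rho> M. \<forall>p\<in>(polys_le s :: (real^'n \<Rightarrow> 'b::{real_normed_field, euclidean_space}) set).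
    0 < \<rho> \<longrightarrow> 0 \<le> M \<longrightarrow> (\<integral>\<^sup>+x\<in>ball z \<rho>. ennreal (norm (p x)) \<partial>lebesgue) \<le> ennreal M \<longrightarrow>
    (\<exists>c. (\<forall>x. p x = (\<Sum>\<alpha>\<in>multi_indices s. scaled_monomial z \<rho> \<alpha> x *\<^sub>R c \<alpha>)) \<and>
      (\<forall>\<alpha>\<in>multi_indices s. norm (c \<alpha>) \<le> C / \<rho> ^ CARD('n) * M))"
proof -
  obtain C where "0 < C" and C: "\<And>(z::real^'n) \<rho>. 0 < \<rho> \<Longrightarrow>
    \<exists>c :: (real^'n \<Rightarrow> 'b) \<Rightarrow> ('n \<Rightarrow> nat) \<Rightarrow> 'b. projection_coefficients s C z \<rho> c"
    using projection_coefficients_exist[of s, where 'n = 'n and 'b = 'b] by blast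
  show ?thesis
  proof (intro exI[of _ C] conjI \<open>0 < C\<close> allI impI ballI)
    fix z :: "real^'n" and \<rho> M and p :: "real^'n \<Rightarrow> 'b"
    assume p: "p \<in> polys_le s" and \<rho>: "0 < \<rho>" and M: "0 \<le> M"
      "(\<integral>\<^sup>+x\<in>ball z \<rho>. ennreal (norm (p x)) \<partial>lebesgue) \<le> ennreal M"
    obtain c :: "(real^'n \<Rightarrow> 'b) \<Rightarrow> ('n \<Rightarrow> nat) \<Rightarrow> 'b" where "projection_coefficients s C z \<rho> c"
      using C[OF \<rho>] by blast
    note c = projection_coefficientsD(1,4)[OF this]
    have "norm (c p \<alpha>) \<le> C / \<rho> ^ CARD('n) * M" if "\<alpha> \<in> multi_indices s" for \<alpha>
      using \<open>0 < C\<close> \<rho> that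
      by (intro order_trans[OF c(1)[OF integrable_polys_le[OF p]]] mult_left_mono
          integral_ball_le[OF integrable_polys_le[OF p] M]) auto
    with c(2)[OF p] show "\<exists>c. (\<forall>x. p x = (\<Sum>\<alpha>\<in>multi_indices s. scaled_monomial z \<rho> \<alpha> x *\<^sub>R c \<alpha>)) \<and>
      (\<forall>\<alpha>\<in>multi_indices s. norm (c \<alpha>) \<le> C / \<rho> ^ CARD('n) * M)"
      by (intro exI[of _ "c p"]) auto
  qed
qed

lemma scaled_sum_bound:
  fixes c :: "'i \<Rightarrow> 'b::real_normed_vector" and e :: "'i \<Rightarrow> real" and E M :: real
  assumes c: "\<And>\<alpha>. \<alpha> \<in> A \<Longrightarrow> norm (c \<alpha>) \<le> M" and "0 \<le> M" and "finite A"
    and e: "\<And>\<alpha>. \<alpha> \<in> A \<Longrightarrow> \<bar>e \<alpha>\<bar> \<le> E"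
  shows "norm (\<Sum>\<alpha>\<in>A. e \<alpha> *\<^sub>R c \<alpha>) \<le> card A * E * M"
proof -
  have "norm (\<Sum>\<alpha>\<in>A. e \<alpha> *\<^sub>R c \<alpha>) \<le> (\<Sum>\<alpha>\<in>A. norm (e \<alpha> *\<^sub>R c \<alpha>))" by (rule norm_sum)
  also have "\<dots> \<le> (\<Sum>\<alpha>\<in>A. E * M)"
  proof (rule sum_mono)
    fix \<alpha> assume "\<alpha> \<in> A"
    then have "\<bar>e \<alpha>\<bar> \<le> E" "norm (c \<alpha>) \<le> M" using c e by auto
    then show "norm (e \<alpha> *\<^sub>R c \<alpha>) \<le> E * M"
      using abs_ge_zero[of "e \<alpha>"] by (auto intro!: mult_mono)
  qed
  finally show ?thesis by (simp add: mult.assoc)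
qed

lemma polys_le_sup_bound:
  "\<exists>C>0. \<forall>(z::real^'n) \<rho> M R. \<forall>p\<in>(polys_le s :: (real^'n \<Rightarrow> 'b::{real_normed_field, euclidean_space}) set).
    0 < \<rho> \<longrightarrow> 1 \<le> R \<longrightarrow> 0 \<le> M \<longrightarrow>
    (\<integral>\<^sup>+x\<in>ball z \<rho>. ennreal (norm (p x)) \<partial>lebesgue) \<le> ennreal M \<longrightarrow>
    (\<forall>x\<in>ball z (R * \<rho>). norm (p x) \<le> C * R ^ s / \<rho> ^ CARD('n) * M)"
proof -
  obtain C where "0 < C" and C: "\<And>(z::real^'n) \<rho> M p. p \<in> (polys_le s :: (real^'n \<Rightarrow> 'b) set) \<Longrightarrow>
    0 < \<rho> \<Longrightarrow> 0 \<le> M \<Longrightarrow> (\<integral>\<^sup>+x\<in>ball z \<rho>. ennreal (norm (p x)) \<partial>lebesgue) \<le> ennreal M \<Longrightarrow>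
    (\<exists>c. (\<forall>x. p x = (\<Sum>\<alpha>\<in>multi_indices s. scaled_monomial z \<rho> \<alpha> x *\<^sub>R c \<alpha>)) \<and>
      (\<forall>\<alpha>\<in>multi_indices s. norm (c \<alpha>) \<le> C / \<rho> ^ CARD('n) * M))"
    using polys_le_coefficients[of s, where 'n = 'n and 'b = 'b] by blast
  let ?I = "multi_indices s :: ('n \<Rightarrow> nat) set"
  show ?thesis
  proof (intro exI[of _ "(1 + card ?I) * C"] conjI allI impI ballI)
    show "0 < (1 + card ?I) * C" using \<open>0 < C\<close> by simp
    fix z x :: "real^'n" and \<rho> M R and p :: "real^'n \<Rightarrow> 'b"
    assume p: "p \<in> polys_le s" and \<rho>: "0 < \<rho>" and R: "1 \<le> R" and M: "0 \<le> M"
      "(\<integral>\<^sup>+x\<in>ball z \<rho>. ennreal (norm (p x)) \<partial>lebesgue) \<le> ennreal M"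
      and x: "x \<in> ball z (R * \<rho>)"
    obtain c where c: "p x = (\<Sum>\<alpha>\<in>?I. scaled_monomial z \<rho> \<alpha> x *\<^sub>R c \<alpha>)"
      "\<And>\<alpha>. \<alpha> \<in> ?I \<Longrightarrow> norm (c \<alpha>) \<le> C / \<rho> ^ CARD('n) * M"
      using C[OF p \<rho> M] by blast
    have "\<bar>scaled_monomial z \<rho> \<alpha> x\<bar> \<le> R ^ s" if "\<alpha> \<in> ?I" for \<alpha>
      using abs_scaled_monomial_le[OF \<rho> x] power_increasing[OF _ R, of "\<Sum>i\<in>UNIV. \<alpha> i" s] that
      by (auto simp: multi_indices_def intro: order_trans)
    from scaled_sum_bound[OF c(2) _ finite_multi_indices this]
    have "norm (p x) \<le> card ?I * R ^ s * (C / \<rho> ^ CARD('n) * M)"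
      unfolding c(1) using \<open>0 < C\<close> \<rho> M(1) by simp
    also have "\<dots> \<le> (1 + card ?I) * R ^ s * (C / \<rho> ^ CARD('n) * M)"
      using \<open>0 < C\<close> \<rho> M R by (intro mult_right_mono) auto
    finally show "norm (p x) \<le> (1 + card ?I) * C * R ^ s / \<rho> ^ CARD('n) * M"
      by (simp add: ac_simps)
  qed
qed

text \<open>
  Discarding the monomials of degree above \<open>m\<close> costs a factor \<open>(r/\<rho>)\<^bsup>m+1\<^esup>\<close> when passing to a concentric smaller
  ball. This gain is what makes the series over dyadic dilates converge later on.
\<close>

lemma polys_le_low_degree_part:
  "\<exists>C>0. \<forall>(z::real^'n) \<rho> M. \<forall>p\<in>(polys_le s :: (real^'n \<Rightarrow> 'b::{real_normed_field, euclidean_space}) set).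
    0 < \<rho> \<longrightarrow> 0 \<le> M \<longrightarrow>
    (\<integral>\<^sup>+x\<in>ball z \<rho>. ennreal (norm (p x)) \<partial>lebesgue) \<le> ennreal M \<longrightarrow>
    (\<exists>u\<in>polys_le m. \<forall>r. 0 < r \<longrightarrow> r \<le> \<rho> \<longrightarrow>
      (\<forall>x\<in>ball z r. norm (p x - u x) \<le> C * (r / \<rho>) ^ Suc m / \<rho> ^ CARD('n) * M))"
proof -
  obtain C where "0 < C" and C: "\<And>(z::real^'n) \<rho> M p. p \<in> (polys_le s :: (real^'n \<Rightarrow> 'b) set) \<Longrightarrow>
    0 < \<rho> \<Longrightarrow> 0 \<le> M \<Longrightarrow> (\<integral>\<^sup>+x\<in>ball z \<rho>. ennreal (norm (p x)) \<partial>lebesgue) \<le> ennreal M \<Longrightarrow>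
    (\<exists>c. (\<forall>x. p x = (\<Sum>\<alpha>\<in>multi_indices s. scaled_monomial z \<rho> \<alpha> x *\<^sub>R c \<alpha>)) \<and>
      (\<forall>\<alpha>\<in>multi_indices s. norm (c \<alpha>) \<le> C / \<rho> ^ CARD('n) * M))"
    using polys_le_coefficients[of s, where 'n = 'n and 'b = 'b] by blast
  let ?I = "multi_indices s :: ('n \<Rightarrow> nat) set"
  let ?J = "multi_indices s \<inter> multi_indices m :: ('n \<Rightarrow> nat) set"
  show ?thesis
  proof (intro exI[of _ "(1 + card (?I - ?J)) * C"] conjI allI impI ballI)
    show "0 < (1 + card (?I - ?J)) * C" using \<open>0 < C\<close> by simp
    fix z :: "real^'n" and \<rho> M and p :: "real^'n \<Rightarrow> 'b"
    assume p: "p \<in> polys_le s" and \<rho>: "0 < \<rho>" and M: "0 \<le> M"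
      "(\<integral>\<^sup>+x\<in>ball z \<rho>. ennreal (norm (p x)) \<partial>lebesgue) \<le> ennreal M"
    obtain c where c: "\<And>x. p x = (\<Sum>\<alpha>\<in>?I. scaled_monomial z \<rho> \<alpha> x *\<^sub>R c \<alpha>)"
      "\<And>\<alpha>. \<alpha> \<in> ?I \<Longrightarrow> norm (c \<alpha>) \<le> C / \<rho> ^ CARD('n) * M"
      using C[OF p \<rho> M] by blast
    define u where "u x = (\<Sum>\<alpha>\<in>?J. scaled_monomial z \<rho> \<alpha> x *\<^sub>R c \<alpha>)" for x
    show "\<exists>u\<in>polys_le m. \<forall>r. 0 < r \<longrightarrow> r \<le> \<rho> \<longrightarrow> (\<forall>x\<in>ball z r.
      norm (p x - u x) \<le> (1 + card (?I - ?J)) * C * (r / \<rho>) ^ Suc m / \<rho> ^ CARD('n) * M)"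
    proof (intro bexI[of _ u] allI impI ballI)
      show "u \<in> polys_le m" unfolding u_def[abs_def] by (rule polys_le_scaled_sum) auto
      fix r x assume r: "0 < r" "r \<le> \<rho>" and x: "x \<in> ball z r"
      have pu: "p x - u x = (\<Sum>\<alpha>\<in>?I - ?J. scaled_monomial z \<rho> \<alpha> x *\<^sub>R c \<alpha>)"
        unfolding c u_def by (subst sum_diff) auto
      have "\<bar>scaled_monomial z \<rho> \<alpha> x\<bar> \<le> (r / \<rho>) ^ Suc m" if "\<alpha> \<in> ?I - ?J" for \<alpha>
      proof -
        have "x \<in> ball z ((r / \<rho>) * \<rho>)" using x \<rho> by simp
        note abs_scaled_monomial_le[OF \<rho> this, of \<alpha>]
        also have "(r / \<rho>) ^ (\<Sum>i\<in>UNIV. \<alpha> i) \<le> (r / \<rho>) ^ Suc m"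
          by (rule power_decreasing) (use r that in \<open>auto simp: multi_indices_def\<close>)
        finally show ?thesis .
      qed
      then have "norm (p x - u x) \<le> card (?I - ?J) * (r / \<rho>) ^ Suc m * (C / \<rho> ^ CARD('n) * M)"
        unfolding pu
        by (intro scaled_sum_bound[where c = c and e = "\<lambda>\<alpha>. scaled_monomial z \<rho> \<alpha> x"])
          (use \<open>0 < C\<close> \<rho> M(1) c(2) in simp_all)
      also have "\<dots> \<le> (1 + card (?I - ?J)) * (r / \<rho>) ^ Suc m * (C / \<rho> ^ CARD('n) * M)"
        using \<open>0 < C\<close> \<rho> M r by (intro mult_right_mono) auto
      finally show "norm (p x - u x) \<le> (1 + card (?I - ?J)) * C * (r / \<rho>) ^ Suc m / \<rho> ^ CARD('n) * M"
        by (simp add: ac_simps)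
    qed
  qed
qed

text \<open>
  The pairing that defines \<^const>\<open>poly_proj\<close> is bilinear with values in \<open>'b\<close>; testing with scaled monomials reduces it to real multipliers.
\<close>

lemma orthogonal_polys_le_iff:
  fixes g :: "real^'n \<Rightarrow> 'b::{real_normed_field, euclidean_space}"
  assumes g: "integrable (lebesgue_on (ball z \<rho>)) g" and \<rho>: "0 < \<rho>"
  shows "(\<forall>Q\<in>polys_le s. (LINT x:ball z \<rho>|lebesgue. g x * Q x) = 0) \<longleftrightarrow>
    (\<forall>\<beta>\<in>multi_indices s. (LINT x|lebesgue_on (ball z \<rho>). scaled_monomial z \<rho> \<beta> x *\<^sub>R g x) = 0)"
proof -
  have conv: "(LINT x:ball z \<rho>|lebesgue. h x) = (LINT x|lebesgue_on (ball z \<rho>). h x)"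
    for h :: "real^'n \<Rightarrow> 'b"
    by (simp add: set_lebesgue_integral_def integral_restrict_space)
  show ?thesis unfolding conv
  proof (intro iffI ballI)
    fix \<beta> :: "'n \<Rightarrow> nat"
    assume *: "\<forall>Q\<in>polys_le s. (LINT x|lebesgue_on (ball z \<rho>). g x * Q x) = 0" and \<beta>: "\<beta> \<in> multi_indices s"
    have "(\<lambda>x. \<Sum>\<alpha>\<in>{\<beta>}. scaled_monomial z \<rho> \<alpha> x *\<^sub>R (1::'b)) \<in> polys_le s"
      using \<beta> by (intro polys_le_scaled_sum) simp
    with * show "(LINT x|lebesgue_on (ball z \<rho>). scaled_monomial z \<rho> \<beta> x *\<^sub>R g x) = 0" by auto
  next
    fix Q :: "real^'n \<Rightarrow> 'b"
    assume *: "\<forall>\<beta>\<in>multi_indices s. (LINT x|lebesgue_on (ball z \<rho>). scaled_monomial z \<rho> \<beta> x *\<^sub>R g x) = 0"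
      and Q: "Q \<in> polys_le s"
    obtain c where c: "\<And>x. Q x = (\<Sum>\<alpha>\<in>multi_indices s. scaled_monomial z \<rho> \<alpha> x *\<^sub>R c \<alpha>)"
      using polys_le_scaled[OF Q \<rho>] by blast
    have "(LINT x|lebesgue_on (ball z \<rho>). g x * Q x) =
        (LINT x|lebesgue_on (ball z \<rho>). (\<Sum>\<alpha>\<in>multi_indices s. (scaled_monomial z \<rho> \<alpha> x *\<^sub>R g x) * c \<alpha>))"
      unfolding c by (simp add: sum_distrib_left)
    also have "\<dots> = (\<Sum>\<alpha>\<in>multi_indices s.
        (LINT x|lebesgue_on (ball z \<rho>). (scaled_monomial z \<rho> \<alpha> x *\<^sub>R g x) * c \<alpha>))"
      by (intro Bochner_Integration.integral_sum integrable_mult_left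
          integrable_scaled_monomial[OF g \<rho>])
    also have "\<dots> = 0"
      using * by (intro sum.neutral ballI) (simp del: mult_scaleR_left)
    finally show "(LINT x|lebesgue_on (ball z \<rho>). g x * Q x) = 0" .
  qed
qed

text \<open>
  The projection of \<open>f\<close> equals \<open>p\<close> plus the projection of \<open>f - p\<close>, so it differs from any competitor \<open>p\<close> by at most
  a multiple of the mean error of \<open>p\<close>. In all estimates the projections may therefore be replaced
  by arbitrary approximating polynomials.
\<close>

lemma poly_proj_near_optimal:
  "\<exists>C>0. \<forall>(z::real^'n) \<rho>. \<forall>f :: real^'n \<Rightarrow> 'b::{real_normed_field, euclidean_space}.
    0 < \<rho> \<longrightarrow> integrable (lebesgue_on (ball z \<rho>)) f \<longrightarrow>
    poly_proj s (ball z \<rho>) f \<in> polys_le s \<and>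
    (\<forall>p\<in>polys_le s. \<forall>M\<ge>0. (\<integral>\<^sup>+x\<in>ball z \<rho>. ennreal (norm (f x - p x)) \<partial>lebesgue) \<le> ennreal M \<longrightarrow>
      (\<forall>x\<in>ball z \<rho>. norm (poly_proj s (ball z \<rho>) f x - p x) \<le> C / \<rho> ^ CARD('n) * M))"
proof -
  let ?I = "multi_indices s :: ('n \<Rightarrow> nat) set"
  obtain C where "0 < C" and C: "\<And>(z::real^'n) \<rho>. 0 < \<rho> \<Longrightarrow>
    \<exists>c :: (real^'n \<Rightarrow> 'b) \<Rightarrow> ('n \<Rightarrow> nat) \<Rightarrow> 'b. projection_coefficients s C z \<rho> c"
    using projection_coefficients_exist[of s, where 'n = 'n and 'b = 'b] by blast
  show ?thesis
  proof (intro exI[of _ "(1 + card ?I) * C"] conjI)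
    show "0 < (1 + card ?I) * C" using \<open>0 < C\<close> by simp
    show "\<forall>(z::real^'n) \<rho>. \<forall>f :: real^'n \<Rightarrow> 'b.
      0 < \<rho> \<longrightarrow> integrable (lebesgue_on (ball z \<rho>)) f \<longrightarrow>
      poly_proj s (ball z \<rho>) f \<in> polys_le s \<and>
      (\<forall>p\<in>polys_le s. \<forall>M\<ge>0. (\<integral>\<^sup>+x\<in>ball z \<rho>. ennreal (norm (f x - p x)) \<partial>lebesgue) \<le> ennreal M \<longrightarrow>
        (\<forall>x\<in>ball z \<rho>. norm (poly_proj s (ball z \<rho>) f x - p x)
          \<le> (1 + card ?I) * C / \<rho> ^ CARD('n) * M))"
    proof (intro allI impI)
      fix z :: "real^'n" and \<rho> and f :: "real^'n \<Rightarrow> 'b"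
      assume \<rho>: "0 < \<rho>" and f: "integrable (lebesgue_on (ball z \<rho>)) f"
      let ?e = "scaled_monomial z \<rho>" and ?L = "lebesgue_on (ball z \<rho>)"
      obtain c :: "(real^'n \<Rightarrow> 'b) \<Rightarrow> ('n \<Rightarrow> nat) \<Rightarrow> 'b" where "projection_coefficients s C z \<rho> c"
        using C[OF \<rho>] by blast
      note c = projection_coefficientsD(1)[OF this] and orth = projection_coefficientsD(2)[OF this]
        and zero = projection_coefficientsD(3)[OF this] and rep = projection_coefficientsD(4)[OF this]
      let ?orth = "\<lambda>g. \<forall>\<beta>\<in>?I. (LINT x|?L. ?e \<beta> x *\<^sub>R g x) = 0"
      have proj_eq: "poly_proj s (ball z \<rho>) f = P" if P: "P \<in> polys_le s" "?orth (\<lambda>x. f x - P x)" for P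
        unfolding poly_proj_def
      proof (rule the_equality)
        show "P \<in> polys_le s \<and> (\<forall>Q\<in>polys_le s. (LINT x:ball z \<rho>|lebesgue. (f x - P x) * Q x) = 0)"
          using P orthogonal_polys_le_iff[OF Bochner_Integration.integrable_diff[OF f integrable_polys_le[OF P(1)]] \<rho>, of s]
          by blast
        fix P' assume P': "P' \<in> polys_le s \<and>
          (\<forall>Q\<in>polys_le s. (LINT x:ball z \<rho>|lebesgue. (f x - P' x) * Q x) = 0)"
        then have P'1: "P' \<in> polys_le s" by blast
        have P'2: "?orth (\<lambda>x. f x - P' x)"
          using P' orthogonal_polys_le_iff[OF Bochner_Integration.integrable_diff[OF f integrable_polys_le[OF P'1]] \<rho>, of s]
          by blast
        have D: "(\<lambda>x. P' x - P x) \<in> polys_le s" by (intro polys_le_diff P P'1)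
        have "?orth (\<lambda>x. P' x - P x)"
        proof
          fix \<beta> assume \<beta>: "\<beta> \<in> ?I"
          have "(LINT x|?L. ?e \<beta> x *\<^sub>R (P' x - P x)) =
              (LINT x|?L. ?e \<beta> x *\<^sub>R (f x - P x) - ?e \<beta> x *\<^sub>R (f x - P' x))"
            by (intro Bochner_Integration.integral_cong refl) (simp add: algebra_simps)
          also have "\<dots> = 0"
            using P(2) P'2 \<beta>
            by (subst Bochner_Integration.integral_diff)
              (auto intro!: integrable_scaled_monomial[OF _ \<rho>] Bochner_Integration.integrable_diff
                f integrable_polys_le[OF P(1)] integrable_polys_le[OF P'1])
          finally show "(LINT x|?L. ?e \<beta> x *\<^sub>R (P' x - P x)) = 0" .
        qed
        then have "c (\<lambda>x. P' x - P x) \<alpha> = 0" for \<alpha>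
          by (intro zero integrable_polys_le[OF D])
        then have "P' x - P x = 0" for x using rep[OF D, of x] by simp
        then show "P' = P" by (simp add: fun_eq_iff)
      qed
      have in_polys: "(\<lambda>x. \<Sum>\<alpha>\<in>?I. ?e \<alpha> x *\<^sub>R c g \<alpha>) \<in> polys_le s" for g
        by (rule polys_le_scaled_sum) simp
      have proj: "poly_proj s (ball z \<rho>) f = (\<lambda>x. p x + (\<Sum>\<alpha>\<in>?I. ?e \<alpha> x *\<^sub>R c (\<lambda>x. f x - p x) \<alpha>))"
        if p: "p \<in> polys_le s" for p
      proof (rule proj_eq)
        show "(\<lambda>x. p x + (\<Sum>\<alpha>\<in>?I. ?e \<alpha> x *\<^sub>R c (\<lambda>x. f x - p x) \<alpha>)) \<in> polys_le s"
          by (intro polys_le_add p in_polys)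
        show "?orth (\<lambda>x. f x - (p x + (\<Sum>\<alpha>\<in>?I. ?e \<alpha> x *\<^sub>R c (\<lambda>x. f x - p x) \<alpha>)))"
          using orth[OF Bochner_Integration.integrable_diff[OF f integrable_polys_le[OF p]]]
          by (simp add: diff_diff_eq)
      qed
      show "poly_proj s (ball z \<rho>) f \<in> polys_le s \<and>
        (\<forall>p\<in>polys_le s. \<forall>M\<ge>0. (\<integral>\<^sup>+x\<in>ball z \<rho>. ennreal (norm (f x - p x)) \<partial>lebesgue) \<le> ennreal M \<longrightarrow>
        (\<forall>x\<in>ball z \<rho>. norm (poly_proj s (ball z \<rho>) f x - p x)
          \<le> (1 + card ?I) * C / \<rho> ^ CARD('n) * M))"
      proof (intro conjI ballI allI impI)
        show "poly_proj s (ball z \<rho>) f \<in> polys_le s"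
          unfolding proj[OF polys_le_zero] by (intro polys_le_add polys_le_zero in_polys)
        fix p M x
        assume p: "p \<in> polys_le s" and M: "0 \<le> M"
          "(\<integral>\<^sup>+x\<in>ball z \<rho>. ennreal (norm (f x - p x)) \<partial>lebesgue) \<le> ennreal M" and x: "x \<in> ball z \<rho>"
        have fp: "integrable ?L (\<lambda>x. f x - p x)"
          by (intro Bochner_Integration.integrable_diff f integrable_polys_le[OF p])
        have "norm (c (\<lambda>x. f x - p x) \<alpha>) \<le> C / \<rho> ^ CARD('n) * M" if "\<alpha> \<in> ?I" for \<alpha>
          using \<open>0 < C\<close> \<rho> that
          by (intro order_trans[OF c[OF fp]] mult_left_mono integral_ball_le[OF fp M]) auto
        moreover have "\<bar>?e \<alpha> x\<bar> \<le> 1" for \<alpha>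
          using abs_scaled_monomial_le[OF \<rho>, of x z 1 \<alpha>] x by simp
        ultimately have "norm (\<Sum>\<alpha>\<in>?I. ?e \<alpha> x *\<^sub>R c (\<lambda>x. f x - p x) \<alpha>)
            \<le> real (card ?I) * 1 * (C / \<rho> ^ CARD('n) * M)"
          by (intro scaled_sum_bound[where c = "c (\<lambda>x. f x - p x)" and e = "\<lambda>\<alpha>. ?e \<alpha> x"])
            (use \<open>0 < C\<close> \<rho> M(1) in simp_all)
        also have "\<dots> \<le> (1 + card ?I) * 1 * (C / \<rho> ^ CARD('n) * M)"
          using \<open>0 < C\<close> \<rho> M by (intro mult_right_mono) auto
        finally show "norm (poly_proj s (ball z \<rho>) f x - p x) \<le> (1 + card ?I) * C / \<rho> ^ CARD('n) * M"
          unfolding proj[OF p] by (simp add: ac_simps)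
      qed
    qed
  qed
qed

section \<open>Polynomials modulo polynomials of lower degree\<close>

lemma nn_integral_ball_le_sup:
  fixes p :: "real^'n \<Rightarrow> 'b::real_normed_vector"
  assumes "\<And>x. x \<in> ball z \<rho> \<Longrightarrow> norm (p x) \<le> \<delta>" "0 \<le> \<delta>" "0 \<le> \<rho>"
  shows "(\<integral>\<^sup>+x\<in>ball z \<rho>. ennreal (norm (p x)) \<partial>lebesgue) \<le>
    ennreal (unit_ball_vol CARD('n) * \<rho> ^ CARD('n) * \<delta>)"
proof -
  have "(\<integral>\<^sup>+x\<in>ball z \<rho>. ennreal (norm (p x)) \<partial>lebesgue) \<le> (\<integral>\<^sup>+x\<in>ball z \<rho>. ennreal \<delta> \<partial>lebesgue)"
    using assms by (intro nn_integral_mono) (auto simp: indicator_def intro!: ennreal_leI)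
  also have "\<dots> = ennreal \<delta> * emeasure lebesgue (ball z \<rho>)"
    by (simp add: nn_integral_cmult_indicator)
  also have "\<dots> = ennreal (unit_ball_vol CARD('n) * \<rho> ^ CARD('n) * \<delta>)"
    using assms by (simp add: emeasure_ball mult.commute flip: ennreal_mult')
  finally show ?thesis .
qed

lemma nn_set_integral_norm_triangle:
  fixes f g :: "real^'n \<Rightarrow> 'b::{real_normed_vector, second_countable_topology}"
  assumes [measurable]: "f \<in> borel_measurable lebesgue" "g \<in> borel_measurable lebesgue"
    "S \<in> sets lebesgue"
  shows "(\<integral>\<^sup>+x\<in>S. ennreal (norm (f x + g x)) \<partial>lebesgue) \<le>
    (\<integral>\<^sup>+x\<in>S. ennreal (norm (f x)) \<partial>lebesgue) + (\<integral>\<^sup>+x\<in>S. ennreal (norm (g x)) \<partial>lebesgue)"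
proof -
  have "(\<integral>\<^sup>+x\<in>S. ennreal (norm (f x + g x)) \<partial>lebesgue) \<le>
      (\<integral>\<^sup>+x. ennreal (norm (f x)) * indicator S x + ennreal (norm (g x)) * indicator S x \<partial>lebesgue)"
    by (intro nn_integral_mono)
      (auto simp: indicator_def norm_triangle_ineq simp flip: ennreal_plus intro!: ennreal_leI)
  also have "\<dots> = (\<integral>\<^sup>+x\<in>S. ennreal (norm (f x)) \<partial>lebesgue) + (\<integral>\<^sup>+x\<in>S. ennreal (norm (g x)) \<partial>lebesgue)"
    by (intro nn_integral_add) auto
  finally show ?thesis .
qed

lemma nn_set_integral_norm_diff_le:
  fixes f g h :: "real^'n \<Rightarrow> 'b::{real_normed_vector, second_countable_topology}"
  assumes m: "f \<in> borel_measurable lebesgue" "g \<in> borel_measurable lebesgue"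
    "h \<in> borel_measurable lebesgue" "S \<in> sets lebesgue"
    and le: "(\<integral>\<^sup>+x\<in>S. ennreal (norm (f x - g x)) \<partial>lebesgue) \<le> ennreal a"
    "(\<integral>\<^sup>+x\<in>S. ennreal (norm (f x - h x)) \<partial>lebesgue) \<le> ennreal b" and "0 \<le> a" "0 \<le> b"
  shows "(\<integral>\<^sup>+x\<in>S. ennreal (norm (g x - h x)) \<partial>lebesgue) \<le> ennreal (a + b)"
proof -
  have "(\<integral>\<^sup>+x\<in>S. ennreal (norm (g x - h x)) \<partial>lebesgue) =
      (\<integral>\<^sup>+x\<in>S. ennreal (norm (- (f x - g x) + (f x - h x))) \<partial>lebesgue)"
    by simp
  also have "\<dots> \<le> (\<integral>\<^sup>+x\<in>S. ennreal (norm (- (f x - g x))) \<partial>lebesgue) +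
      (\<integral>\<^sup>+x\<in>S. ennreal (norm (f x - h x)) \<partial>lebesgue)"
    using m by (intro nn_set_integral_norm_triangle) auto
  also have "\<dots> \<le> ennreal (a + b)"
    using le assms(7,8) by (simp add: norm_minus_commute add_mono)
  finally show ?thesis .
qed

lemma borel_measurable_polys_le: "p \<in> polys_le s \<Longrightarrow> p \<in> borel_measurable lebesgue"
  by (metis borel_measurable_continuous_onI continuous_on_polys_le measurable_completion
      measurable_lborel2)

lemma nn_set_integral_mono_set:
  "S \<subseteq> T \<Longrightarrow> (\<integral>\<^sup>+x\<in>S. f x \<partial>M) \<le> (\<integral>\<^sup>+x\<in>T. f x \<partial>M)"
  by (intro nn_integral_mono) (auto simp: indicator_def)

text \<open>
  The quotient seminorm on polynomials modulo degree \<open>m\<close>, as a relation: the seminorm of \<open>p\<close> on the ball is at most \<open>\<delta>\<close>.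
\<close>

definition near_polys :: "nat \<Rightarrow> real^'n \<Rightarrow> real \<Rightarrow> (real^'n \<Rightarrow> 'b::{real_normed_field, euclidean_space}) \<Rightarrow> real \<Rightarrow> bool" where
  "near_polys m z r p \<delta> \<longleftrightarrow> (\<exists>u\<in>polys_le m. \<forall>x\<in>ball z r. norm (p x - u x) \<le> \<delta>)"

lemma near_polys_mono: "near_polys m z r p \<delta> \<Longrightarrow> \<delta> \<le> \<epsilon> \<Longrightarrow> near_polys m z r p \<epsilon>"
  unfolding near_polys_def by (meson order_trans)

lemma near_polys_ball: "near_polys m z' r' p \<delta> \<Longrightarrow> ball z r \<subseteq> ball z' r' \<Longrightarrow> near_polys m z r p \<delta>"
  unfolding near_polys_def by blast

lemma near_polys_bounded: "(\<And>x. x \<in> ball z r \<Longrightarrow> norm (p x) \<le> \<delta>) \<Longrightarrow> near_polys m z r p \<delta>"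
  unfolding near_polys_def by (rule bexI[of _ "\<lambda>_. 0"]) (auto intro: polys_le_zero)

lemma near_polys_add:
  assumes "near_polys m z r p \<delta>" "near_polys m z r q \<epsilon>"
  shows "near_polys m z r (\<lambda>x. p x + q x) (\<delta> + \<epsilon>)"
proof -
  obtain u v where "u \<in> polys_le m" "v \<in> polys_le m"
    and uv: "\<And>x. x \<in> ball z r \<Longrightarrow> norm (p x - u x) \<le> \<delta>" "\<And>x. x \<in> ball z r \<Longrightarrow> norm (q x - v x) \<le> \<epsilon>"
    using assms unfolding near_polys_def by blast
  moreover have "norm (p x + q x - (u x + v x)) \<le> \<delta> + \<epsilon>" if "x \<in> ball z r" for x
    using norm_triangle_mono[OF uv(1)[OF that] uv(2)[OF that]] by (simp add: algebra_simps)
  ultimately show ?thesis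
    unfolding near_polys_def by (intro bexI[of _ "\<lambda>x. u x + v x"] polys_le_add) auto
qed

lemma near_polys_uminus: "near_polys m z r p \<delta> \<Longrightarrow> near_polys m z r (\<lambda>x. - p x) \<delta>"
  unfolding near_polys_def
  by (metis (no_types, lifting) minus_diff_minus norm_minus_cancel polys_le_uminus)

lemma near_polys_sum:
  assumes "\<And>i. i \<in> I \<Longrightarrow> near_polys m z r (p i) (\<delta> i)"
  shows "near_polys m z r (\<lambda>x. \<Sum>i\<in>I. p i x) (\<Sum>i\<in>I. \<delta> i)"
  using assms
  by (induction I rule: infinite_finite_induct) (auto intro: near_polys_add near_polys_bounded)

lemma near_polys_shrink:
  assumes "m \<le> s"
  shows "\<exists>C>0. \<forall>(z::real^'n) \<rho> r \<delta>. \<forall>p\<in>(polys_le s :: (real^'n \<Rightarrow> 'b::{real_normed_field, euclidean_space}) set).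
    0 < r \<longrightarrow> r \<le> \<rho> \<longrightarrow> 0 \<le> \<delta> \<longrightarrow> near_polys m z \<rho> p \<delta> \<longrightarrow>
    near_polys m z r p (C * (r / \<rho>) ^ Suc m * \<delta>)"
proof -
  obtain C where "0 < C" and C: "\<And>(z::real^'n) \<rho> M p. p \<in> (polys_le s :: (real^'n \<Rightarrow> 'b) set) \<Longrightarrow>
    0 < \<rho> \<Longrightarrow> 0 \<le> M \<Longrightarrow> (\<integral>\<^sup>+x\<in>ball z \<rho>. ennreal (norm (p x)) \<partial>lebesgue) \<le> ennreal M \<Longrightarrow>
    (\<exists>u\<in>polys_le m. \<forall>r. 0 < r \<longrightarrow> r \<le> \<rho> \<longrightarrow>
      (\<forall>x\<in>ball z r. norm (p x - u x) \<le> C * (r / \<rho>) ^ Suc m / \<rho> ^ CARD('n) * M))"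
    using polys_le_low_degree_part[of s m, where 'n = 'n and 'b = 'b] by blast
  let ?V = "unit_ball_vol (real CARD('n))"
  show ?thesis
  proof (intro exI[of _ "C * ?V"] conjI allI impI ballI)
    show "0 < C * ?V" using \<open>0 < C\<close> by simp
    fix z :: "real^'n" and \<rho> r \<delta> and p :: "real^'n \<Rightarrow> 'b"
    assume p: "p \<in> polys_le s" and r: "0 < r" "r \<le> \<rho>" and \<delta>: "0 \<le> \<delta>" and near: "near_polys m z \<rho> p \<delta>"
    then obtain u where u: "u \<in> polys_le m" and pu: "\<And>x. x \<in> ball z \<rho> \<Longrightarrow> norm (p x - u x) \<le> \<delta>"
      unfolding near_polys_def by blast
    have pu_in: "(\<lambda>x. p x - u x) \<in> polys_le s"
      using p u polys_le_mono[OF assms] by (intro polys_le_diff) auto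
    have "(\<integral>\<^sup>+x\<in>ball z \<rho>. ennreal (norm (p x - u x)) \<partial>lebesgue) \<le> ennreal (?V * \<rho> ^ CARD('n) * \<delta>)"
      using r \<delta> by (intro nn_integral_ball_le_sup pu) auto
    from C[OF pu_in _ _ this] r \<delta> obtain v where v: "v \<in> polys_le m" and
      v': "\<And>x. x \<in> ball z r \<Longrightarrow> norm (p x - u x - v x) \<le> C * (r / \<rho>) ^ Suc m / \<rho> ^ CARD('n) * (?V * \<rho> ^ CARD('n) * \<delta>)"
      by (auto simp del: power_Suc)
    have eq: "C * (r / \<rho>) ^ Suc m / \<rho> ^ CARD('n) * (?V * \<rho> ^ CARD('n) * \<delta>) = C * ?V * (r / \<rho>) ^ Suc m * \<delta>"
      using r by (simp del: power_Suc)
    show "near_polys m z r p (C * ?V * (r / \<rho>) ^ Suc m * \<delta>)"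
      unfolding near_polys_def
    proof (intro bexI[of _ "\<lambda>x. u x + v x"] polys_le_add u v ballI)
      fix x assume "x \<in> ball z r"
      from v'[OF this] show "norm (p x - (u x + v x)) \<le> C * ?V * (r / \<rho>) ^ Suc m * \<delta>"
        unfolding eq by (simp only: diff_diff_eq)
    qed
  qed
qed

text \<open>
  The space of polynomials of degree \<open>m\<close> is closed: the projection of \<open>R\<close> is as good as any approximation, up
  to a constant, hence agrees with \<open>R\<close> on the ball.
\<close>

lemma polys_le_if_near_polys:
  fixes R :: "real^'n \<Rightarrow> 'b::{real_normed_field, euclidean_space}"
  assumes R: "R \<in> polys_le s" and near: "\<And>\<epsilon>. 0 < \<epsilon> \<Longrightarrow> near_polys m 0 1 R \<epsilon>"
  shows "R \<in> polys_le m"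
proof -
  let ?V = "unit_ball_vol (real CARD('n))"
  obtain C where "0 < C" and C: "\<And>(z::real^'n) \<rho> (f :: real^'n \<Rightarrow> 'b). 0 < \<rho> \<Longrightarrow>
    integrable (lebesgue_on (ball z \<rho>)) f \<Longrightarrow> poly_proj m (ball z \<rho>) f \<in> polys_le m \<and>
    (\<forall>p\<in>polys_le m. \<forall>M\<ge>0. (\<integral>\<^sup>+x\<in>ball z \<rho>. ennreal (norm (f x - p x)) \<partial>lebesgue) \<le> ennreal M \<longrightarrow>
      (\<forall>x\<in>ball z \<rho>. norm (poly_proj m (ball z \<rho>) f x - p x) \<le> C / \<rho> ^ CARD('n) * M))"
    using poly_proj_near_optimal[of m, where 'n = 'n and 'b = 'b] by blast
  define P where "P = poly_proj m (ball 0 1) R"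
  note C = C[OF zero_less_one integrable_polys_le[OF R], of 0, folded P_def]
  have P: "P \<in> polys_le m" using C by blast
  have eq: "R x = P x" if x: "x \<in> ball 0 1" for x
  proof -
    have "norm (R x - P x) \<le> e" if e: "0 < e" for e
    proof -
      define \<epsilon> where "\<epsilon> = e / (1 + C * ?V)"
      have pos: "0 < 1 + C * ?V" using \<open>0 < C\<close> by (simp add: add_pos_pos)
      have \<epsilon>: "0 < \<epsilon>" "\<epsilon> * (1 + C * ?V) = e" using e pos by (simp_all add: \<epsilon>_def)
      obtain u where u: "u \<in> polys_le m" "\<And>x. x \<in> ball 0 1 \<Longrightarrow> norm (R x - u x) \<le> \<epsilon>"
        using near[OF \<epsilon>(1)] unfolding near_polys_def by blast
      have "(\<integral>\<^sup>+x\<in>ball 0 1. ennreal (norm (R x - u x)) \<partial>lebesgue) \<le> ennreal (?V * 1 ^ CARD('n) * \<epsilon>)"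
        using \<epsilon> by (intro nn_integral_ball_le_sup u) auto
      then have "norm (P x - u x) \<le> C / 1 ^ CARD('n) * (?V * 1 ^ CARD('n) * \<epsilon>)"
        using C u(1) x \<epsilon>(1) by (simp add: less_imp_le)
      then have "norm ((R x - u x) - (P x - u x)) \<le> \<epsilon> + C * (?V * \<epsilon>)"
        using u(2)[OF x] by (intro order_trans[OF norm_triangle_ineq4 add_mono]) simp_all
      also have "\<dots> = e" using \<epsilon>(2) by (simp add: algebra_simps)
      finally show ?thesis by simp
    qed
    then have "norm (R x - P x) \<le> 0" by (rule field_le_epsilon[of _ 0, simplified])
    then show ?thesis by simp
  qed
  have "(\<lambda>x. R x - P x) \<in> polys_le (max s m)"
    using R P polys_le_mono[of s "max s m"] polys_le_mono[of m "max s m"]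
    by (intro polys_le_diff) auto
  then have "R x - P x = 0" for x
    by (rule polys_le_eq_zeroI[OF _ zero_less_one, where z = 0]) (simp only: eq diff_self)
  then have "R = P" by (simp add: fun_eq_iff)
  with P show ?thesis by simp
qed

section \<open>Lowering the degree of approximating polynomials\<close>

lemma scaled_monomial_zero_center:
  "scaled_monomial 0 \<rho> \<alpha> x = (1 / \<rho>) ^ (\<Sum>i\<in>UNIV. \<alpha> i) * monomial \<alpha> x"
  by (simp add: scaled_monomial_def monomial_scaleR)

text \<open>
  \<open>N\<close> stands for the norm of the characteristic function of a ball; its monotonicity and its growth under
  dilation are what drives the degree reduction.
\<close>

locale ball_functional =
  fixes N :: "real^'n \<Rightarrow> real \<Rightarrow> real" and D \<kappa> :: real
  assumes pos: "0 < \<rho> \<Longrightarrow> 0 < N z \<rho>"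
    and mono: "0 < \<rho> \<Longrightarrow> ball z \<rho> \<subseteq> ball z' \<rho>' \<Longrightarrow> N z \<rho> \<le> N z' \<rho>'"
    and growth: "0 < \<rho> \<Longrightarrow> 1 \<le> R \<Longrightarrow> N z (R * \<rho>) \<le> D * R powr \<kappa> * N z \<rho>"
begin

lemma D_ge_1: "1 \<le> D"
  using growth[of 1 1 0] pos[of 1 0] by simp

definition \<tau> :: real where "\<tau> = 2 powr \<kappa>"

lemma \<tau>_pos: "0 < \<tau>" by (simp add: \<tau>_def)

lemma growth_dyadic: "0 < \<rho> \<Longrightarrow> N z (2 ^ j * \<rho>) \<le> D * \<tau> ^ j * N z \<rho>"
proof -
  assume "0 < \<rho>"
  have "((2::real) ^ j) powr \<kappa> = 2 powr (\<kappa> * real j)"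
    by (simp add: powr_powr mult.commute flip: powr_realpow)
  also have "\<dots> = \<tau> ^ j" by (simp add: \<tau>_def powr_powr flip: powr_realpow)
  finally show ?thesis using growth[of \<rho> "2 ^ j" z] \<open>0 < \<rho>\<close> by simp
qed

lemma growth_dyadic_between: 
  assumes "l \<le> k" shows "N z (2 ^ k) \<le> D * \<tau> ^ (k - l) * N z (2 ^ l)"
  using growth_dyadic[of "2 ^ l" z "k - l"] assms by (simp flip: power_add)

end

text \<open>
  The hypothesis on \<open>\<kappa>\<close> says that the gain \<open>2\<^bsup>-(m+1)\<^esup>\<close> from \<open>polys_le_low_degree_part\<close>, together with
  the factor \<open>2\<^bsup>-n\<^esup>\<close> from averaging, beats the growth \<open>2\<^sup>\<kappa>\<close> of \<open>N\<close> under doubling of a ball. The ratio of the resulting geometric series is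
  \<open>\<theta>\<close> below.
\<close>

locale high_degree_decay = ball_functional N D \<kappa> for N :: "real^'n \<Rightarrow> real \<Rightarrow> real" and D \<kappa> +
  fixes m :: nat
  assumes \<kappa>: "\<kappa> < CARD('n) + m + 1"
begin

definition \<theta> :: real where "\<theta> = \<tau> / 2 ^ (CARD('n) + Suc m)"

lemma \<theta>: "0 < \<theta>" "\<theta> < 1"
proof -
  show "0 < \<theta>" using \<tau>_pos by (simp add: \<theta>_def)
  have "2 powr \<kappa> < 2 powr (real (CARD('n) + Suc m))"
    using \<kappa> by (intro powr_less_mono) auto
  then show "\<theta> < 1" unfolding \<theta>_def \<tau>_def by (subst (asm) powr_realpow) auto
qed

lemma \<theta>_power: "(1 / 2 ^ k) ^ Suc m * (1 / (2 ^ k) ^ CARD('n)) * \<tau> ^ k = \<theta> ^ k"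
  by (simp add: \<theta>_def power_divide power_add power_mult_distrib power_mult[symmetric] mult.commute)

lemma sum_\<theta>_le: "(\<Sum>k<n. \<theta> ^ k) \<le> 1 / (1 - \<theta>)"
  using \<theta> by (simp add: sum_gp_strict divide_right_mono)

text \<open>
  Restrict the approximation on a ball of radius \<open>2\<^sup>k\<close> to the unit ball: the error there is of order \<open>\<theta>\<^sup>k\<close>.
\<close>

lemma rigidity:
  fixes R :: "real^'n \<Rightarrow> 'b::{real_normed_field, euclidean_space}"
  assumes ms: "m \<le> s" and R: "R \<in> polys_le s" and K: "0 \<le> K"
    and near: "\<And>\<rho>. 1 \<le> \<rho> \<Longrightarrow> near_polys m 0 \<rho> R (K * N 0 \<rho> / \<rho> ^ CARD('n))"
  shows "R \<in> polys_le m"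
proof (rule polys_le_if_near_polys[OF R])
  fix \<epsilon> :: real assume \<epsilon>: "0 < \<epsilon>"
  obtain C where "0 < C" and C: "\<And>(z::real^'n) \<rho> r \<delta> p. p \<in> (polys_le s :: (real^'n \<Rightarrow> 'b) set) \<Longrightarrow>
    0 < r \<Longrightarrow> r \<le> \<rho> \<Longrightarrow> 0 \<le> \<delta> \<Longrightarrow> near_polys m z \<rho> p \<delta> \<Longrightarrow> near_polys m z r p (C * (r / \<rho>) ^ Suc m * \<delta>)"
    using near_polys_shrink[OF ms, where 'n = 'n and 'b = 'b] by blast
  have "(\<lambda>k. C * K * D * N 0 1 * \<theta> ^ k) \<longlonglongrightarrow> C * K * D * N 0 1 * 0"
    using \<theta> by (intro tendsto_mult tendsto_const LIMSEQ_power_zero) auto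
  then have "eventually (\<lambda>k. C * K * D * N 0 1 * \<theta> ^ k < \<epsilon>) sequentially"
    using \<epsilon> by (intro order_tendstoD(2)[where y = "C * K * D * N 0 1 * 0"]) auto
  then obtain k where k: "C * K * D * N 0 1 * \<theta> ^ k < \<epsilon>"
    by (auto simp: eventually_sequentially)
  have "0 \<le> K * N 0 (2 ^ k) / (2 ^ k) ^ CARD('n)"
    using K pos[of "2 ^ k" 0] by simp
  from C[OF R _ _ this near[of "2 ^ k"], of 1]
  have "near_polys m 0 1 R (C * (1 / 2 ^ k) ^ Suc m * (K * N 0 (2 ^ k) / (2 ^ k) ^ CARD('n)))"
    by (simp del: power_Suc)
  moreover have "C * (1 / 2 ^ k) ^ Suc m * (K * N 0 (2 ^ k) / (2 ^ k) ^ CARD('n)) \<le>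
      C * (1 / 2 ^ k) ^ Suc m * (K * (D * \<tau> ^ k * N 0 1) / (2 ^ k) ^ CARD('n))"
    using growth_dyadic[of 1 0 k] \<open>0 < C\<close> K
    by (intro mult_left_mono divide_right_mono) auto
  moreover have "C * (1 / 2 ^ k) ^ Suc m * (K * (D * \<tau> ^ k * N 0 1) / (2 ^ k) ^ CARD('n)) =
      C * K * D * N 0 1 * \<theta> ^ k"
    unfolding \<theta>_power[symmetric] by (simp add: field_simps)
  ultimately show "near_polys m 0 1 R \<epsilon>"
    using k by (elim near_polys_mono) linarith
qed

text \<open>
  Along the balls of radius \<open>2\<^sup>k\<close> about the origin, the coefficients of degree above \<open>m\<close> form an absolutely convergent
  telescoping series; \<open>R\<close> collects their limits. The deviation at stage \<open>l\<close> consists of a polynomial of degree \<open>m\<close>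
  (the partial sums of low degree) and of the tail of the convergent series.
\<close>

lemma high_degree_limit:
  assumes ms: "m \<le> s"
  shows "\<exists>C>0. \<forall>K\<ge>0. \<forall>q :: nat \<Rightarrow> real^'n \<Rightarrow> 'b::{real_normed_field, euclidean_space}.
    (\<forall>k. q k \<in> polys_le s) \<longrightarrow>
    (\<forall>k. (\<integral>\<^sup>+x\<in>ball 0 (2 ^ k). ennreal (norm (q (Suc k) x - q k x)) \<partial>lebesgue) \<le> ennreal (K * N 0 (2 ^ Suc k))) \<longrightarrow>
    (\<exists>R\<in>polys_le s. \<forall>l. near_polys m 0 (2 ^ l) (\<lambda>x. q l x - R x) (C * K * N 0 (2 ^ l) / (2 ^ l) ^ CARD('n)))"
proof -
  obtain C where "0 < C" and C: "\<And>(z::real^'n) \<rho> M p. p \<in> (polys_le s :: (real^'n \<Rightarrow> 'b) set) \<Longrightarrow>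
    0 < \<rho> \<Longrightarrow> 0 \<le> M \<Longrightarrow> (\<integral>\<^sup>+x\<in>ball z \<rho>. ennreal (norm (p x)) \<partial>lebesgue) \<le> ennreal M \<Longrightarrow>
    (\<exists>c. (\<forall>x. p x = (\<Sum>\<alpha>\<in>multi_indices s. scaled_monomial z \<rho> \<alpha> x *\<^sub>R c \<alpha>)) \<and>
      (\<forall>\<alpha>\<in>multi_indices s. norm (c \<alpha>) \<le> C / \<rho> ^ CARD('n) * M))"
    using polys_le_coefficients[of s, where 'n = 'n and 'b = 'b] by blast
  let ?I = "multi_indices s :: ('n \<Rightarrow> nat) set" and ?J = "multi_indices m :: ('n \<Rightarrow> nat) set"
  have JI: "?J \<subseteq> ?I" using ms by (rule multi_indices_mono)
  let ?c = "real (card (?I - ?J))"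
  define C' where "C' = (1 + ?c) * (C * D * \<tau> / (1 - \<theta>))"
  have C': "0 < C'"
    unfolding C'_def using \<open>0 < C\<close> D_ge_1 \<tau>_pos \<theta> by (intro mult_pos_pos divide_pos_pos) auto
  show ?thesis
  proof (intro exI[of _ C'] conjI C' allI impI)
    fix K :: real and q :: "nat \<Rightarrow> real^'n \<Rightarrow> 'b"
    assume K: "0 \<le> K" and q: "\<forall>k. q k \<in> polys_le s"
      and osc: "\<forall>k. (\<integral>\<^sup>+x\<in>ball 0 (2 ^ k). ennreal (norm (q (Suc k) x - q k x)) \<partial>lebesgue) \<le> ennreal (K * N 0 (2 ^ Suc k))"
    have Npos: "0 < N 0 (2 ^ k)" for k by (intro pos) simp
    have "\<forall>k. \<exists>c. (\<forall>x. q (Suc k) x - q k x = (\<Sum>\<alpha>\<in>?I. scaled_monomial 0 (2 ^ k) \<alpha> x *\<^sub>R c \<alpha>)) \<and>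
        (\<forall>\<alpha>\<in>?I. norm (c \<alpha>) \<le> C / (2 ^ k) ^ CARD('n) * (K * N 0 (2 ^ Suc k)))"
    proof
      fix k
      show "\<exists>c. (\<forall>x. q (Suc k) x - q k x = (\<Sum>\<alpha>\<in>?I. scaled_monomial 0 (2 ^ k) \<alpha> x *\<^sub>R c \<alpha>)) \<and>
        (\<forall>\<alpha>\<in>?I. norm (c \<alpha>) \<le> C / (2 ^ k) ^ CARD('n) * (K * N 0 (2 ^ Suc k)))"
        by (rule C[OF polys_le_diff]) (use q osc K Npos[of "Suc k"] in auto)
    qed
    from choice[OF this] obtain c where c: "\<And>k x. q (Suc k) x - q k x = (\<Sum>\<alpha>\<in>?I. scaled_monomial 0 (2 ^ k) \<alpha> x *\<^sub>R c k \<alpha>)"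
      "\<And>k \<alpha>. \<alpha> \<in> ?I \<Longrightarrow> norm (c k \<alpha>) \<le> C / (2 ^ k) ^ CARD('n) * (K * N 0 (2 ^ Suc k))"
      by blast
    define d where "d k \<alpha> = (1 / 2 ^ k) ^ (\<Sum>i\<in>UNIV. \<alpha> i) *\<^sub>R c k \<alpha>" for k \<alpha>
    have cd: "q (Suc k) x - q k x = (\<Sum>\<alpha>\<in>?I. monomial \<alpha> x *\<^sub>R d k \<alpha>)" for k x
      unfolding c d_def scaled_monomial_zero_center by (simp add: mult.commute)
    define E where "E l = C * D * \<tau> * K * N 0 (2 ^ l) / (2 ^ l) ^ CARD('n)" for l
    have E: "0 \<le> E l" for l
      using \<open>0 < C\<close> D_ge_1 \<tau>_pos K Npos[of l] by (simp add: E_def)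
    \<comment> \<open>Measured on the ball of radius \<open>2\<^sup>l\<close>, the high coefficients decay geometrically beyond stage \<open>l\<close>.\<close>
    have d_bound: "(2 ^ l) ^ (\<Sum>i\<in>UNIV. \<alpha> i) * norm (d (j + l) \<alpha>) \<le> E l * \<theta> ^ j"
      if \<alpha>: "\<alpha> \<in> ?I - ?J" for \<alpha> j l
    proof -
      let ?a = "\<Sum>i\<in>UNIV. \<alpha> i"
      have "(2 ^ l) ^ ?a * norm (d (j + l) \<alpha>) = (1 / 2 ^ j) ^ ?a * norm (c (j + l) \<alpha>)"
        by (simp add: d_def power_add power_mult_distrib power_divide)
      also have "\<dots> \<le> (1 / 2 ^ j) ^ Suc m * (C / (2 ^ (j + l)) ^ CARD('n) * (K * N 0 (2 ^ Suc (j + l))))"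
        using \<alpha> by (intro mult_mono c power_decreasing) (auto simp: multi_indices_def simp del: power_Suc)
      also have "\<dots> \<le> (1 / 2 ^ j) ^ Suc m * (C / (2 ^ (j + l)) ^ CARD('n) * (K * (D * \<tau> ^ (Suc (j + l) - l) * N 0 (2 ^ l))))"
        using \<open>0 < C\<close> K by (intro mult_left_mono growth_dyadic_between) auto
      also have "\<dots> = E l * ((1 / 2 ^ j) ^ Suc m * (1 / (2 ^ j) ^ CARD('n)) * \<tau> ^ j)"
        by (simp add: E_def power_add power_mult_distrib Suc_diff_le field_simps)
      finally show ?thesis unfolding \<theta>_power .
    qed
    have geo: "summable (\<lambda>j. E l * \<theta> ^ j)" for l
      using \<theta> by (intro summable_mult summable_geometric) auto
    have summ0: "summable (\<lambda>j. norm (d (j + l) \<alpha>))" if \<alpha>: "\<alpha> \<in> ?I - ?J" for \<alpha> l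
    proof (rule summable_comparison_test'[OF geo[of l], of 0])
      fix j
      have "1 * norm (d (j + l) \<alpha>) \<le> (2 ^ l) ^ (\<Sum>i\<in>UNIV. \<alpha> i) * norm (d (j + l) \<alpha>)"
        by (intro mult_right_mono) (auto intro!: one_le_power)
      also note d_bound[OF \<alpha>]
      finally show "norm (norm (d (j + l) \<alpha>)) \<le> E l * \<theta> ^ j" by simp
    qed
    have summ: "summable (\<lambda>j. d (j + l) \<alpha>)" if "\<alpha> \<in> ?I - ?J" for \<alpha> l
      by (rule summable_norm_cancel[OF summ0[OF that]])
    define R where "R x = q 0 x + (\<Sum>\<alpha>\<in>?I - ?J. monomial \<alpha> x *\<^sub>R (\<Sum>k. d k \<alpha>))" for x
    show "\<exists>R\<in>polys_le s. \<forall>l. near_polys m 0 (2 ^ l) (\<lambda>x. q l x - R x) (C' * K * N 0 (2 ^ l) / (2 ^ l) ^ CARD('n))"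
    proof (intro bexI[of _ R] allI)
      show "R \<in> polys_le s"
        unfolding R_def[abs_def] using q by (intro polys_le_add polys_le_sum polys_le_monomial) auto
      fix l
      define u where "u x = (\<Sum>k<l. \<Sum>\<alpha>\<in>?J. monomial \<alpha> x *\<^sub>R d k \<alpha>)" for x
      have diff: "q l x - R x - u x = - (\<Sum>\<alpha>\<in>?I - ?J. monomial \<alpha> x *\<^sub>R (\<Sum>j. d (j + l) \<alpha>))" for x
      proof -
        have "q l x - q 0 x = (\<Sum>k<l. q (Suc k) x - q k x)" by (rule sum_lessThan_telescope[symmetric])
        also have "\<dots> = (\<Sum>k<l. (\<Sum>\<alpha>\<in>?J. monomial \<alpha> x *\<^sub>R d k \<alpha>) + (\<Sum>\<alpha>\<in>?I - ?J. monomial \<alpha> x *\<^sub>R d k \<alpha>))"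
          unfolding cd by (intro sum.cong refl) (simp add: sum.subset_diff[OF JI] add.commute)
        also have "\<dots> = u x + (\<Sum>\<alpha>\<in>?I - ?J. monomial \<alpha> x *\<^sub>R (\<Sum>k<l. d k \<alpha>))"
          by (simp add: u_def sum.distrib scaleR_sum_right sum.swap[of _ "{..<l}"])
        finally have "q l x - R x - u x =
          (\<Sum>\<alpha>\<in>?I - ?J. monomial \<alpha> x *\<^sub>R (\<Sum>k<l. d k \<alpha>)) - (\<Sum>\<alpha>\<in>?I - ?J. monomial \<alpha> x *\<^sub>R (\<Sum>k. d k \<alpha>))"
          by (simp add: R_def algebra_simps)
        also have "\<dots> = (\<Sum>\<alpha>\<in>?I - ?J. - (monomial \<alpha> x *\<^sub>R (\<Sum>j. d (j + l) \<alpha>)))"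
          unfolding sum_subtractf[symmetric]
        proof (intro sum.cong refl)
          fix \<alpha> assume "\<alpha> \<in> ?I - ?J"
          from suminf_split_initial_segment[OF summ[OF this, of 0, simplified], of l]
          show "monomial \<alpha> x *\<^sub>R (\<Sum>k<l. d k \<alpha>) - monomial \<alpha> x *\<^sub>R (\<Sum>k. d k \<alpha>) =
              - (monomial \<alpha> x *\<^sub>R (\<Sum>j. d (j + l) \<alpha>))"
            by (simp add: scaleR_add_right)
        qed
        finally show ?thesis by (simp add: sum_negf)
      qed
      have "near_polys m 0 (2 ^ l) (\<lambda>x. q l x - R x) (?c * (E l / (1 - \<theta>)))"
        unfolding near_polys_def
      proof (intro bexI[of _ u] ballI)
        show "u \<in> polys_le m"
          unfolding u_def[abs_def] by (intro polys_le_sum polys_le_monomial)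
        fix x :: "real^'n" assume x: "x \<in> ball 0 (2 ^ l)"
        have "norm (monomial \<alpha> x *\<^sub>R (\<Sum>j. d (j + l) \<alpha>)) \<le> E l / (1 - \<theta>)" if \<alpha>: "\<alpha> \<in> ?I - ?J" for \<alpha>
        proof -
          have "norm (monomial \<alpha> x *\<^sub>R (\<Sum>j. d (j + l) \<alpha>)) \<le>
              (2 ^ l) ^ (\<Sum>i\<in>UNIV. \<alpha> i) * (\<Sum>j. norm (d (j + l) \<alpha>))"
            unfolding norm_scaleR real_norm_def using x
            by (intro mult_mono summable_norm summ0[OF \<alpha>] order_trans[OF abs_monomial_le] power_mono) auto
          also have "\<dots> = (\<Sum>j. (2 ^ l) ^ (\<Sum>i\<in>UNIV. \<alpha> i) * norm (d (j + l) \<alpha>))"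
            by (rule suminf_mult[OF summ0[OF \<alpha>], symmetric])
          also have "\<dots> \<le> (\<Sum>j. E l * \<theta> ^ j)"
            by (intro suminf_le d_bound \<alpha> geo summable_mult summ0[OF \<alpha>])
          also have "\<dots> = E l / (1 - \<theta>)"
            using \<theta> by (simp add: suminf_mult suminf_geometric summable_geometric)
          finally show ?thesis .
        qed
        then have "norm (\<Sum>\<alpha>\<in>?I - ?J. monomial \<alpha> x *\<^sub>R (\<Sum>j. d (j + l) \<alpha>)) \<le> (\<Sum>\<alpha>\<in>?I - ?J. E l / (1 - \<theta>))"
          by (rule sum_norm_le)
        then show "norm (q l x - R x - u x) \<le> ?c * (E l / (1 - \<theta>))"
          unfolding diff by simp
      qed
      moreover have "?c * (E l / (1 - \<theta>)) \<le> (1 + ?c) * (E l / (1 - \<theta>))"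
        using E[of l] \<theta> by (intro mult_right_mono) auto
      moreover have "(1 + ?c) * (E l / (1 - \<theta>)) = C' * K * N 0 (2 ^ l) / (2 ^ l) ^ CARD('n)"
        by (simp add: C'_def E_def mult_ac)
      ultimately show "near_polys m 0 (2 ^ l) (\<lambda>x. q l x - R x) (C' * K * N 0 (2 ^ l) / (2 ^ l) ^ CARD('n))"
        by (elim near_polys_mono) linarith
    qed
  qed
qed


text \<open>
  The polynomial \<open>R\<close> is the limit along balls about the origin. For an arbitrary ball, go up the chain of its
  concentric dyadic dilates until the dilate is comparable with a ball about the origin, and compare there. Passing back down the
  chain, each step contributes a term of the geometric series modulo degree \<open>m\<close>.
\<close>

theorem degree_reduction:
  assumes ms: "m \<le> s"
  shows "\<exists>C>0. \<forall>K\<ge>0. \<forall>f\<in>borel_measurable lebesgue. \<forall>P :: real^'n \<Rightarrow> real \<Rightarrow> real^'n \<Rightarrow> 'b::{real_normed_field, euclidean_space}.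
    (\<forall>z \<rho>. 0 < \<rho> \<longrightarrow> P z \<rho> \<in> polys_le s \<and>
      (\<integral>\<^sup>+x\<in>ball z \<rho>. ennreal (norm (f x - P z \<rho> x)) \<partial>lebesgue) \<le> ennreal (K * N z \<rho>)) \<longrightarrow>
    (\<exists>R\<in>polys_le s. \<forall>z \<rho>. 0 < \<rho> \<longrightarrow>
      near_polys m z \<rho> (\<lambda>x. P z \<rho> x - R x) (C * K * N z \<rho> / \<rho> ^ CARD('n)))"
proof -
  obtain C1 where "0 < C1" and C1: "\<And>(z::real^'n) \<rho> M R p. p \<in> (polys_le s :: (real^'n \<Rightarrow> 'b) set) \<Longrightarrow>
    0 < \<rho> \<Longrightarrow> 1 \<le> R \<Longrightarrow> 0 \<le> M \<Longrightarrow>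
    (\<integral>\<^sup>+x\<in>ball z \<rho>. ennreal (norm (p x)) \<partial>lebesgue) \<le> ennreal M \<Longrightarrow>
    \<forall>x\<in>ball z (R * \<rho>). norm (p x) \<le> C1 * R ^ s / \<rho> ^ CARD('n) * M"
    using polys_le_sup_bound[of s, where 'n = 'n and 'b = 'b] by blast
  obtain C2 where "0 < C2" and C2: "\<And>(z::real^'n) \<rho> r \<delta> p. p \<in> (polys_le s :: (real^'n \<Rightarrow> 'b) set) \<Longrightarrow>
    0 < r \<Longrightarrow> r \<le> \<rho> \<Longrightarrow> 0 \<le> \<delta> \<Longrightarrow> near_polys m z \<rho> p \<delta> \<Longrightarrow> near_polys m z r p (C2 * (r / \<rho>) ^ Suc m * \<delta>)"
    using near_polys_shrink[OF ms, where 'n = 'n and 'b = 'b] by blast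
  obtain C3 where "0 < C3" and C3: "\<And>K q. 0 \<le> K \<Longrightarrow> \<forall>k. (q k :: real^'n \<Rightarrow> 'b) \<in> polys_le s \<Longrightarrow>
    \<forall>k. (\<integral>\<^sup>+x\<in>ball 0 (2 ^ k). ennreal (norm (q (Suc k) x - q k x)) \<partial>lebesgue) \<le> ennreal (K * N 0 (2 ^ Suc k)) \<Longrightarrow>
    \<exists>R\<in>polys_le s. \<forall>l. near_polys m 0 (2 ^ l) (\<lambda>x. q l x - R x) (C3 * K * N 0 (2 ^ l) / (2 ^ l) ^ CARD('n))"
    using high_degree_limit[OF ms, where 'b = 'b] by blast
  define C where "C = 2 * C1 * C2 * D * \<tau> / (1 - \<theta>) + C2 * (C1 + C3) * 2 * D * \<tau> ^ 3"
  have D: "0 < D" using D_ge_1 by simp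
  have "0 < C"
    unfolding C_def using \<open>0 < C1\<close> \<open>0 < C2\<close> \<open>0 < C3\<close> D \<tau>_pos \<theta>
    by (intro add_pos_pos mult_pos_pos divide_pos_pos) auto
  show ?thesis
  proof (intro exI[of _ C] conjI \<open>0 < C\<close> allI impI ballI)
    fix K :: real and f :: "real^'n \<Rightarrow> 'b" and P :: "real^'n \<Rightarrow> real \<Rightarrow> real^'n \<Rightarrow> 'b"
    assume K: "0 \<le> K" and f: "f \<in> borel_measurable lebesgue" and
      PP: "\<forall>z \<rho>. 0 < \<rho> \<longrightarrow> P z \<rho> \<in> polys_le s \<and>
        (\<integral>\<^sup>+x\<in>ball z \<rho>. ennreal (norm (f x - P z \<rho> x)) \<partial>lebesgue) \<le> ennreal (K * N z \<rho>)"
    have P: "\<And>z \<rho>. 0 < \<rho> \<Longrightarrow> P z \<rho> \<in> polys_le s" and osc: "\<And>z \<rho>. 0 < \<rho> \<Longrightarrow>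
        (\<integral>\<^sup>+x\<in>ball z \<rho>. ennreal (norm (f x - P z \<rho> x)) \<partial>lebesgue) \<le> ennreal (K * N z \<rho>)"
      using PP by blast+
    have compare: "(\<integral>\<^sup>+x\<in>ball z \<rho>. ennreal (norm (P z' \<rho>' x - P z \<rho> x)) \<partial>lebesgue) \<le> ennreal (2 * K * N z' \<rho>')"
      if sub: "ball z \<rho> \<subseteq> ball z' \<rho>'" and \<rho>: "0 < \<rho>" "0 < \<rho>'" for z z' \<rho> \<rho>'
    proof -
      have "(\<integral>\<^sup>+x\<in>ball z \<rho>. ennreal (norm (f x - P z' \<rho>' x)) \<partial>lebesgue) \<le> ennreal (K * N z' \<rho>')"
        by (rule order_trans[OF nn_set_integral_mono_set[OF sub] osc[OF \<rho>(2)]])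
      moreover have "(\<integral>\<^sup>+x\<in>ball z \<rho>. ennreal (norm (f x - P z \<rho> x)) \<partial>lebesgue) \<le> ennreal (K * N z' \<rho>')"
        by (intro order_trans[OF osc[OF \<rho>(1)]] ennreal_leI mult_left_mono mono[OF \<rho>(1) sub] K)
      ultimately have "(\<integral>\<^sup>+x\<in>ball z \<rho>. ennreal (norm (P z' \<rho>' x - P z \<rho> x)) \<partial>lebesgue) \<le>
          ennreal (K * N z' \<rho>' + K * N z' \<rho>')"
        using \<rho> K pos[OF \<rho>(2), of z']
        by (intro nn_set_integral_norm_diff_le[OF f]) (auto intro: borel_measurable_polys_le P)
      moreover have "K * N z' \<rho>' + K * N z' \<rho>' = 2 * K * N z' \<rho>'" by simp
      ultimately show ?thesis by (simp only:)
    qed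
    have diff_near: "near_polys m z \<rho> (\<lambda>x. P z' \<rho>' x - P z \<rho> x) (2 * C1 * K * N z' \<rho>' / \<rho> ^ CARD('n))"
      if sub: "ball z \<rho> \<subseteq> ball z' \<rho>'" and \<rho>: "0 < \<rho>" "0 < \<rho>'" for z z' \<rho> \<rho>'
    proof (rule near_polys_bounded)
      fix x assume x: "x \<in> ball z \<rho>"
      have "norm (P z' \<rho>' x - P z \<rho> x) \<le> C1 * 1 ^ s / \<rho> ^ CARD('n) * (2 * K * N z' \<rho>')"
        using C1[OF polys_le_diff[OF P[OF \<rho>(2), of z'] P[OF \<rho>(1), of z]] \<rho>(1) order_refl _ compare[OF that]]
          x K pos[OF \<rho>(2), of z'] by simp
      then show "norm (P z' \<rho>' x - P z \<rho> x) \<le> 2 * C1 * K * N z' \<rho>' / \<rho> ^ CARD('n)"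
        by (simp add: mult_ac)
    qed
    have "\<exists>R\<in>polys_le s. \<forall>l. near_polys m 0 (2 ^ l) (\<lambda>x. P 0 (2 ^ l) x - R x)
        (C3 * (2 * K) * N 0 (2 ^ l) / (2 ^ l) ^ CARD('n))"
    proof (rule C3[of "2 * K" "\<lambda>k. P 0 (2 ^ k)"])
      show "\<forall>k. (\<integral>\<^sup>+x\<in>ball 0 (2 ^ k). ennreal (norm (P 0 (2 ^ Suc k) x - P 0 (2 ^ k) x)) \<partial>lebesgue)
          \<le> ennreal (2 * K * N 0 (2 ^ Suc k))"
        by (intro allI compare subset_ball) auto
    qed (use K P in auto)
    then obtain R where R: "R \<in> polys_le s" and R_near: "\<And>l. near_polys m 0 (2 ^ l) (\<lambda>x. P 0 (2 ^ l) x - R x)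
        (C3 * (2 * K) * N 0 (2 ^ l) / (2 ^ l) ^ CARD('n))" by blast
    show "\<exists>R\<in>polys_le s. \<forall>z \<rho>. 0 < \<rho> \<longrightarrow>
      near_polys m z \<rho> (\<lambda>x. P z \<rho> x - R x) (C * K * N z \<rho> / \<rho> ^ CARD('n))"
    proof (intro bexI[of _ R] R allI impI)
      fix z :: "real^'n" and \<rho> :: real
      assume \<rho>: "0 < \<rho>"
      define A where "A = K * N z \<rho> / \<rho> ^ CARD('n)"
      have A: "0 \<le> A" using K pos[OF \<rho>, of z] \<rho> by (simp add: A_def)
      have shrink: "near_polys m z \<rho> p (C2 * B * D * \<tau> ^ i * A * \<theta> ^ k)"
        if p: "p \<in> polys_le s" and near: "near_polys m z (2 ^ k * \<rho>) p (B * K * M / (2 ^ k * \<rho>) ^ CARD('n))"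
          and M: "0 \<le> M" "M \<le> D * \<tau> ^ (i + k) * N z \<rho>" and B: "0 \<le> B"
        for p :: "real^'n \<Rightarrow> 'b" and B M :: real and i k :: nat
      proof -
        have le: "\<rho> \<le> 2 ^ k * \<rho>" using \<rho> by (simp add: mult_le_cancel_right1)
        have "0 \<le> B * K * M / (2 ^ k * \<rho>) ^ CARD('n)" using B K M \<rho> by simp
        from C2[OF p \<rho> le this near]
        have "near_polys m z \<rho> p (C2 * (1 / 2 ^ k) ^ Suc m * (B * K * M / (2 ^ k * \<rho>) ^ CARD('n)))"
          using \<rho> by (simp del: power_Suc)
        moreover have "C2 * (1 / 2 ^ k) ^ Suc m * (B * K * M / (2 ^ k * \<rho>) ^ CARD('n)) \<le>
            C2 * (1 / 2 ^ k) ^ Suc m * (B * K * (D * \<tau> ^ (i + k) * N z \<rho>) / (2 ^ k * \<rho>) ^ CARD('n))"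
          using \<open>0 < C2\<close> B K \<rho> M by (intro mult_left_mono divide_right_mono) auto
        moreover have "C2 * (1 / 2 ^ k) ^ Suc m * (B * K * (D * \<tau> ^ (i + k) * N z \<rho>) / (2 ^ k * \<rho>) ^ CARD('n)) =
            C2 * B * D * \<tau> ^ i * A * \<theta> ^ k"
          unfolding \<theta>_power[symmetric] A_def
          by (simp add: power_mult_distrib power_add mult_ac del: power_Suc)
        ultimately show ?thesis by (elim near_polys_mono) simp
      qed
      \<comment> \<open>The dilate by \<open>2\<^sup>k\<close> reaches the origin; the ball of radius \<open>2\<^sup>l\<close> about the origin then lies between it
        and its dilate by 8.\<close>
      obtain k where k: "1 \<le> 2 ^ k * \<rho>" "norm z \<le> 2 ^ k * \<rho>"
      proof -
        obtain k where "max 1 (norm z) / \<rho> < 2 ^ k" using real_arch_pow[of 2] by auto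
        then have "max 1 (norm z) < 2 ^ k * \<rho>" using \<rho> by (simp add: pos_divide_less_eq)
        then show ?thesis by (intro that[of k]) auto
      qed
      define \<rho>k where "\<rho>k = 2 ^ k * \<rho>"
      have ex: "\<exists>l. 2 * \<rho>k \<le> 2 ^ l" using real_arch_pow[of 2 "2 * \<rho>k"] by (auto intro: less_imp_le)
      define l where "l = (LEAST l. 2 * \<rho>k \<le> 2 ^ l)"
      have l1: "2 * \<rho>k \<le> 2 ^ l" unfolding l_def by (rule LeastI_ex[OF ex])
      have l2: "(2::real) ^ l \<le> 4 * \<rho>k"
      proof (cases l)
        case 0 then show ?thesis using k by (simp add: \<rho>k_def)
      next
        case (Suc j)
        then have "\<not> 2 * \<rho>k \<le> 2 ^ j" unfolding l_def by (intro not_less_Least) simp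
        then show ?thesis using Suc by simp
      qed
      have \<rho>k: "0 < \<rho>k" using \<rho> by (simp add: \<rho>k_def)
      have sub1: "ball z \<rho>k \<subseteq> ball 0 (2 ^ l)"
        using l1 k unfolding \<rho>k_def[symmetric] by (subst ball_subset_ball_iff) (auto simp: dist_norm)
      have sub2: "ball 0 (2 ^ l) \<subseteq> ball z (2 ^ (3 + k) * \<rho>)"
        using l2 k \<rho>k by (subst ball_subset_ball_iff) (auto simp: dist_norm power_add \<rho>k_def)
      have far: "near_polys m z \<rho> (\<lambda>x. P z \<rho>k x - R x) (C2 * (2 * (C1 + C3)) * D * \<tau> ^ 3 * A * \<theta> ^ k)"
      proof (rule shrink[of _ _ _ "N 0 (2 ^ l)"])
        show "(\<lambda>x. P z \<rho>k x - R x) \<in> polys_le s" by (intro polys_le_diff P R \<rho>k)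
        have "near_polys m z \<rho>k (\<lambda>x. - (P 0 (2 ^ l) x - P z \<rho>k x) + (P 0 (2 ^ l) x - R x))
            (2 * C1 * K * N 0 (2 ^ l) / \<rho>k ^ CARD('n) + C3 * (2 * K) * N 0 (2 ^ l) / (2 ^ l) ^ CARD('n))"
          using sub1 \<rho>k
          by (intro near_polys_add near_polys_uminus diff_near near_polys_ball[OF R_near]) auto
        then have near: "near_polys m z \<rho>k (\<lambda>x. P z \<rho>k x - R x)
            (2 * C1 * K * N 0 (2 ^ l) / \<rho>k ^ CARD('n) + C3 * (2 * K) * N 0 (2 ^ l) / (2 ^ l) ^ CARD('n))"
          by simp
        have "C3 * (2 * K) * N 0 (2 ^ l) / (2 ^ l) ^ CARD('n) \<le> C3 * (2 * K) * N 0 (2 ^ l) / \<rho>k ^ CARD('n)"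
          using \<open>0 < C3\<close> K pos[of "2 ^ l" 0] l1 \<rho>k
          by (intro divide_left_mono power_mono mult_nonneg_nonneg mult_pos_pos) auto
        from near_polys_mono[OF near add_left_mono[OF this]]
        show "near_polys m z (2 ^ k * \<rho>) (\<lambda>x. P z \<rho>k x - R x)
            (2 * (C1 + C3) * K * N 0 (2 ^ l) / (2 ^ k * \<rho>) ^ CARD('n))"
          unfolding \<rho>k_def[symmetric] by (simp add: add_divide_distrib[symmetric] algebra_simps)
        show "0 \<le> N 0 (2 ^ l)" using pos[of "2 ^ l" 0] by simp
        show "N 0 (2 ^ l) \<le> D * \<tau> ^ (3 + k) * N z \<rho>"
          by (rule order_trans[OF mono[OF _ sub2] growth_dyadic[OF \<rho>]]) simp
      qed (use \<open>0 < C1\<close> \<open>0 < C3\<close> in auto)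
      have step: "near_polys m z \<rho> (\<lambda>x. P z (2 ^ Suc j * \<rho>) x - P z (2 ^ j * \<rho>) x)
          (C2 * (2 * C1) * D * \<tau> ^ 1 * A * \<theta> ^ j)" for j
      proof (rule shrink[of _ _ _ "N z (2 ^ Suc j * \<rho>)"])
        show "near_polys m z (2 ^ j * \<rho>) (\<lambda>x. P z (2 ^ Suc j * \<rho>) x - P z (2 ^ j * \<rho>) x)
            (2 * C1 * K * N z (2 ^ Suc j * \<rho>) / (2 ^ j * \<rho>) ^ CARD('n))"
          using \<rho> by (intro diff_near subset_ball) auto
        show "N z (2 ^ Suc j * \<rho>) \<le> D * \<tau> ^ (1 + j) * N z \<rho>"
          using growth_dyadic[OF \<rho>, of z "Suc j"] by simp
        show "0 \<le> N z (2 ^ Suc j * \<rho>)" using pos[of "2 ^ Suc j * \<rho>" z] \<rho> by simp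
      qed (use \<open>0 < C1\<close> \<rho> in \<open>auto intro!: polys_le_diff P\<close>)
      have "near_polys m z \<rho> (\<lambda>x. (P z \<rho>k x - R x) + - (\<Sum>j<k. P z (2 ^ Suc j * \<rho>) x - P z (2 ^ j * \<rho>) x))
          (C2 * (2 * (C1 + C3)) * D * \<tau> ^ 3 * A * \<theta> ^ k + (\<Sum>j<k. C2 * (2 * C1) * D * \<tau> ^ 1 * A * \<theta> ^ j))"
        by (intro near_polys_add near_polys_uminus near_polys_sum far step)
      moreover have "(P z \<rho>k x - R x) + - (\<Sum>j<k. P z (2 ^ Suc j * \<rho>) x - P z (2 ^ j * \<rho>) x) = P z \<rho> x - R x" for x
        using sum_lessThan_telescope[of "\<lambda>j. P z (2 ^ j * \<rho>) x" k] by (simp add: \<rho>k_def)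
      ultimately have near: "near_polys m z \<rho> (\<lambda>x. P z \<rho> x - R x)
          (C2 * (2 * (C1 + C3)) * D * \<tau> ^ 3 * A * \<theta> ^ k + (\<Sum>j<k. C2 * (2 * C1) * D * \<tau> ^ 1 * A * \<theta> ^ j))"
        by (simp only:)
      have "C2 * (2 * (C1 + C3)) * D * \<tau> ^ 3 * A * \<theta> ^ k \<le> C2 * (2 * (C1 + C3)) * D * \<tau> ^ 3 * A * 1"
        using \<open>0 < C1\<close> \<open>0 < C2\<close> \<open>0 < C3\<close> D \<tau>_pos \<theta> A
        by (intro mult_left_mono power_le_one mult_nonneg_nonneg) auto
      moreover have "(\<Sum>j<k. C2 * (2 * C1) * D * \<tau> ^ 1 * A * \<theta> ^ j) \<le> C2 * (2 * C1) * D * \<tau> * A * (1 / (1 - \<theta>))"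
        unfolding sum_distrib_left[symmetric] power_one_right
        using \<open>0 < C1\<close> \<open>0 < C2\<close> D \<tau>_pos A
        by (intro mult_left_mono sum_\<theta>_le mult_nonneg_nonneg) auto
      moreover have "C2 * (2 * (C1 + C3)) * D * \<tau> ^ 3 * A * 1 + C2 * (2 * C1) * D * \<tau> * A * (1 / (1 - \<theta>)) =
          C * K * N z \<rho> / \<rho> ^ CARD('n)"
      proof -
        have "C * K * N z \<rho> / \<rho> ^ CARD('n) = C * A" by (simp add: A_def)
        also have "\<dots> = C2 * (2 * (C1 + C3)) * D * \<tau> ^ 3 * A * 1 + C2 * (2 * C1) * D * \<tau> * A * (1 / (1 - \<theta>))"
          by (simp add: C_def distrib_left distrib_right mult_ac)
        finally show ?thesis by (rule sym)
      qed
      ultimately show "near_polys m z \<rho> (\<lambda>x. P z \<rho> x - R x) (C * K * N z \<rho> / \<rho> ^ CARD('n))"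
        using near_polys_mono[OF near, of "C * K * N z \<rho> / \<rho> ^ CARD('n)"] by linarith
    qed
  qed
qed

end

section \<open>Dyadic cubes\<close>

text \<open>
  All comparisons of integrals over a family of stopping cubes go through this lemma, applied with varying densities.
\<close>

lemma nn_set_integral_Union_mono:
  fixes f g :: "'a::euclidean_space \<Rightarrow> ennreal"
  assumes F: "countable F" "disjoint F" "F \<subseteq> sets lebesgue"
    and [measurable]: "f \<in> borel_measurable lebesgue" "g \<in> borel_measurable lebesgue"
    and le: "\<And>Q. Q \<in> F \<Longrightarrow> (\<integral>\<^sup>+x\<in>Q. f x \<partial>lebesgue) \<le> (\<integral>\<^sup>+x\<in>Q. g x \<partial>lebesgue)"
  shows "(\<integral>\<^sup>+x\<in>\<Union>F. f x \<partial>lebesgue) \<le> (\<integral>\<^sup>+x\<in>\<Union>F. g x \<partial>lebesgue)"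
proof -
  have eq: "(\<integral>\<^sup>+x\<in>\<Union>F. h x \<partial>lebesgue) = (\<integral>\<^sup>+Q. (\<integral>\<^sup>+x\<in>Q. h x \<partial>lebesgue) \<partial>count_space F)"
    if [measurable]: "h \<in> borel_measurable lebesgue" for h :: "'a \<Rightarrow> ennreal"
  proof -
    have "(\<integral>\<^sup>+x\<in>\<Union>F. h x \<partial>lebesgue) = emeasure (density lebesgue h) (\<Union>((\<lambda>Q. Q) ` F))"
      using F by (subst emeasure_density) (auto intro!: sets.countable_Union)
    also have "\<dots> = (\<integral>\<^sup>+Q. emeasure (density lebesgue h) Q \<partial>count_space F)"
      using F by (intro emeasure_UN_countable) (auto simp: disjoint_family_on_def pairwise_def disjnt_def)
    also have "\<dots> = (\<integral>\<^sup>+Q. (\<integral>\<^sup>+x\<in>Q. h x \<partial>lebesgue) \<partial>count_space F)"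
      using F by (intro nn_integral_cong emeasure_density) auto
    finally show ?thesis .
  qed
  show ?thesis
    by (subst (1 2) eq) (auto intro!: nn_integral_mono le)
qed

text \<open>
  Half-open cubes of side \<open>L/2\<^sup>k\<close>. Describing the cube of generation \<open>k\<close> that contains \<open>x\<close> as the set of points with the same integer
  index as \<open>x\<close> makes disjointness and nesting immediate.
\<close>

locale dyadic_grid =
  fixes corner :: "real^'n" and L :: real
  assumes L: "0 < L"
begin

definition idx :: "nat \<Rightarrow> real^'n \<Rightarrow> 'n \<Rightarrow> int" where
  "idx k x i = \<lfloor>2 ^ k * (x $ i - corner $ i) / L\<rfloor>"

definition cube :: "nat \<Rightarrow> real^'n \<Rightarrow> (real^'n) set" where
  "cube k x = {y. idx k y = idx k x}"

definition side :: "nat \<Rightarrow> real" where "side k = L / 2 ^ k"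

lemma side_pos: "0 < side k" using L by (simp add: side_def)

lemma in_cube_self [simp]: "x \<in> cube k x" by (simp add: cube_def)

lemma cube_eq: "y \<in> cube k x \<Longrightarrow> cube k y = cube k x" by (simp add: cube_def)

lemma idx_Suc: "idx k x i = idx (Suc k) x i div 2"
proof -
  define u where "u = 2 ^ k * (x $ i - corner $ i) / L"
  have "idx (Suc k) x i = \<lfloor>2 * u\<rfloor>" "idx k x i = \<lfloor>u\<rfloor>"
    by (simp_all add: idx_def u_def mult.assoc)
  then show ?thesis using floor_divide_real_eq_div[of 2 "2 * u"] by simp
qed

lemma cube_Suc_subset: "cube (Suc k) x \<subseteq> cube k x"
proof
  fix y assume "y \<in> cube (Suc k) x"
  then have "idx k y i = idx k x i" for i
    unfolding cube_def by (subst (1 2) idx_Suc) simp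
  then show "y \<in> cube k x" by (auto simp: cube_def)
qed

lemma cube_antimono: "j \<le> k \<Longrightarrow> cube k x \<subseteq> cube j x"
  by (rule lift_Suc_antimono_le[of "\<lambda>k. cube k x"]) (rule cube_Suc_subset)

definition low :: "nat \<Rightarrow> real^'n \<Rightarrow> real^'n" where
  "low k x = (\<chi> i. corner $ i + side k * idx k x i)"

lemma in_cube_iff: "y \<in> cube k x \<longleftrightarrow> (\<forall>i. low k x $ i \<le> y $ i \<and> y $ i < low k x $ i + side k)"
proof -
  have "idx k y i = idx k x i \<longleftrightarrow> low k x $ i \<le> y $ i \<and> y $ i < low k x $ i + side k" for i
  proof -
    have "2 ^ k * (y $ i - corner $ i) / L = (y $ i - corner $ i) / side k"
      using L by (simp add: side_def)
    then have "idx k y i = idx k x i \<longleftrightarrow>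
        real_of_int (idx k x i) \<le> (y $ i - corner $ i) / side k \<and>
        (y $ i - corner $ i) / side k < real_of_int (idx k x i) + 1"
      unfolding idx_def[of k y] by (simp add: floor_eq_iff)
    also have "\<dots> \<longleftrightarrow> low k x $ i \<le> y $ i \<and> y $ i < low k x $ i + side k"
      using side_pos[of k] by (auto simp: low_def field_simps)
    finally show ?thesis .
  qed
  then show ?thesis by (auto simp: cube_def fun_eq_iff)
qed

definition center :: "nat \<Rightarrow> real^'n \<Rightarrow> real^'n" where
  "center k x = (\<chi> i. low k x $ i + side k / 2)"

lemma ball_subset_cube: "ball (center k x) (side k / 2) \<subseteq> cube k x"
proof
  fix y assume "y \<in> ball (center k x) (side k / 2)"
  then have d: "norm (y - center k x) < side k / 2" by (simp add: dist_norm norm_minus_commute)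
  have "low k x $ i \<le> y $ i \<and> y $ i < low k x $ i + side k" for i
  proof -
    have "\<bar>y $ i - (low k x $ i + side k / 2)\<bar> < side k / 2"
      using component_le_norm_cart[of "y - center k x" i] d by (simp add: center_def)
    then show ?thesis unfolding abs_diff_less_iff by (auto simp: field_simps)
  qed
  then show "y \<in> cube k x" unfolding in_cube_iff by blast
qed

lemma cube_subset_ball: "cube k x \<subseteq> ball (center k x) (CARD('n) * side k)"
proof
  fix y assume "y \<in> cube k x"
  then have y: "\<bar>y $ i - center k x $ i\<bar> \<le> side k / 2" for i
  proof -
    have "low k x $ i \<le> y $ i \<and> y $ i < low k x $ i + side k"
      using \<open>y \<in> cube k x\<close> unfolding in_cube_iff by blast
    then show ?thesis unfolding center_def abs_diff_le_iff by (auto simp: field_simps)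
  qed
  have "norm (y - center k x) \<le> (\<Sum>i\<in>UNIV. \<bar>(y - center k x) $ i\<bar>)"
    by (rule norm_le_l1_cart)
  also have "\<dots> \<le> (\<Sum>i\<in>(UNIV::'n set). side k / 2)"
    by (intro sum_mono) (use y in simp)
  also have "\<dots> < CARD('n) * side k" using side_pos[of k] by simp
  finally show "y \<in> ball (center k x) (CARD('n) * side k)"
    by (simp add: dist_norm norm_minus_commute)
qed

lemma cube_sets_borel: "cube k x \<in> sets borel"
proof -
  have "cube k x = {y. \<forall>i. low k x $ i \<le> y $ i \<and> y $ i < low k x $ i + side k}"
    by (auto simp: in_cube_iff)
  also have "\<dots> \<in> sets borel" by measurable
  finally show ?thesis .
qed

lemma cube_sets [measurable]: "cube k x \<in> sets lebesgue"
  using cube_sets_borel by (simp add: sets_completionI_sets)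

lemma emeasure_cube: "emeasure lebesgue (cube k x) = ennreal (side k ^ CARD('n))"
proof (rule antisym)
  let ?b = "low k x + (\<chi> i. side k)"
  have le: "low k x \<bullet> i \<le> ?b \<bullet> i" if "i \<in> Basis" for i
    using that side_pos[of k] by (auto simp: Basis_vec_def inner_axis)
  have "(\<Prod>i\<in>Basis. (?b - low k x) \<bullet> i) = (\<Prod>i\<in>(Basis :: (real^'n) set). side k)"
    by (intro prod.cong refl) (auto simp: Basis_vec_def inner_axis)
  then have p: "(\<Prod>i\<in>Basis. (?b - low k x) \<bullet> i) = side k ^ CARD('n)" by simp
  have "cube k x \<subseteq> cbox (low k x) ?b"
    by (auto simp: in_cube_iff mem_box_cart less_imp_le)
  then have "emeasure lebesgue (cube k x) \<le> emeasure lebesgue (cbox (low k x) ?b)"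
    by (intro emeasure_mono) auto
  also have "\<dots> = ennreal (side k ^ CARD('n))"
    using emeasure_lborel_cbox[OF le] p by simp
  finally show "emeasure lebesgue (cube k x) \<le> ennreal (side k ^ CARD('n))" .
  have "box (low k x) ?b \<subseteq> cube k x"
    by (auto simp: in_cube_iff mem_box_cart less_imp_le)
  then have "emeasure lebesgue (box (low k x) ?b) \<le> emeasure lebesgue (cube k x)"
    by (intro emeasure_mono) auto
  then show "ennreal (side k ^ CARD('n)) \<le> emeasure lebesgue (cube k x)"
    using emeasure_lborel_box[OF le] p by simp
qed

lemma countable_cubes: "countable (range (\<lambda>(k, x). cube k x))"
proof -
  have "range (\<lambda>(k, x). cube k x) \<subseteq> (\<lambda>(k, g). {y. idx k y = g}) ` (UNIV \<times> Pi\<^sub>E UNIV (\<lambda>_. UNIV))"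
    by (force simp: cube_def)
  moreover have "countable (UNIV \<times> Pi\<^sub>E UNIV (\<lambda>_. UNIV) :: (nat \<times> ('n \<Rightarrow> int)) set)"
    by (intro countable_SIGMA countable_PiE) auto
  ultimately show ?thesis by (meson countable_image countable_subset)
qed

text \<open>
  Take for each point the first generation at which \<open>S\<close> holds. The points of one such cube share that
  generation, hence the cubes partition the set where \<open>S\<close> ever holds.
\<close>

lemma stopping_cubes:
  obtains F where "countable F" "disjoint F" "F \<subseteq> sets lebesgue" "\<Union>F = {x. \<exists>k. S k (cube k x)}"
    "\<And>Q. Q \<in> F \<Longrightarrow> \<exists>k x. Q = cube k x \<and> S k (cube k x) \<and> (\<forall>j<k. \<not> S j (cube j x))"
proof -
  define E where "E = {x. \<exists>k. S k (cube k x)}"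
  define T where "T x = (LEAST k. S k (cube k x))" for x
  have T1: "S (T x) (cube (T x) x)" if "x \<in> E" for x
    using that unfolding T_def E_def by (auto intro: LeastI_ex)
  have T2: "\<not> S j (cube j x)" if "j < T x" for j x
    using that unfolding T_def by (rule not_less_Least)
  have T_le: "T y \<le> T x" if "x \<in> E" "y \<in> cube (T x) x" for x y
    using T1[OF that(1)] unfolding cube_eq[OF that(2), symmetric] T_def[of y] by (rule Least_le)
  have yE: "y \<in> E" if "x \<in> E" "y \<in> cube (T x) x" for x y
    using T1[OF that(1)] unfolding cube_eq[OF that(2), symmetric] E_def by blast
  have T_eq: "T y = T x" if "x \<in> E" "y \<in> cube (T x) x" for x y
  proof (rule antisym[OF T_le[OF that]])
    have "cube (T y) y = cube (T y) x"
      using cube_antimono[OF T_le[OF that]] that(2) by (intro cube_eq) blast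
    then show "T x \<le> T y" using T1[OF yE[OF that]] T2[of "T y" x] by (metis not_le)
  qed
  let ?F = "(\<lambda>x. cube (T x) x) ` E"
  show ?thesis
  proof (rule that[of ?F])
    show "countable ?F"
      by (rule countable_subset[OF _ countable_cubes]) auto
    show "disjoint ?F"
    proof (rule disjointI)
      fix A B assume "A \<in> ?F" "B \<in> ?F" "A \<noteq> B"
      then obtain x y where xy: "x \<in> E" "A = cube (T x) x" "y \<in> E" "B = cube (T y) y" by blast
      show "A \<inter> B = {}"
      proof (rule ccontr)
        assume "A \<inter> B \<noteq> {}"
        then obtain z where "z \<in> cube (T x) x" "z \<in> cube (T y) y" using xy by blast
        then have "A = cube (T z) z" "B = cube (T z) z" using xy T_eq cube_eq by metis+
        with \<open>A \<noteq> B\<close> show False by simp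
      qed
    qed
    show "?F \<subseteq> sets lebesgue" by auto
    show "\<Union>?F = {x. \<exists>k. S k (cube k x)}" using yE unfolding E_def[symmetric] by auto
    show "\<exists>k x. Q = cube k x \<and> S k (cube k x) \<and> (\<forall>j<k. \<not> S j (cube j x))" if "Q \<in> ?F" for Q
      using that T1 T2 by blast
  qed
qed

lemma cube_subset_open:
  assumes "open T" "x \<in> T"
  obtains k where "k0 \<le> k" "cube k x \<subseteq> T"
proof -
  obtain e where e: "0 < e" "ball x e \<subseteq> T" using assms by (metis openE)
  obtain k where k: "2 * CARD('n) * L / e < 2 ^ k" using real_arch_pow[of 2] by auto
  have "cube (max k k0) x \<subseteq> ball x e"
  proof
    fix y assume "y \<in> cube (max k k0) x"
    then have "y \<in> cube k x" using cube_antimono[of k "max k k0"] by auto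
    then have "dist (center k x) y < CARD('n) * side k" "dist (center k x) x < CARD('n) * side k"
      using cube_subset_ball[of k x] in_cube_self[of x k] by (auto simp: subset_iff)
    then have "dist x y < 2 * CARD('n) * side k"
      using dist_triangle[of x y "center k x"] by (simp add: dist_commute)
    also have "\<dots> < e" using k e by (simp add: side_def field_simps)
    finally show "y \<in> ball x e" by simp
  qed
  then show ?thesis using e by (intro that[of "max k k0"]) auto
qed

text \<open>
  A weak form of the Lebesgue differentiation theorem, proved without maximal functions. If \<open>h \<ge> l + d\<close> on a
  subset \<open>S\<close> of \<open>G\<close>, fill an open set slightly larger than \<open>S\<close> with cubes that meet \<open>S\<close>: integrating \<open>h\<close>
  gives \<open>(l + d) \<bar>S\<bar> \<le> l (\<bar>S\<bar> + e)\<close>.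
\<close>

lemma averages_bound_AE:
  fixes h :: "real^'n \<Rightarrow> real"
  assumes [measurable]: "h \<in> borel_measurable lebesgue" and h: "\<And>x. 0 \<le> h x"
    and G: "G \<in> sets lebesgue" "emeasure lebesgue G < \<infinity>" and l: "0 \<le> l"
    and avg: "\<And>x k. x \<in> G \<Longrightarrow> k0 \<le> k \<Longrightarrow>
      (\<integral>\<^sup>+y\<in>cube k x. ennreal (h y) \<partial>lebesgue) \<le> ennreal l * emeasure lebesgue (cube k x)"
  shows "AE x in lebesgue. x \<in> G \<longrightarrow> h x \<le> l"
proof -
  have null: "emeasure lebesgue {x\<in>G. l + d \<le> h x} = 0" if d: "0 < d" for d
  proof -
    define S where "S = {x\<in>G. l + d \<le> h x}"
    have [measurable]: "G \<in> sets lebesgue" by (rule G)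
    have S: "S \<in> sets lebesgue"
    proof -
      have "S = G \<inter> (h -` {l + d..} \<inter> space lebesgue)" by (auto simp: S_def)
      also have "\<dots> \<in> sets lebesgue" by measurable
      finally show ?thesis .
    qed
    have finS: "emeasure lebesgue S < \<infinity>"
      by (rule le_less_trans[OF emeasure_mono G(2)]) (auto simp: S_def G)
    then obtain \<mu> where \<mu>: "0 \<le> \<mu>" "emeasure lebesgue S = ennreal \<mu>"
      by (metis ennreal_enn2real enn2real_nonneg infinity_ennreal_def)
    have le: "(l + d) * \<mu> \<le> l * (\<mu> + e)" if e: "0 < e" for e
    proof -
      obtain T where T: "open T" "S \<subseteq> T" "T - S \<in> lmeasurable" "emeasure lebesgue (T - S) < ennreal e"
        using sets_lebesgue_outer_open[OF S e] by blast
      obtain F where F: "countable F" "disjoint F" "F \<subseteq> sets lebesgue"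
        "\<Union>F = {x. \<exists>k. k0 \<le> k \<and> cube k x \<subseteq> T \<and> cube k x \<inter> S \<noteq> {}}"
        "\<And>Q. Q \<in> F \<Longrightarrow> \<exists>k x. Q = cube k x \<and> (k0 \<le> k \<and> cube k x \<subseteq> T \<and> cube k x \<inter> S \<noteq> {}) \<and>
          (\<forall>j<k. \<not> (k0 \<le> j \<and> cube j x \<subseteq> T \<and> cube j x \<inter> S \<noteq> {}))"
        by (rule stopping_cubes[where S = "\<lambda>k Q. k0 \<le> k \<and> Q \<subseteq> T \<and> Q \<inter> S \<noteq> {}"]) (rule that)
      have SF: "S \<subseteq> \<Union>F"
      proof
        fix x assume x: "x \<in> S"
        then obtain k where "k0 \<le> k" "cube k x \<subseteq> T"
          using cube_subset_open[OF T(1), of x k0] T(2) by blast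
        then show "x \<in> \<Union>F" unfolding F(4) using x in_cube_self[of x k] by blast
      qed
      have FT: "\<Union>F \<subseteq> T" unfolding F(4) using in_cube_self by blast
      have Fm: "\<Union>F \<in> sets lebesgue" using F by (intro sets.countable_Union) auto
      have "ennreal ((l + d) * \<mu>) = (\<integral>\<^sup>+x\<in>S. ennreal (l + d) \<partial>lebesgue)"
        using l d \<mu> S by (simp add: nn_integral_cmult_indicator ennreal_mult)
      also have "\<dots> \<le> (\<integral>\<^sup>+x\<in>S. ennreal (h x) \<partial>lebesgue)"
        by (intro nn_integral_mono) (auto simp: indicator_def S_def intro!: ennreal_leI)
      also have "\<dots> \<le> (\<integral>\<^sup>+x\<in>\<Union>F. ennreal (h x) \<partial>lebesgue)"
        by (rule nn_set_integral_mono_set[OF SF])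
      also have "\<dots> \<le> (\<integral>\<^sup>+x\<in>\<Union>F. ennreal l \<partial>lebesgue)"
      proof (rule nn_set_integral_Union_mono[OF F(1-3)])
        fix Q assume "Q \<in> F"
        then obtain k x where Q: "Q = cube k x" "k0 \<le> k" "cube k x \<inter> S \<noteq> {}" using F(5) by blast
        then obtain y where y: "y \<in> cube k x" "y \<in> G" by (auto simp: S_def)
        then have "Q = cube k y" using Q cube_eq by simp
        then show "(\<integral>\<^sup>+x\<in>Q. ennreal (h x) \<partial>lebesgue) \<le> (\<integral>\<^sup>+x\<in>Q. ennreal l \<partial>lebesgue)"
          using avg[OF y(2) Q(2)] by (simp add: nn_integral_cmult_indicator)
      qed auto
      also have "\<dots> = ennreal l * emeasure lebesgue (\<Union>F)"
        using Fm by (simp add: nn_integral_cmult_indicator)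
      also have "\<dots> \<le> ennreal l * emeasure lebesgue (S \<union> (T - S))"
        using FT T S by (intro mult_left_mono emeasure_mono) auto
      also have "\<dots> \<le> ennreal l * (emeasure lebesgue S + emeasure lebesgue (T - S))"
        using T S by (intro mult_left_mono emeasure_subadditive) auto
      also have "\<dots> \<le> ennreal l * (ennreal \<mu> + ennreal e)"
        using T(4) by (intro mult_left_mono add_mono) (auto simp: \<mu> less_imp_le)
      also have "\<dots> = ennreal (l * (\<mu> + e))"
        using l \<mu> e by (simp add: ennreal_mult flip: ennreal_plus)
      finally show ?thesis using l \<mu> e by (simp add: ennreal_le_iff)
    qed
    have "d * \<mu> \<le> 0"
    proof (rule field_le_epsilon)
      fix e :: real assume "0 < e"
      with le[of "e / (l + 1)"] l have "(l + d) * \<mu> \<le> l * (\<mu> + e / (l + 1))" by simp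
      then have "d * \<mu> \<le> l / (l + 1) * e" by (simp add: algebra_simps)
      also have "\<dots> \<le> 1 * e" using l \<open>0 < e\<close> by (intro mult_right_mono) auto
      finally show "d * \<mu> \<le> 0 + e" by simp
    qed
    then have "\<mu> = 0" using d \<mu>(1) by (simp add: mult_le_0_iff)
    then show ?thesis using \<mu> by (simp add: S_def)
  qed
  have "AE x in lebesgue. \<forall>n. \<not> (x \<in> G \<and> l + 1 / real (Suc n) \<le> h x)"
  proof (subst AE_all_countable, rule allI)
    fix n
    have "{x\<in>G. l + 1 / real (Suc n) \<le> h x} = G \<inter> (h -` {l + 1 / real (Suc n)..} \<inter> space lebesgue)" by auto
    also have "\<dots> \<in> sets lebesgue" using G by measurable
    finally have m: "{x\<in>G. l + 1 / real (Suc n) \<le> h x} \<in> sets lebesgue" .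
    have "0 < 1 / real (Suc n)" by simp
    from null_setsI[OF null[OF this] m]
    have "{x\<in>G. l + 1 / real (Suc n) \<le> h x} \<in> null_sets lebesgue" .
    from AE_not_in[OF this] show "AE x in lebesgue. \<not> (x \<in> G \<and> l + 1 / real (Suc n) \<le> h x)" by simp
  qed
  then show ?thesis
  proof (rule AE_mp, intro AE_I2 impI)
    fix x assume *: "\<forall>n. \<not> (x \<in> G \<and> l + 1 / real (Suc n) \<le> h x)" and x: "x \<in> G"
    show "h x \<le> l"
    proof (rule ccontr)
      assume "\<not> h x \<le> l"
      then obtain n where "inverse (real (Suc n)) < h x - l" using reals_Archimedean[of "h x - l"] by auto
      then have "l + 1 / real (Suc n) \<le> h x" unfolding inverse_eq_divide by linarith
      with * x show False by blast
    qed
  qed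
qed

end

section \<open>A weighted John--Nirenberg inequality\<close>

text \<open>
  Convexity of the power function. The factor in front of \<open>v\<close> can be brought arbitrarily close to 1, which the
  triangle inequality in the form \<open>(u + v)\<^sup>q \<le> 2\<^bsup>q-1\<^esup> (u\<^sup>q + v\<^sup>q)\<close> does not allow.
\<close>

lemma powr_add_le_weighted:
  fixes u v t q :: real
  assumes "0 \<le> u" "0 \<le> v" "0 < t" "t < 1" "1 \<le> q"
  shows "(u + v) powr q \<le> t powr (1 - q) * u powr q + (1 - t) powr (1 - q) * v powr q"
proof -
  have ge1: "1 \<le> r powr (1 - q)" if "0 < r" "r < 1" for r :: real
    using that \<open>1 \<le> q\<close> powr_mono'[of "1 - q" 0 r] by simp
  consider "u = 0" | "v = 0" | "0 < u" "0 < v" using assms by fastforce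
  then show ?thesis
  proof cases
    case 1
    have "1 * v powr q \<le> (1 - t) powr (1 - q) * v powr q"
      using assms by (intro mult_right_mono ge1) auto
    with 1 show ?thesis by simp
  next
    case 2
    have "1 * u powr q \<le> t powr (1 - q) * u powr q"
      using assms by (intro mult_right_mono ge1) auto
    with 2 show ?thesis by simp
  next
    case 3
    have eq: "r * (y / r) powr q = r powr (1 - q) * y powr q" if "0 < r" "0 < y" for r y :: real
      using that by (simp add: powr_divide powr_diff)
    have "((1 - t) *\<^sub>R (v / (1 - t)) + t *\<^sub>R (u / t)) powr q \<le>
        (1 - t) * (v / (1 - t)) powr q + t * (u / t) powr q"
      using assms 3 by (intro convex_onD[OF powr_convex]) auto
    also have "(1 - t) *\<^sub>R (v / (1 - t)) + t *\<^sub>R (u / t) = u + v" using assms by simp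
    also have "(1 - t) * (v / (1 - t)) powr q + t * (u / t) powr q =
        t powr (1 - q) * u powr q + (1 - t) powr (1 - q) * v powr q"
      using assms 3 by (simp add: eq)
    finally show ?thesis .
  qed
qed

text \<open>
  The constant is given explicitly so that it visibly depends neither on the grid nor on the functions.
\<close>

definition john_nirenberg_const :: "nat \<Rightarrow> nat \<Rightarrow> real \<Rightarrow> real \<Rightarrow> real \<Rightarrow> real \<Rightarrow> real \<Rightarrow> real" where
  "john_nirenberg_const n s q A \<epsilon> \<delta> C1 =
    (1 + (1 - \<delta> powr (1 / q)) powr (1 - q) * (C1 * (2 * real n) ^ s * 2 ^ (2 * n + 1)) powr q) *
    (2 / \<epsilon>) powr q * A / (1 - \<delta> powr (1 / q))"

text \<open>
  The polynomials \<open>P Q\<close> are arbitrary approximations of \<open>f\<close> on the dyadic subcubes \<open>Q\<close> of one cube. The assumption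
  \<open>dual\<close> is the Muckenhoupt condition of exponent \<open>q/(q-1)\<close>, in the form that the \<open>q\<close>-th power of the mean
  of \<open>w\<close> times the mass of \<open>w\<^bsup>1-q\<^esup>\<close> is controlled by the mass of \<open>w\<close>. The assumption \<open>A_infty\<close> says that a small
  portion of a cube cannot carry almost all of its mass. \<open>C1\<close> is the constant from \<open>polys_le_sup_bound\<close>.
\<close>

locale weighted_oscillation = dyadic_grid corner L for corner :: "real^'n" and L +
  fixes w :: "real^'n \<Rightarrow> real" and f :: "real^'n \<Rightarrow> 'b::{real_normed_field, euclidean_space}"
    and P :: "(real^'n) set \<Rightarrow> real^'n \<Rightarrow> 'b" and x0 :: "real^'n"
    and K q A \<epsilon> \<delta> C1 :: real and s :: nat
  assumes w_meas [measurable]: "w \<in> borel_measurable lebesgue" and w_pos: "\<And>x. 0 < w x"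
    and w_fin: "(\<integral>\<^sup>+x\<in>cube 0 x0. ennreal (w x) \<partial>lebesgue) < \<infinity>"
    and f_meas [measurable]: "f \<in> borel_measurable lebesgue"
    and q: "1 \<le> q" and K: "0 < K" and A: "0 \<le> A" and \<epsilon>: "0 < \<epsilon>" "\<epsilon> \<le> 1" and \<delta>: "0 < \<delta>" "\<delta> < 1" and C1: "0 < C1"
    and P_poly: "\<And>k x. x \<in> cube 0 x0 \<Longrightarrow> P (cube k x) \<in> polys_le s"
    and osc: "\<And>k x. x \<in> cube 0 x0 \<Longrightarrow>
      (\<integral>\<^sup>+y\<in>cube k x. ennreal (norm (f y - P (cube k x) y)) \<partial>lebesgue) \<le>
      ennreal K * (\<integral>\<^sup>+y\<in>cube k x. ennreal (w y) \<partial>lebesgue)"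
    and dual: "\<And>k x. x \<in> cube 0 x0 \<Longrightarrow>
      ennreal ((enn2real (\<integral>\<^sup>+y\<in>cube k x. ennreal (w y) \<partial>lebesgue) / side k ^ CARD('n)) powr q) *
        (\<integral>\<^sup>+y\<in>cube k x. ennreal (w y powr (1 - q)) \<partial>lebesgue) \<le>
      ennreal A * (\<integral>\<^sup>+y\<in>cube k x. ennreal (w y) \<partial>lebesgue)"
    and A_infty: "\<And>k x E. x \<in> cube 0 x0 \<Longrightarrow> E \<in> sets lebesgue \<Longrightarrow> E \<subseteq> cube k x \<Longrightarrow>
      emeasure lebesgue E \<le> ennreal \<epsilon> * emeasure lebesgue (cube k x) \<Longrightarrow>
      (\<integral>\<^sup>+y\<in>E. ennreal (w y) \<partial>lebesgue) \<le> ennreal \<delta> * (\<integral>\<^sup>+y\<in>cube k x. ennreal (w y) \<partial>lebesgue)"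
    and sup_bound: "\<And>(z::real^'n) \<rho> M R p. p \<in> (polys_le s :: (real^'n \<Rightarrow> 'b) set) \<Longrightarrow>
      0 < \<rho> \<Longrightarrow> 1 \<le> R \<Longrightarrow> 0 \<le> M \<Longrightarrow>
      (\<integral>\<^sup>+x\<in>ball z \<rho>. ennreal (norm (p x)) \<partial>lebesgue) \<le> ennreal M \<Longrightarrow>
      \<forall>x\<in>ball z (R * \<rho>). norm (p x) \<le> C1 * R ^ s / \<rho> ^ CARD('n) * M"
begin

abbreviation W :: "(real^'n) set \<Rightarrow> ennreal" where
  "W S \<equiv> \<integral>\<^sup>+y\<in>S. ennreal (w y) \<partial>lebesgue"

abbreviation \<sigma> :: "real^'n \<Rightarrow> real" where "\<sigma> y \<equiv> w y powr (1 - q)"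

text \<open>
  Truncating at a multiple of \<open>w\<close> makes the quantity to be estimated finite and, more importantly, bounded a
  priori by a multiple of \<open>w(Q)\<close>, uniformly in \<open>Q\<close> (\<open>energy_a_priori\<close>).
\<close>

definition trunc :: "real \<Rightarrow> (real^'n) set \<Rightarrow> real^'n \<Rightarrow> real" where
  "trunc M Q y = min (norm (f y - P Q y)) (M * w y)"

definition energy :: "real \<Rightarrow> (real^'n) set \<Rightarrow> ennreal" where
  "energy M Q = (\<integral>\<^sup>+y\<in>Q. ennreal (trunc M Q y powr q * \<sigma> y) \<partial>lebesgue)"

text \<open>
  With \<open>l\<close> the stopping level, \<open>jump * l\<close> bounds the difference of the polynomials of a cube and
  of a stopping cube inside it.
\<close>

definition jump :: real where "jump = C1 * (2 * real CARD('n)) ^ s * 2 ^ (2 * CARD('n) + 1)"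

text \<open>
  Used as weight in \<open>powr_add_le_weighted\<close>: the loss \<open>\<eta>\<^bsup>1-q\<^esup>\<close> there times the gain \<open>\<delta>\<close> from \<open>A_infty\<close> is
  \<open>\<eta> < 1\<close>.
\<close>

definition \<eta> :: real where "\<eta> = \<delta> powr (1 / q)"

definition step :: real where
  "step = (1 + (1 - \<eta>) powr (1 - q) * jump powr q) * (2 / \<epsilon>) powr q * A"

lemma \<eta>: "0 < \<eta>" "\<eta> < 1" "\<eta> powr (1 - q) * \<delta> = \<eta>"
proof -
  show "0 < \<eta>" using \<delta> by (simp add: \<eta>_def)
  show "\<eta> < 1" using powr_less_mono2[of "1 / q" \<delta> 1] \<delta> q by (simp add: \<eta>_def)
  have "\<delta> = \<eta> powr q" using \<delta> q by (simp add: \<eta>_def powr_powr)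
  then have "\<eta> powr (1 - q) * \<delta> = \<eta> powr (1 - q) * \<eta> powr q"
    by (rule arg_cong[where f = "\<lambda>d. \<eta> powr (1 - q) * d"])
  also have "\<dots> = \<eta>" using \<open>0 < \<eta>\<close> by (simp flip: powr_add)
  finally show "\<eta> powr (1 - q) * \<delta> = \<eta>" .
qed

lemma jump_pos: "0 < jump" using C1 by (simp add: jump_def)

lemma step_nonneg: "0 \<le> step" using A by (simp add: step_def)

lemma cube_subset_top: "x \<in> cube 0 x0 \<Longrightarrow> cube k x \<subseteq> cube 0 x0"
  using cube_antimono[of 0 k x] cube_eq[of x 0 x0] by simp

lemma W_cube:
  assumes "x \<in> cube 0 x0"
  obtains \<omega> where "0 < \<omega>" "W (cube k x) = ennreal (\<omega> * side k ^ CARD('n))"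
proof -
  have "W (cube k x) \<le> W (cube 0 x0)" by (rule nn_set_integral_mono_set[OF cube_subset_top[OF assms]])
  then have fin: "W (cube k x) < \<infinity>" using w_fin by (rule le_less_trans)
  have "W (cube k x) \<noteq> 0"
  proof
    assume "W (cube k x) = 0"
    moreover have "\<not> w y \<le> 0" for y using w_pos[of y] by simp
    ultimately have "AE y in lebesgue. y \<notin> cube k x"
      by (subst (asm) nn_integral_0_iff_AE) (auto simp: indicator_def not_le ennreal_eq_0_iff)
    then have "emeasure lebesgue (cube k x) = 0" by (subst (asm) AE_iff_null_sets[symmetric]) auto
    then show False using side_pos[of k] by (simp add: emeasure_cube)
  qed
  with fin have pos: "0 < enn2real (W (cube k x))"
    by (simp add: enn2real_positive_iff zero_less_iff_neq_zero)
  show ?thesis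
  proof (rule that[of "enn2real (W (cube k x)) / side k ^ CARD('n)"])
    show "0 < enn2real (W (cube k x)) / side k ^ CARD('n)"
      using pos side_pos[of k] by simp
    show "W (cube k x) = ennreal (enn2real (W (cube k x)) / side k ^ CARD('n) * side k ^ CARD('n))"
      using fin side_pos[of k] by simp
  qed
qed

lemma trunc_nonneg: "0 \<le> M \<Longrightarrow> 0 \<le> trunc M Q y"
  using w_pos[of y] by (simp add: trunc_def)

lemma P_meas [measurable]: "x \<in> cube 0 x0 \<Longrightarrow> P (cube k x) \<in> borel_measurable lebesgue"
  by (rule borel_measurable_polys_le[OF P_poly])

lemma trunc_meas [measurable]: "x \<in> cube 0 x0 \<Longrightarrow> trunc M (cube k x) \<in> borel_measurable lebesgue"
  unfolding trunc_def[abs_def] using P_meas[of x k] by measurable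

lemma energy_a_priori:
  assumes M: "0 \<le> M" and [measurable]: "Q \<in> sets lebesgue"
  shows "energy M Q \<le> ennreal (M powr q) * W Q"
proof -
  have "energy M Q \<le> (\<integral>\<^sup>+y. ennreal (M powr q) * (ennreal (w y) * indicator Q y) \<partial>lebesgue)"
    unfolding energy_def
  proof (rule nn_integral_mono)
    fix y
    have "trunc M Q y powr q * \<sigma> y \<le> (M * w y) powr q * \<sigma> y"
      using trunc_nonneg[OF M] q by (intro mult_right_mono powr_mono2) (auto simp: trunc_def)
    also have "\<dots> = M powr q * w y"
      using w_pos[of y] M by (simp add: powr_mult powr_diff)
    finally show "ennreal (trunc M Q y powr q * \<sigma> y) * indicator Q y \<le>
        ennreal (M powr q) * (ennreal (w y) * indicator Q y)"
      using M w_pos[of y] by (auto simp: indicator_def simp flip: ennreal_mult' intro!: ennreal_leI)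
  qed
  also have "\<dots> \<le> ennreal (M powr q) * W Q"
    by (subst nn_integral_cmult) (auto)
  finally show ?thesis .
qed


text \<open>
  One Calderon--Zygmund step. Stop at the maximal subcubes on which the mean of \<open>h = \<bar>f - P Q\<bar> + K w\<close> exceeds
  a level \<open>l\<close> proportional to the mean of \<open>w\<close> on \<open>Q\<close>. Off the stopping cubes \<open>h \<le> l\<close>, and \<open>l\<^sup>q\<close> times
  the mass of \<open>w\<^bsup>1-q\<^esup>\<close> is controlled by \<open>dual\<close>. On a stopping cube \<open>R\<close> the
  polynomials \<open>P Q\<close> and \<open>P R\<close> differ by \<open>O(l)\<close>, so the problem repeats itself for \<open>R\<close>. By \<open>A_infty\<close> the
  stopping cubes carry at most the fraction \<open>\<delta>\<close> of the mass of \<open>w\<close>, so the constant \<open>Y\<close> is improved.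
  Including \<open>K w\<close> in \<open>h\<close> ensures that the mean of \<open>w\<close> is still \<open>O(l)\<close> on the stopping cubes.
\<close>

lemma energy_improves:
  assumes x: "x \<in> cube 0 x0" and Y: "0 \<le> Y" and M: "0 \<le> M"
    and le: "\<And>j y. y \<in> cube 0 x0 \<Longrightarrow> energy M (cube j y) \<le> ennreal Y * W (cube j y)"
  shows "energy M (cube k x) \<le> ennreal (step * K powr q + \<eta> * Y) * W (cube k x)"
proof -
  define Q where "Q = cube k x"
  have Qx0: "Q \<subseteq> cube 0 x0" unfolding Q_def by (rule cube_subset_top[OF x])
  have Qm [measurable]: "Q \<in> sets lebesgue" by (simp add: Q_def)
  obtain \<omega> where \<omega>: "0 < \<omega>" "W Q = ennreal (\<omega> * side k ^ CARD('n))"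
    unfolding Q_def by (rule W_cube[OF x, of k])
  \<comment> \<open>The mean of \<open>h\<close> on \<open>Q\<close> is at most \<open>2 K \<omega> = \<epsilon> l\<close>, so the stopping cubes fill at most the fraction \<open>\<epsilon>\<close> of \<open>Q\<close>.\<close>
  define l where "l = 2 * K * \<omega> / \<epsilon>"
  have l: "0 < l" using K \<omega> \<epsilon> by (simp add: l_def)
  define h where "h y = norm (f y - P Q y) + K * w y" for y
  have PQ [measurable]: "P Q \<in> borel_measurable lebesgue" unfolding Q_def by (rule P_meas[OF x])
  have h_meas [measurable]: "h \<in> borel_measurable lebesgue" unfolding h_def by measurable
  have h_nonneg: "0 \<le> h y" for y using K w_pos[of y] by (simp add: h_def)
  have side: "0 < side j" for j by (rule side_pos)
  have int_h_Q: "(\<integral>\<^sup>+y\<in>Q. ennreal (h y) \<partial>lebesgue) \<le> ennreal l * (ennreal \<epsilon> * emeasure lebesgue Q)"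
  proof -
    have "(\<integral>\<^sup>+y\<in>Q. ennreal (h y) \<partial>lebesgue) =
        (\<integral>\<^sup>+y. ennreal (norm (f y - P Q y)) * indicator Q y + ennreal K * (ennreal (w y) * indicator Q y) \<partial>lebesgue)"
      using K w_pos by (intro nn_integral_cong)
        (auto simp: h_def indicator_def less_imp_le simp flip: ennreal_plus ennreal_mult')
    also have "\<dots> = (\<integral>\<^sup>+y\<in>Q. ennreal (norm (f y - P Q y)) \<partial>lebesgue) + ennreal K * W Q"
      by (subst nn_integral_add) (auto simp: nn_integral_cmult)
    also have "\<dots> \<le> ennreal K * W Q + ennreal K * W Q"
      using osc[OF x, of k] by (intro add_mono) (auto simp: Q_def)
    also have "\<dots> = ennreal (l * (\<epsilon> * side k ^ CARD('n)))"
      unfolding \<omega>(2) using K \<omega>(1) \<epsilon> side[of k]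
      by (simp add: l_def mult_ac flip: ennreal_mult' ennreal_plus)
    also have "\<dots> = ennreal l * (ennreal \<epsilon> * emeasure lebesgue Q)"
      using l \<epsilon> by (simp add: Q_def emeasure_cube ennreal_mult')
    finally show ?thesis .
  qed
  define S where "S j R \<longleftrightarrow> k \<le> j \<and> R \<subseteq> Q \<and>
    \<not> (\<integral>\<^sup>+y\<in>R. ennreal (h y) \<partial>lebesgue) \<le> ennreal l * emeasure lebesgue R" for j R
  obtain F where F: "countable F" "disjoint F" "F \<subseteq> sets lebesgue" "\<Union>F = {x. \<exists>k. S k (cube k x)}"
    "\<And>R. R \<in> F \<Longrightarrow> \<exists>k x. R = cube k x \<and> S k (cube k x) \<and> (\<forall>j<k. \<not> S j (cube j x))"
    by (rule stopping_cubes[where S = S]) (rule that)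
  define E where "E = \<Union>F"
  have E_iff: "y \<in> E \<longleftrightarrow> (\<exists>j. S j (cube j y))" for y using F(4) by (auto simp: E_def)
  have EQ: "E \<subseteq> Q"
  proof
    fix y assume "y \<in> E"
    then obtain j where "cube j y \<subseteq> Q" using E_iff S_def by blast
    then show "y \<in> Q" using in_cube_self by blast
  qed
  have Em [measurable]: "E \<in> sets lebesgue" unfolding E_def using F(1,3) by (intro sets.countable_Union) auto
  \<comment> \<open>The parent of a stopping cube did not stop, which bounds the mean of \<open>h\<close> on the cube by \<open>2\<^sup>n l\<close>.\<close>
  have stop: "\<exists>j y. R = cube j y \<and> y \<in> Q \<and> R \<subseteq> Q \<and>
      ennreal l * emeasure lebesgue R \<le> (\<integral>\<^sup>+y\<in>R. ennreal (h y) \<partial>lebesgue) \<and>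
      (\<integral>\<^sup>+y\<in>R. ennreal (h y) \<partial>lebesgue) \<le> ennreal (2 ^ CARD('n) * l * side j ^ CARD('n))"
    if R: "R \<in> F" for R
  proof -
    obtain j y where jy: "R = cube j y" "S j (cube j y)" "\<And>i. i < j \<Longrightarrow> \<not> S i (cube i y)"
      using F(5)[OF R] by blast
    have RQ: "R \<subseteq> Q" and kj: "k \<le> j" and big: "\<not> (\<integral>\<^sup>+y\<in>R. ennreal (h y) \<partial>lebesgue) \<le> ennreal l * emeasure lebesgue R"
      using jy by (auto simp: S_def)
    have yQ: "y \<in> Q" using RQ jy(1) by auto
    have kQ: "cube k y = Q" using yQ unfolding Q_def by (rule cube_eq)
    have "j \<noteq> k"
    proof
      assume "j = k"
      then have "R = Q" using jy kQ by simp
      have "ennreal \<epsilon> * emeasure lebesgue Q \<le> 1 * emeasure lebesgue Q"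
        using \<epsilon> by (intro mult_right_mono) (auto simp: ennreal_le_1)
      then have "(\<integral>\<^sup>+y\<in>Q. ennreal (h y) \<partial>lebesgue) \<le> ennreal l * emeasure lebesgue Q"
        by (intro order_trans[OF int_h_Q] mult_left_mono) auto
      with big \<open>R = Q\<close> show False by simp
    qed
    with kj obtain i where i: "j = Suc i" "k \<le> i" by (cases j) auto
    have "(\<integral>\<^sup>+y\<in>R. ennreal (h y) \<partial>lebesgue) \<le> (\<integral>\<^sup>+z\<in>cube i y. ennreal (h z) \<partial>lebesgue)"
      unfolding jy(1) i(1) by (rule nn_set_integral_mono_set[OF cube_Suc_subset])
    also have "\<dots> \<le> ennreal l * emeasure lebesgue (cube i y)"
      using jy(3)[of i] i cube_antimono[OF i(2), of y] kQ by (simp add: S_def)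
    also have "\<dots> = ennreal (2 ^ CARD('n) * l * side j ^ CARD('n))"
      using l by (simp add: emeasure_cube i side_def power_divide power_mult_distrib mult_ac flip: ennreal_mult')
    finally show ?thesis using jy(1) RQ yQ big by (intro exI[of _ j] exI[of _ y]) auto
  qed
  have WE: "W E \<le> ennreal \<delta> * W Q"
  proof (unfold Q_def, rule A_infty[OF x Em])
    show "E \<subseteq> cube k x" using EQ by (simp add: Q_def)
    have "ennreal l * emeasure lebesgue E = (\<integral>\<^sup>+y\<in>E. ennreal l \<partial>lebesgue)"
      by (simp add: nn_integral_cmult_indicator)
    also have "\<dots> \<le> (\<integral>\<^sup>+y\<in>E. ennreal (h y) \<partial>lebesgue)"
      unfolding E_def
    proof (rule nn_set_integral_Union_mono[OF F(1-3)])
      fix R assume "R \<in> F"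
      with stop[OF this] F(3) show "(\<integral>\<^sup>+y\<in>R. ennreal l \<partial>lebesgue) \<le> (\<integral>\<^sup>+y\<in>R. ennreal (h y) \<partial>lebesgue)"
        by (auto simp: nn_integral_cmult_indicator subset_iff)
    qed auto
    also have "\<dots> \<le> ennreal l * (ennreal \<epsilon> * emeasure lebesgue Q)"
      by (rule order_trans[OF nn_set_integral_mono_set[OF EQ] int_h_Q])
    finally show "emeasure lebesgue E \<le> ennreal \<epsilon> * emeasure lebesgue (cube k x)"
      using l unfolding Q_def[symmetric] by (subst (asm) ennreal_mult_le_mult_iff) auto
  qed
  have good: "AE y in lebesgue. y \<in> Q - E \<longrightarrow> h y \<le> l"
  proof (rule averages_bound_AE[where ?k0.0 = k])
    show "emeasure lebesgue (Q - E) < \<infinity>"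
      by (rule le_less_trans[OF emeasure_mono[of _ Q]]) (auto simp: Q_def emeasure_cube)
    fix y j assume y: "y \<in> Q - E" and j: "k \<le> j"
    have "cube j y \<subseteq> Q"
      using cube_antimono[OF j, of y] cube_eq[of y k x] y by (simp add: Q_def)
    moreover have "\<not> S j (cube j y)" using y E_iff by blast
    ultimately show "(\<integral>\<^sup>+z\<in>cube j y. ennreal (h z) \<partial>lebesgue) \<le> ennreal l * emeasure lebesgue (cube j y)"
      using j by (simp add: S_def)
  qed (use l h_nonneg in auto)
  let ?I = "\<lambda>y. ennreal (trunc M Q y powr q * \<sigma> y)"
  have trunc_Q_meas [measurable]: "trunc M Q \<in> borel_measurable lebesgue"
    unfolding Q_def by (rule trunc_meas[OF x])
  have int_good: "(\<integral>\<^sup>+y\<in>Q - E. ?I y \<partial>lebesgue) \<le> (\<integral>\<^sup>+y\<in>Q. ennreal (l powr q * \<sigma> y) \<partial>lebesgue)"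
  proof (rule nn_integral_mono_AE)
    show "AE y in lebesgue. ?I y * indicator (Q - E) y \<le> ennreal (l powr q * \<sigma> y) * indicator Q y"
      using good
    proof (rule AE_mp, intro AE_I2 impI)
      fix y assume "y \<in> Q - E \<longrightarrow> h y \<le> l"
      moreover have "trunc M Q y \<le> h y" using K w_pos[of y] by (simp add: trunc_def h_def min.coboundedI1)
      ultimately have "trunc M Q y powr q * \<sigma> y \<le> l powr q * \<sigma> y" if "y \<in> Q - E"
        using that trunc_nonneg[OF M] q by (intro mult_right_mono powr_mono2) auto
      then show "?I y * indicator (Q - E) y \<le> ennreal (l powr q * \<sigma> y) * indicator Q y"
        by (auto simp: indicator_def intro!: ennreal_leI)
    qed
  qed
  define a where "a = (1 - \<eta>) powr (1 - q)"
  define b where "b = \<eta> powr (1 - q)"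
  have ab: "0 \<le> a" "0 \<le> b" by (simp_all add: a_def b_def)
  have int_bad: "(\<integral>\<^sup>+y\<in>E. ?I y \<partial>lebesgue) \<le>
      (\<integral>\<^sup>+y\<in>E. ennreal (a * (jump * l) powr q * \<sigma> y + b * Y * w y) \<partial>lebesgue)"
    unfolding E_def
  proof (rule nn_set_integral_Union_mono[OF F(1-3)])
    fix R assume R: "R \<in> F"
    obtain j y where jy: "R = cube j y" "y \<in> Q" "R \<subseteq> Q" and
      h_R: "(\<integral>\<^sup>+z\<in>R. ennreal (h z) \<partial>lebesgue) \<le> ennreal (2 ^ CARD('n) * l * side j ^ CARD('n))"
      using stop[OF R] by blast
    have y: "y \<in> cube 0 x0" using jy(2) Qx0 by blast
    have Rm [measurable]: "R \<in> sets lebesgue" using R F(3) by blast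
    have PR [measurable]: "P R \<in> borel_measurable lebesgue" unfolding jy(1) by (rule P_meas[OF y])
    let ?m = "2 ^ CARD('n) * l * side j ^ CARD('n)"
    have m: "0 \<le> ?m" using l side[of j] by simp
    have Kw: "ennreal K * W R \<le> (\<integral>\<^sup>+z\<in>R. ennreal (h z) \<partial>lebesgue)"
    proof -
      have "ennreal K * W R = (\<integral>\<^sup>+z. ennreal K * (ennreal (w z) * indicator R z) \<partial>lebesgue)"
        by (subst nn_integral_cmult) auto
      also have "\<dots> \<le> (\<integral>\<^sup>+z\<in>R. ennreal (h z) \<partial>lebesgue)"
        using K by (intro nn_integral_mono)
          (auto simp: indicator_def h_def simp flip: ennreal_mult' intro!: ennreal_leI)
      finally show ?thesis .
    qed
    have "(\<integral>\<^sup>+z\<in>R. ennreal (norm (P R z - P Q z)) \<partial>lebesgue) \<le> ennreal (?m + ?m)"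
    proof (rule nn_set_integral_norm_diff_le[OF f_meas PR PQ Rm _ _ m m])
      show "(\<integral>\<^sup>+z\<in>R. ennreal (norm (f z - P R z)) \<partial>lebesgue) \<le> ennreal ?m"
        using osc[OF y, of j] Kw h_R unfolding jy(1)[symmetric] by (meson order_trans)
      have "(\<integral>\<^sup>+z\<in>R. ennreal (norm (f z - P Q z)) \<partial>lebesgue) \<le> (\<integral>\<^sup>+z\<in>R. ennreal (h z) \<partial>lebesgue)"
        using K w_pos by (intro nn_integral_mono)
          (auto simp: indicator_def h_def less_imp_le intro!: ennreal_leI)
      with h_R show "(\<integral>\<^sup>+z\<in>R. ennreal (norm (f z - P Q z)) \<partial>lebesgue) \<le> ennreal ?m"
        by (rule order_trans[rotated])
    qed
    from order_trans[OF nn_set_integral_mono_set[OF ball_subset_cube[of j y, folded jy(1)]] this]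
    have "(\<integral>\<^sup>+z\<in>ball (center j y) (side j / 2). ennreal (norm (P R z - P Q z)) \<partial>lebesgue) \<le> ennreal (?m + ?m)" .
    moreover have "(\<lambda>z. P R z - P Q z) \<in> polys_le s"
      unfolding jy(1) Q_def by (intro polys_le_diff P_poly x y)
    moreover have "1 \<le> 2 * real CARD('n)"
      using zero_less_card_finite[where 'a = 'n] by linarith
    ultimately have sup: "\<forall>z\<in>ball (center j y) (2 * real CARD('n) * (side j / 2)).
        norm (P R z - P Q z) \<le> C1 * (2 * real CARD('n)) ^ s / (side j / 2) ^ CARD('n) * (?m + ?m)"
      using side[of j] l by (intro sup_bound) auto
    have jump_l: "norm (P R z - P Q z) \<le> jump * l" if "z \<in> R" for z
    proof -
      have "z \<in> ball (center j y) (2 * real CARD('n) * (side j / 2))"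
        using that cube_subset_ball[of j y] jy(1) by auto
      then have "norm (P R z - P Q z) \<le> C1 * (2 * real CARD('n)) ^ s / (side j / 2) ^ CARD('n) * (?m + ?m)"
        using sup by blast
      also have "\<dots> = jump * l"
      proof -
        have "(2::real) ^ (2 * CARD('n) + 1) = 2 * (2 ^ CARD('n) * 2 ^ CARD('n))"
          unfolding power_add mult_2[of "CARD('n)"] power_one_right by (rule mult.commute)
        moreover have "c * e / (a / N) * (N * l * a + N * l * a) = c * e * (2 * (N * N)) * l"
          if "0 < a" "0 < N" for a c e N :: real
          using that by (simp add: divide_simps)
        note this[of "side j ^ CARD('n)" "2 ^ CARD('n)" C1 "(2 * real CARD('n)) ^ s"]
        ultimately show ?thesis
          unfolding jump_def power_divide using side[of j] by (simp only: zero_less_power zero_less_numeral)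
      qed
      finally show ?thesis .
    qed
    have pointwise: "trunc M Q z powr q * \<sigma> z \<le> a * (jump * l) powr q * \<sigma> z + b * (trunc M R z powr q * \<sigma> z)"
      if "z \<in> R" for z
    proof -
      have "norm (f z - P Q z) \<le> norm (P R z - P Q z) + norm (f z - P R z)"
        using norm_triangle_ineq[of "P R z - P Q z" "f z - P R z"] by simp
      moreover have "0 < jump * l" using jump_pos l by simp
      ultimately have "trunc M Q z \<le> jump * l + trunc M R z"
        using jump_l[OF that] unfolding trunc_def by linarith
      then have "trunc M Q z powr q \<le> (jump * l + trunc M R z) powr q"
        using q trunc_nonneg[OF M] by (intro powr_mono2) auto
      also have "\<dots> \<le> a * (jump * l) powr q + b * trunc M R z powr q"
        using powr_add_le_weighted[of "jump * l" "trunc M R z" "1 - \<eta>" q] jump_pos l q \<eta> trunc_nonneg[OF M, of R z]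
        by (simp add: a_def b_def)
      finally have "trunc M Q z powr q * \<sigma> z \<le> (a * (jump * l) powr q + b * trunc M R z powr q) * \<sigma> z"
        by (intro mult_right_mono) auto
      then show ?thesis by (simp add: algebra_simps)
    qed
    have trunc_R_meas [measurable]: "trunc M R \<in> borel_measurable lebesgue"
      unfolding jy(1) by (rule trunc_meas[OF y])
    have "(\<integral>\<^sup>+z\<in>R. ?I z \<partial>lebesgue) \<le> (\<integral>\<^sup>+z. ennreal (a * (jump * l) powr q * \<sigma> z) * indicator R z +
        ennreal b * (ennreal (trunc M R z powr q * \<sigma> z) * indicator R z) \<partial>lebesgue)"
      using pointwise ab by (intro nn_integral_mono)
        (auto simp: indicator_def simp flip: ennreal_mult' ennreal_plus intro!: ennreal_leI)
    also have "\<dots> = (\<integral>\<^sup>+z\<in>R. ennreal (a * (jump * l) powr q * \<sigma> z) \<partial>lebesgue) + ennreal b * energy M R"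
      by (subst nn_integral_add) (auto simp: energy_def nn_integral_cmult)
    also have "\<dots> \<le> (\<integral>\<^sup>+z\<in>R. ennreal (a * (jump * l) powr q * \<sigma> z) \<partial>lebesgue) + ennreal b * (ennreal Y * W R)"
      using le[OF y, of j] by (intro add_left_mono mult_left_mono) (auto simp: jy(1))
    also have "\<dots> = (\<integral>\<^sup>+z. ennreal (a * (jump * l) powr q * \<sigma> z) * indicator R z +
        ennreal (b * Y) * (ennreal (w z) * indicator R z) \<partial>lebesgue)"
      using ab Y by (subst nn_integral_add) (auto simp: nn_integral_cmult ennreal_mult mult.assoc)
    also have "\<dots> = (\<integral>\<^sup>+z\<in>R. ennreal (a * (jump * l) powr q * \<sigma> z + b * Y * w z) \<partial>lebesgue)"
      using ab Y w_pos by (intro nn_integral_cong)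
        (auto simp: indicator_def less_imp_le simp flip: ennreal_mult' ennreal_plus)
    finally show "(\<integral>\<^sup>+z\<in>R. ?I z \<partial>lebesgue) \<le>
      (\<integral>\<^sup>+z\<in>R. ennreal (a * (jump * l) powr q * \<sigma> z + b * Y * w z) \<partial>lebesgue)" .
  qed measurable
  have l_\<sigma>: "ennreal (l powr q) * (\<integral>\<^sup>+y\<in>Q. ennreal (\<sigma> y) \<partial>lebesgue) \<le> ennreal ((2 / \<epsilon>) powr q * K powr q * A) * W Q"
  proof -
    have "enn2real (W Q) / side k ^ CARD('n) = \<omega>"
      using \<omega> side[of k] by simp
    then have d: "ennreal (\<omega> powr q) * (\<integral>\<^sup>+y\<in>Q. ennreal (\<sigma> y) \<partial>lebesgue) \<le> ennreal A * W Q"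
      using dual[OF x, of k] unfolding Q_def by simp
    have "l powr q = (2 / \<epsilon>) powr q * K powr q * \<omega> powr q"
    proof -
      have "l = 2 / \<epsilon> * K * \<omega>" by (simp add: l_def)
      then show ?thesis using K \<omega>(1) \<epsilon>
        by (simp add: powr_mult del: times_divide_eq_left times_divide_eq_right)
    qed
    then have "ennreal (l powr q) * (\<integral>\<^sup>+y\<in>Q. ennreal (\<sigma> y) \<partial>lebesgue) =
        ennreal ((2 / \<epsilon>) powr q * K powr q) * (ennreal (\<omega> powr q) * (\<integral>\<^sup>+y\<in>Q. ennreal (\<sigma> y) \<partial>lebesgue))"
      by (simp add: ennreal_mult mult.assoc)
    also have "\<dots> \<le> ennreal ((2 / \<epsilon>) powr q * K powr q) * (ennreal A * W Q)"
      by (intro mult_left_mono d) auto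
    finally show ?thesis using A by (simp add: ennreal_mult mult.assoc)
  qed
  have "energy M Q = (\<integral>\<^sup>+y\<in>Q - E. ?I y \<partial>lebesgue) + (\<integral>\<^sup>+y\<in>E. ?I y \<partial>lebesgue)"
  proof -
    have "energy M Q = (\<integral>\<^sup>+y. ?I y * indicator (Q - E) y + ?I y * indicator E y \<partial>lebesgue)"
      unfolding energy_def using EQ by (intro nn_integral_cong) (auto simp: indicator_def)
    also have "\<dots> = (\<integral>\<^sup>+y\<in>Q - E. ?I y \<partial>lebesgue) + (\<integral>\<^sup>+y\<in>E. ?I y \<partial>lebesgue)"
      by (intro nn_integral_add) auto
    finally show ?thesis .
  qed
  also have "\<dots> \<le> ennreal (l powr q) * (\<integral>\<^sup>+y\<in>Q. ennreal (\<sigma> y) \<partial>lebesgue) +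
      (ennreal (a * jump powr q) * (ennreal (l powr q) * (\<integral>\<^sup>+y\<in>Q. ennreal (\<sigma> y) \<partial>lebesgue)) + ennreal (b * Y) * W E)"
  proof (intro add_mono order_trans[OF int_good] order_trans[OF int_bad])
    show "(\<integral>\<^sup>+y\<in>Q. ennreal (l powr q * \<sigma> y) \<partial>lebesgue) \<le> ennreal (l powr q) * (\<integral>\<^sup>+y\<in>Q. ennreal (\<sigma> y) \<partial>lebesgue)"
      by (subst nn_integral_cmult[symmetric]) (auto simp: ennreal_mult mult.assoc intro!: nn_integral_mono)
    have "(\<integral>\<^sup>+y\<in>E. ennreal (a * (jump * l) powr q * \<sigma> y + b * Y * w y) \<partial>lebesgue) =
        (\<integral>\<^sup>+y. ennreal (a * jump powr q) * (ennreal (l powr q) * (ennreal (\<sigma> y) * indicator E y)) +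
          ennreal (b * Y) * (ennreal (w y) * indicator E y) \<partial>lebesgue)"
      using ab Y w_pos jump_pos l by (intro nn_integral_cong)
        (auto simp: indicator_def less_imp_le powr_mult mult_ac simp flip: ennreal_mult' ennreal_plus)
    also have "\<dots> = ennreal (a * jump powr q) * (ennreal (l powr q) * (\<integral>\<^sup>+y\<in>E. ennreal (\<sigma> y) \<partial>lebesgue)) +
        ennreal (b * Y) * W E"
      by (subst nn_integral_add) (auto simp: nn_integral_cmult)
    also have "\<dots> \<le> ennreal (a * jump powr q) * (ennreal (l powr q) * (\<integral>\<^sup>+y\<in>Q. ennreal (\<sigma> y) \<partial>lebesgue)) +
        ennreal (b * Y) * W E"
      by (intro add_mono mult_left_mono nn_set_integral_mono_set[OF EQ]) auto
    finally show "(\<integral>\<^sup>+y\<in>E. ennreal (a * (jump * l) powr q * \<sigma> y + b * Y * w y) \<partial>lebesgue) \<le>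
        ennreal (a * jump powr q) * (ennreal (l powr q) * (\<integral>\<^sup>+y\<in>Q. ennreal (\<sigma> y) \<partial>lebesgue)) + ennreal (b * Y) * W E" .
  qed
  also have "\<dots> \<le> ennreal ((2 / \<epsilon>) powr q * K powr q * A) * W Q +
      (ennreal (a * jump powr q) * (ennreal ((2 / \<epsilon>) powr q * K powr q * A) * W Q) + ennreal (b * Y) * (ennreal \<delta> * W Q))"
    by (intro add_mono mult_left_mono l_\<sigma> WE) auto
  also have "\<dots> = ennreal (step * K powr q + \<eta> * Y) * W Q"
  proof -
    have "ennreal (b * Y) * ennreal \<delta> = ennreal (\<eta> * Y)"
      using \<eta>(3) ab Y \<delta> by (simp add: b_def mult_ac flip: ennreal_mult)
    moreover have "ennreal ((2 / \<epsilon>) powr q * K powr q * A) + ennreal (a * jump powr q) * ennreal ((2 / \<epsilon>) powr q * K powr q * A) =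
        ennreal (step * K powr q)"
      using A ab by (simp add: step_def a_def algebra_simps flip: ennreal_mult ennreal_plus)
    moreover have "ennreal (step * K powr q + \<eta> * Y) = ennreal (step * K powr q) + ennreal (\<eta> * Y)"
      using step_nonneg \<eta>(1) Y by (intro ennreal_plus) auto
    moreover have "u * W Q + (v * (u * W Q) + y * (d * W Q)) = (u + v * u + y * d) * W Q"
      for u v y d :: ennreal
      by (simp only: distrib_right mult.assoc add.assoc)
    ultimately show ?thesis by (simp only:)
  qed
  finally show ?thesis by (simp add: Q_def)
qed

text \<open>
  Iterating \<open>energy_improves\<close> from the a priori constant \<open>M\<^sup>q\<close> converges to the fixed point, which does not
  depend on \<open>M\<close>.
\<close>

lemma truncated_bound:
  assumes x: "x \<in> cube 0 x0" and M: "0 \<le> M"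
  shows "energy M (cube k x) \<le> ennreal (step / (1 - \<eta>) * K powr q) * W (cube k x)"
proof -
  define c where "c = step / (1 - \<eta>) * K powr q"
  have c: "0 \<le> c" using step_nonneg \<eta> by (simp add: c_def)
  have step_eq: "step * K powr q + \<eta> * (c + y) = c + \<eta> * y" for y
    using \<eta> by (simp add: c_def field_simps)
  have iter: "energy M (cube j y) \<le> ennreal (c + \<eta> ^ i * M powr q) * W (cube j y)" if "y \<in> cube 0 x0" for i j y
    using that
  proof (induction i arbitrary: j y)
    case 0
    have "energy M (cube j y) \<le> ennreal (M powr q) * W (cube j y)" by (rule energy_a_priori[OF M]) simp
    also have "\<dots> \<le> ennreal (c + \<eta> ^ 0 * M powr q) * W (cube j y)"
      using c by (intro mult_right_mono ennreal_leI) auto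
    finally show ?case .
  next
    case (Suc i)
    have "energy M (cube j y) \<le> ennreal (step * K powr q + \<eta> * (c + \<eta> ^ i * M powr q)) * W (cube j y)"
      using c \<eta> by (intro energy_improves Suc M) auto
    then show ?case unfolding step_eq by (simp add: mult.assoc)
  qed
  obtain \<omega> where \<omega>: "0 < \<omega>" "W (cube k x) = ennreal (\<omega> * side k ^ CARD('n))"
    by (rule W_cube[OF x, of k])
  let ?\<mu> = "\<omega> * side k ^ CARD('n)"
  have \<mu>: "0 < ?\<mu>" using \<omega>(1) side_pos[of k] by simp
  have "(\<lambda>i. (c + \<eta> ^ i * M powr q) * ?\<mu>) \<longlonglongrightarrow> (c + 0 * M powr q) * ?\<mu>"
    using \<eta> by (intro tendsto_intros LIMSEQ_power_zero) auto
  then have "(\<lambda>i. ennreal ((c + \<eta> ^ i * M powr q) * ?\<mu>)) \<longlonglongrightarrow> ennreal (c * ?\<mu>)"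
    by (intro tendsto_ennrealI) simp
  moreover have "energy M (cube k x) \<le> ennreal ((c + \<eta> ^ i * M powr q) * ?\<mu>)" for i
  proof -
    have "ennreal (c + \<eta> ^ i * M powr q) * ennreal ?\<mu> = ennreal ((c + \<eta> ^ i * M powr q) * ?\<mu>)"
      using c \<eta> \<mu> by (intro ennreal_mult[symmetric]) auto
    with iter[OF x, of k i] show ?thesis unfolding \<omega>(2) by (simp only:)
  qed
  ultimately have "energy M (cube k x) \<le> ennreal (c * ?\<mu>)"
    by (intro LIMSEQ_le_const) auto
  then show ?thesis unfolding \<omega>(2) c_def[symmetric] using c \<mu> by (simp add: ennreal_mult)
qed

theorem john_nirenberg:
  assumes x: "x \<in> cube 0 x0"
  shows "(\<integral>\<^sup>+y\<in>cube k x. ennreal (norm (f y - P (cube k x) y) powr q * \<sigma> y) \<partial>lebesgue) \<le>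
    ennreal (john_nirenberg_const CARD('n) s q A \<epsilon> \<delta> C1 * K powr q) * W (cube k x)"
proof -
  have const: "john_nirenberg_const CARD('n) s q A \<epsilon> \<delta> C1 = step / (1 - \<eta>)"
    unfolding john_nirenberg_const_def step_def \<eta>_def jump_def ..
  let ?Q = "cube k x"
  let ?g = "\<lambda>i y. ennreal (trunc (real i) ?Q y powr q * \<sigma> y) * indicator ?Q y"
  have mono: "incseq ?g"
  proof (rule incseq_SucI, rule le_funI)
    fix i y
    have "trunc (real i) ?Q y \<le> trunc (real (Suc i)) ?Q y"
      unfolding trunc_def using w_pos[of y] by (intro min.mono mult_right_mono) auto
    then show "?g i y \<le> ?g (Suc i) y"
      using trunc_nonneg[of "real i" ?Q y] q
      by (intro mult_right_mono ennreal_leI powr_mono2) auto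
  qed
  have sup: "ennreal (norm (f y - P ?Q y) powr q * \<sigma> y) * indicator ?Q y \<le> (SUP i. ?g i y)" for y
  proof -
    obtain i :: nat where "norm (f y - P ?Q y) / w y < real i" using reals_Archimedean2 by blast
    then have "norm (f y - P ?Q y) \<le> real i * w y" using w_pos[of y] by (simp add: pos_divide_less_eq less_imp_le)
    then have "trunc (real i) ?Q y = norm (f y - P ?Q y)" by (simp add: trunc_def)
    then show ?thesis by (intro SUP_upper2[of i]) auto
  qed
  have "(\<integral>\<^sup>+y\<in>?Q. ennreal (norm (f y - P ?Q y) powr q * \<sigma> y) \<partial>lebesgue) \<le> (\<integral>\<^sup>+y. (SUP i. ?g i y) \<partial>lebesgue)"
    by (intro nn_integral_mono sup)
  also have "\<dots> = (SUP i. \<integral>\<^sup>+y. ?g i y \<partial>lebesgue)"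
  proof (intro nn_integral_monotone_convergence_SUP mono)
    fix i
    have [measurable]: "trunc (real i) ?Q \<in> borel_measurable lebesgue" by (rule trunc_meas[OF x])
    show "?g i \<in> borel_measurable lebesgue" by measurable
  qed
  also have "\<dots> \<le> ennreal (step / (1 - \<eta>) * K powr q) * W ?Q"
    using truncated_bound[OF x, of _ k] by (intro SUP_least) (auto simp: energy_def)
  finally show ?thesis unfolding const .
qed

end

section \<open>Consequences of the Muckenhoupt condition\<close>

lemma ball_sets_lebesgue [measurable]: "ball z \<rho> \<in> sets lebesgue"
  by simp

lemma ennreal_mult3:
  "0 \<le> a \<Longrightarrow> 0 \<le> b \<Longrightarrow> 0 \<le> c \<Longrightarrow> ennreal (a * b * c) = ennreal a * ennreal b * ennreal c"
  by (simp add: ennreal_mult)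

lemma measure_ball_pos: "0 < \<rho> \<Longrightarrow> 0 < measure lebesgue (ball (z::real^'n) \<rho>)"
  by (simp add: content_ball)

lemma emeasure_ball_measure: "emeasure lebesgue (ball (z::real^'n) \<rho>) = ennreal (measure lebesgue (ball z \<rho>))"
  by (rule emeasure_eq_ennreal_measure) (use emeasure_lborel_ball_finite[of z \<rho>] in auto)

lemma nn_integral_ball_pos:
  fixes w :: "real^'n \<Rightarrow> real"
  assumes [measurable]: "w \<in> borel_measurable lebesgue" and w: "\<And>x. 0 < w x" and \<rho>: "0 < \<rho>"
  shows "0 < (\<integral>\<^sup>+x\<in>ball z \<rho>. ennreal (w x) \<partial>lebesgue)"
proof (rule ccontr)
  assume "\<not> ?thesis"
  then have "(\<integral>\<^sup>+x\<in>ball z \<rho>. ennreal (w x) \<partial>lebesgue) = 0" by simp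
  then have "AE x in lebesgue. ennreal (w x) * indicator (ball z \<rho>) x = 0"
    by (subst (asm) nn_integral_0_iff_AE) auto
  then have "AE x in lebesgue. x \<notin> ball z \<rho>"
  proof (rule AE_mp, intro AE_I2 impI)
    fix x assume "ennreal (w x) * indicator (ball z \<rho>) x = 0"
    then show "x \<notin> ball z \<rho>" using w[of x] by (auto simp: ennreal_eq_0_iff)
  qed
  then have "emeasure lebesgue (ball z \<rho>) = 0" by (subst (asm) AE_iff_null_sets[symmetric]) auto
  then show False using measure_ball_pos[OF \<rho>, of z] by (simp add: emeasure_ball_measure)
qed

lemma powr_minus_le_1_plus:
  fixes v a b :: real assumes "0 < v" "0 \<le> a" "a \<le> b"
  shows "v powr (- a) \<le> 1 + v powr (- b)"
proof (cases "1 \<le> v")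
  case True
  then have "v powr (- a) \<le> v powr 0" using assms by (intro powr_mono) auto
  then show ?thesis using assms by (simp add: add_increasing2)
next
  case False
  then have "v powr (- a) \<le> v powr (- b)" using assms by (intro powr_mono') auto
  then show ?thesis by simp
qed

lemma one_le_add_powr_minus:
  fixes u a :: real assumes "0 < u" "0 < a" shows "1 \<le> u + u powr (- a)"
proof (cases "1 \<le> u")
  case True then show ?thesis by (simp add: add_increasing2)
next
  case False
  then have "u powr 0 \<le> u powr (- a)" using assms by (intro powr_mono') auto
  then show ?thesis using assms by simp
qed

text \<open>
  Normalise the weight to mean 1 on the ball; the Muckenhoupt condition then bounds the mean of a negative power.
  Both factors of the product must first be shown finite: each is positive because \<open>w\<close> is positive everywhere.
\<close>

lemma muckenhoupt_quantity_dual_bound: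
  fixes w :: "real^'n \<Rightarrow> real"
  assumes meas [measurable]: "w \<in> borel_measurable lebesgue" and pos: "\<And>x. 0 < w x"
    and \<rho>: "0 < \<rho>" and q: "1 < q" and C: "0 \<le> C"
    and le: "ennreal (1 / measure lebesgue (ball z \<rho>) powr q) * (\<integral>\<^sup>+x\<in>ball z \<rho>. ennreal (w x) \<partial>lebesgue) *
      ennreal_powr (\<integral>\<^sup>+y\<in>ball z \<rho>. ennreal (w y powr (- (1 / (q - 1)))) \<partial>lebesgue) (q - 1) \<le> ennreal C"
  obtains W where "0 < W" "(\<integral>\<^sup>+x\<in>ball z \<rho>. ennreal (w x) \<partial>lebesgue) = ennreal W"
    "(\<integral>\<^sup>+y\<in>ball z \<rho>. ennreal ((w y * measure lebesgue (ball z \<rho>) / W) powr (- (1 / (q - 1)))) \<partial>lebesgue)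
      \<le> ennreal (C powr (1 / (q - 1)) * measure lebesgue (ball z \<rho>))"
proof -
  let ?B = "ball z \<rho>" and ?b = "1 / (q - 1)"
  define \<mu> where "\<mu> = measure lebesgue ?B"
  have \<mu>: "0 < \<mu>" unfolding \<mu>_def by (rule measure_ball_pos[OF \<rho>])
  let ?W = "\<integral>\<^sup>+x\<in>?B. ennreal (w x) \<partial>lebesgue" and ?S = "\<integral>\<^sup>+y\<in>?B. ennreal (w y powr (- ?b)) \<partial>lebesgue"
  have W0: "0 < ?W" by (rule nn_integral_ball_pos[OF meas pos \<rho>])
  have S0: "0 < ?S"
    by (rule nn_integral_ball_pos[OF _ _ \<rho>]) (use pos in \<open>auto simp: less_imp_neq[symmetric]\<close>)
  have S1: "0 < ennreal_powr ?S (q - 1)"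
  proof (cases "?S = top")
    case False
    then have "0 < enn2real ?S" using S0 by (simp add: enn2real_positive_iff less_top)
    then show ?thesis using False by (simp add: ennreal_powr_def)
  qed (simp add: ennreal_powr_def)
  have fin: "ennreal (1 / \<mu> powr q) * ?W * ennreal_powr ?S (q - 1) < top"
    using le unfolding \<mu>_def by (rule le_less_trans) simp
  have "?W < top"
  proof (rule ccontr)
    assume "\<not> ?W < top"
    then have "?W = top" by (simp add: not_less top_unique)
    with fin S1 \<mu> show False by (simp add: ennreal_mult_top ennreal_top_mult split: if_splits)
  qed
  moreover have "?S < top"
  proof (rule ccontr)
    assume "\<not> ?S < top"
    then have "?S = top" by (simp add: not_less top_unique)
    with fin W0 \<mu> show False by (auto simp: ennreal_powr_def ennreal_mult_top ennreal_mult_eq_top_iff split: if_splits)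
  qed
  ultimately obtain W S where WS: "?W = ennreal W" "?S = ennreal S" "0 < W" "0 < S"
    using W0 S0 by (intro that[of "enn2real ?W" "enn2real ?S"]) (simp_all add: enn2real_positive_iff)
  have "W * S powr (q - 1) \<le> C * \<mu> powr q"
  proof -
    have "ennreal (1 / \<mu> powr q * W * S powr (q - 1)) \<le> ennreal C"
      using le WS \<mu> unfolding \<mu>_def[symmetric]
      by (subst ennreal_mult3) (simp_all add: ennreal_powr_def)
    then have "1 / \<mu> powr q * W * S powr (q - 1) \<le> C" using C by (simp add: ennreal_le_iff)
    then show ?thesis using \<mu> by (simp add: field_simps)
  qed
  then have "(W / \<mu>) * S powr (q - 1) \<le> C * \<mu> powr (q - 1)"
    using \<mu> by (simp add: powr_diff field_simps)
  then have "((W / \<mu>) * S powr (q - 1)) powr ?b \<le> (C * \<mu> powr (q - 1)) powr ?b"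
    using WS \<mu> q by (intro powr_mono2) auto
  then have *: "(W / \<mu>) powr ?b * S \<le> C powr ?b * \<mu>"
    using WS \<mu> q C by (simp add: powr_mult powr_powr del: times_divide_eq_left)
  show ?thesis
  proof (rule that[OF WS(3) WS(1)])
    have eq: "(w y * \<mu> / W) powr (- ?b) = (W / \<mu>) powr ?b * w y powr (- ?b)" for y
      using pos[of y] WS \<mu> by (simp add: powr_mult powr_divide powr_minus field_simps)
    have "(\<integral>\<^sup>+y\<in>?B. ennreal ((w y * \<mu> / W) powr (- ?b)) \<partial>lebesgue) = ennreal ((W / \<mu>) powr ?b) * ?S"
      unfolding eq by (subst nn_integral_cmult[symmetric]) (auto simp: ennreal_mult mult.assoc)
    also have "\<dots> = ennreal ((W / \<mu>) powr ?b * S)" using WS by (simp add: ennreal_mult)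
    also have "\<dots> \<le> ennreal (C powr ?b * \<mu>)" by (intro ennreal_leI *)
    finally show "(\<integral>\<^sup>+y\<in>?B. ennreal ((w y * measure lebesgue ?B / W) powr (- ?b)) \<partial>lebesgue)
      \<le> ennreal (C powr ?b * measure lebesgue ?B)" unfolding \<mu>_def .
  qed
qed

lemma muckenhoupt_quantity_1_dual_bound:
  fixes w :: "real^'n \<Rightarrow> real"
  assumes meas [measurable]: "w \<in> borel_measurable lebesgue" and pos: "\<And>x. 0 < w x"
    and \<rho>: "0 < \<rho>" and C: "0 \<le> C" and a: "0 \<le> a"
    and le: "ennreal (1 / measure lebesgue (ball z \<rho>)) * (\<integral>\<^sup>+x\<in>ball z \<rho>. ennreal (w x) \<partial>lebesgue) *
      esssup (restrict_space lebesgue (ball z \<rho>)) (\<lambda>y. ennreal (inverse (w y))) \<le> ennreal C"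
  obtains W where "0 < W" "(\<integral>\<^sup>+x\<in>ball z \<rho>. ennreal (w x) \<partial>lebesgue) = ennreal W"
    "(\<integral>\<^sup>+y\<in>ball z \<rho>. ennreal ((w y * measure lebesgue (ball z \<rho>) / W) powr (- a)) \<partial>lebesgue)
      \<le> ennreal (C powr a * measure lebesgue (ball z \<rho>))"
proof -
  let ?B = "ball z \<rho>"
  define \<mu> where "\<mu> = measure lebesgue ?B"
  have \<mu>: "0 < \<mu>" unfolding \<mu>_def by (rule measure_ball_pos[OF \<rho>])
  let ?W = "\<integral>\<^sup>+x\<in>?B. ennreal (w x) \<partial>lebesgue"
  define e where "e = esssup (restrict_space lebesgue ?B) (\<lambda>y. ennreal (inverse (w y)))"
  have "AE y in restrict_space lebesgue ?B. ennreal (inverse (w y)) \<le> e"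
    unfolding e_def by (rule esssup_AE)
  then have AE: "AE y in lebesgue. y \<in> ?B \<longrightarrow> ennreal (inverse (w y)) \<le> e"
    by (simp add: AE_restrict_space_iff)
  have W0: "0 < ?W" by (rule nn_integral_ball_pos[OF meas pos \<rho>])
  have e0: "0 < e"
  proof (rule ccontr)
    assume "\<not> 0 < e"
    then have e: "e = 0" by simp
    from AE have "AE y in lebesgue. y \<notin> ?B"
    proof (rule AE_mp, intro AE_I2 impI)
      fix y assume "y \<in> ?B \<longrightarrow> ennreal (inverse (w y)) \<le> e"
      then show "y \<notin> ?B" using pos[of y] by (auto simp: e ennreal_eq_0_iff)
    qed
    then have "emeasure lebesgue ?B = 0" by (subst (asm) AE_iff_null_sets[symmetric]) auto
    then show False using \<mu> by (simp add: emeasure_ball_measure \<mu>_def)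
  qed
  have fin: "ennreal (1 / \<mu>) * ?W * e < top"
    using le unfolding \<mu>_def e_def by (rule le_less_trans) simp
  have "?W < top"
  proof (rule ccontr)
    assume "\<not> ?W < top"
    then have "?W = top" by (simp add: not_less top_unique)
    with fin e0 \<mu> show False by (simp add: ennreal_mult_top ennreal_top_mult split: if_splits)
  qed
  moreover have "e < top"
  proof (rule ccontr)
    assume "\<not> e < top"
    then have "e = top" by (simp add: not_less top_unique)
    with fin W0 \<mu> show False by (auto simp: ennreal_mult_top ennreal_mult_eq_top_iff split: if_splits)
  qed
  ultimately obtain W E where WE: "?W = ennreal W" "e = ennreal E" "0 < W" "0 < E"
    using W0 e0 by (intro that[of "enn2real ?W" "enn2real e"]) (simp_all add: enn2real_positive_iff)
  have "ennreal (1 / \<mu> * W * E) \<le> ennreal C"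
    using le WE \<mu> unfolding \<mu>_def[symmetric] e_def[symmetric]
    by (subst ennreal_mult3) simp_all
  then have "1 / \<mu> * W * E \<le> C" using C by (simp add: ennreal_le_iff)
  then have E: "W / \<mu> * E \<le> C" by simp
  show ?thesis
  proof (rule that[OF WE(3) WE(1)])
    have "(\<integral>\<^sup>+y\<in>?B. ennreal ((w y * \<mu> / W) powr (- a)) \<partial>lebesgue) \<le> (\<integral>\<^sup>+y\<in>?B. ennreal (C powr a) \<partial>lebesgue)"
    proof (rule nn_integral_mono_AE, rule AE_mp[OF AE], intro AE_I2 impI)
      fix y assume y: "y \<in> ?B \<longrightarrow> ennreal (inverse (w y)) \<le> e"
      show "ennreal ((w y * \<mu> / W) powr (- a)) * indicator ?B y \<le> ennreal (C powr a) * indicator ?B y"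
      proof (cases "y \<in> ?B")
        case True
        then have "inverse (w y) \<le> E" using y WE by (simp add: ennreal_le_iff)
        then have "W / \<mu> * inverse (w y) \<le> W / \<mu> * E"
          using WE \<mu> by (intro mult_left_mono) auto
        then have "W / \<mu> * inverse (w y) \<le> C" using E by simp
        then have "(W / \<mu> * inverse (w y)) powr a \<le> C powr a"
          using WE \<mu> pos[of y] a by (intro powr_mono2) auto
        moreover have "(W / \<mu> * inverse (w y)) powr a = (w y * \<mu> / W) powr (- a)"
          using pos[of y] WE \<mu> by (simp add: powr_mult powr_divide powr_minus field_simps)
        ultimately show ?thesis by (auto intro!: ennreal_leI mult_right_mono)
      qed simp
    qed
    also have "\<dots> = ennreal (C powr a * \<mu>)"
      by (simp add: nn_integral_cmult_indicator emeasure_ball_measure \<mu>_def ennreal_mult')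
    finally show "(\<integral>\<^sup>+y\<in>?B. ennreal ((w y * measure lebesgue ?B / W) powr (- a)) \<partial>lebesgue)
      \<le> ennreal (C powr a * measure lebesgue ?B)" unfolding \<mu>_def .
  qed
qed

text \<open>
  The Muckenhoupt condition of exponent \<open>1 + 1/a\<close>, for the weight normalised to mean 1 on each ball and uniformly in \<open>t\<close>.
  In this normalisation it passes to larger exponents without Jensen's inequality.
\<close>

definition dual_bound :: "(real^'n \<Rightarrow> real \<Rightarrow> real) \<Rightarrow> real \<Rightarrow> real \<Rightarrow> bool" where
  "dual_bound \<phi> a C \<longleftrightarrow> (\<forall>t>0. \<forall>z. \<forall>\<rho>>0. \<exists>W>0.
     (\<integral>\<^sup>+x\<in>ball z \<rho>. ennreal (\<phi> x t) \<partial>lebesgue) = ennreal W \<and>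
     (\<integral>\<^sup>+y\<in>ball z \<rho>. ennreal ((\<phi> y t * measure lebesgue (ball z \<rho>) / W) powr (- a)) \<partial>lebesgue)
       \<le> ennreal (C * measure lebesgue (ball z \<rho>)))"

lemma muckenhoupt_dual_bound:
  fixes \<phi> :: "real^'n \<Rightarrow> real \<Rightarrow> real"
  assumes meas: "\<And>t. 0 < t \<Longrightarrow> (\<lambda>x. \<phi> x t) \<in> borel_measurable lebesgue"
    and pos: "\<And>x t. 0 < t \<Longrightarrow> 0 < \<phi> x t"
    and muck: "muckenhoupt r \<phi>" and r: "1 \<le> r" and a: "0 < a" "a * (r - 1) < 1"
  shows "\<exists>C>0. dual_bound \<phi> a C"
proof -
  define C where "C = enn2real (SUP t\<in>{0<..}. SUP (z, \<rho>)\<in>UNIV \<times> {0<..}. muckenhoupt_quantity r \<phi> t (ball z \<rho>))"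
  have C: "0 \<le> C" by (simp add: C_def)
  have fin: "(SUP t\<in>{0<..}. SUP (z, \<rho>)\<in>UNIV \<times> {0<..}. muckenhoupt_quantity r \<phi> t (ball z \<rho>)) < top"
    using muck by (simp add: muckenhoupt_def)
  have le: "muckenhoupt_quantity r \<phi> t (ball z \<rho>) \<le> ennreal C" if "0 < t" "0 < \<rho>" for t z \<rho>
  proof -
    have "muckenhoupt_quantity r \<phi> t (ball z \<rho>) \<le>
        (SUP (z, \<rho>)\<in>UNIV \<times> {0<..}. muckenhoupt_quantity r \<phi> t (ball z \<rho>))"
      using that by (intro SUP_upper2[of "(z, \<rho>)"]) auto
    also have "\<dots> \<le> (SUP t\<in>{0<..}. SUP (z, \<rho>)\<in>UNIV \<times> {0<..}. muckenhoupt_quantity r \<phi> t (ball z \<rho>))"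
      using that by (intro SUP_upper) auto
    also have "\<dots> = ennreal C" using fin by (simp add: C_def)
    finally show ?thesis .
  qed
  show ?thesis
  proof (cases "r = 1")
    case True
    have "dual_bound \<phi> a (C powr a + 1)"
      unfolding dual_bound_def
    proof (intro allI impI)
      fix t \<rho> :: real and z :: "real^'n" assume t: "0 < t" and \<rho>: "0 < \<rho>"
      have "ennreal (1 / measure lebesgue (ball z \<rho>)) * (\<integral>\<^sup>+x\<in>ball z \<rho>. ennreal (\<phi> x t) \<partial>lebesgue) *
        esssup (restrict_space lebesgue (ball z \<rho>)) (\<lambda>y. ennreal (inverse (\<phi> y t))) \<le> ennreal C"
        using le[OF t \<rho>, of z] by (simp add: muckenhoupt_quantity_def True)
      from muckenhoupt_quantity_1_dual_bound[OF meas[OF t] pos[OF t] \<rho> C less_imp_le[OF a(1)] this]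
      obtain W where W: "0 < W" "(\<integral>\<^sup>+x\<in>ball z \<rho>. ennreal (\<phi> x t) \<partial>lebesgue) = ennreal W"
        "(\<integral>\<^sup>+y\<in>ball z \<rho>. ennreal ((\<phi> y t * measure lebesgue (ball z \<rho>) / W) powr (- a)) \<partial>lebesgue)
          \<le> ennreal (C powr a * measure lebesgue (ball z \<rho>))" by blast
      have "ennreal (C powr a * measure lebesgue (ball z \<rho>)) \<le> ennreal ((C powr a + 1) * measure lebesgue (ball z \<rho>))"
        by (intro ennreal_leI mult_right_mono) auto
      with W show "\<exists>W>0. (\<integral>\<^sup>+x\<in>ball z \<rho>. ennreal (\<phi> x t) \<partial>lebesgue) = ennreal W \<and>
        (\<integral>\<^sup>+y\<in>ball z \<rho>. ennreal ((\<phi> y t * measure lebesgue (ball z \<rho>) / W) powr (- a)) \<partial>lebesgue)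
          \<le> ennreal ((C powr a + 1) * measure lebesgue (ball z \<rho>))"
        by (meson order_trans)
    qed
    moreover have "0 < C powr a + 1" by (simp add: add_nonneg_pos)
    ultimately show ?thesis by blast
  next
    case False
    with r have r1: "1 < r" by simp
    let ?b = "1 / (r - 1)"
    have ab: "a \<le> ?b" using a r1 by (simp add: pos_le_divide_eq)
    have ex: "r / (r - 1) / r = ?b" "r / (r / (r - 1)) = r - 1" using r1 by auto
    have "dual_bound \<phi> a (1 + C powr ?b)"
      unfolding dual_bound_def
    proof (intro allI impI)
      fix t \<rho> :: real and z :: "real^'n" assume t: "0 < t" and \<rho>: "0 < \<rho>"
      have [measurable]: "(\<lambda>x. \<phi> x t) \<in> borel_measurable lebesgue" by (rule meas[OF t])
      have "ennreal (1 / measure lebesgue (ball z \<rho>) powr r) * (\<integral>\<^sup>+x\<in>ball z \<rho>. ennreal (\<phi> x t) \<partial>lebesgue) *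
        ennreal_powr (\<integral>\<^sup>+y\<in>ball z \<rho>. ennreal (\<phi> y t powr (- ?b)) \<partial>lebesgue) (r - 1) \<le> ennreal C"
        using le[OF t \<rho>, of z] False unfolding muckenhoupt_quantity_def Let_def ex by simp
      from muckenhoupt_quantity_dual_bound[OF meas[OF t] pos[OF t] \<rho> r1 C this]
      obtain W where W: "0 < W" "(\<integral>\<^sup>+x\<in>ball z \<rho>. ennreal (\<phi> x t) \<partial>lebesgue) = ennreal W"
        "(\<integral>\<^sup>+y\<in>ball z \<rho>. ennreal ((\<phi> y t * measure lebesgue (ball z \<rho>) / W) powr (- ?b)) \<partial>lebesgue)
          \<le> ennreal (C powr ?b * measure lebesgue (ball z \<rho>))" by blast
      define \<mu> where "\<mu> = measure lebesgue (ball z \<rho>)"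
      have \<mu>: "0 < \<mu>" unfolding \<mu>_def by (rule measure_ball_pos[OF \<rho>])
      let ?v = "\<lambda>y. \<phi> y t * \<mu> / W"
      have "(\<integral>\<^sup>+y\<in>ball z \<rho>. ennreal (?v y powr (- a)) \<partial>lebesgue) \<le>
          (\<integral>\<^sup>+y. indicator (ball z \<rho>) y + ennreal (?v y powr (- ?b)) * indicator (ball z \<rho>) y \<partial>lebesgue)"
      proof (intro nn_integral_mono)
        fix y
        have "0 < ?v y" using pos[OF t, of y] \<mu> W(1) by simp
        from powr_minus_le_1_plus[OF this less_imp_le[OF a(1)] ab]
        have "ennreal (?v y powr (- a)) \<le> ennreal (1 + ?v y powr (- ?b))" by (rule ennreal_leI)
        also have "\<dots> = 1 + ennreal (?v y powr (- ?b))" by simp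
        finally show "ennreal (?v y powr (- a)) * indicator (ball z \<rho>) y \<le>
            indicator (ball z \<rho>) y + ennreal (?v y powr (- ?b)) * indicator (ball z \<rho>) y"
          by (cases "y \<in> ball z \<rho>") simp_all
      qed
      also have "\<dots> = ennreal \<mu> + (\<integral>\<^sup>+y\<in>ball z \<rho>. ennreal (?v y powr (- ?b)) \<partial>lebesgue)"
        by (subst nn_integral_add) (auto simp: emeasure_ball_measure \<mu>_def)
      also have "\<dots> \<le> ennreal \<mu> + ennreal (C powr ?b * \<mu>)"
        using W(3) unfolding \<mu>_def[symmetric] by (rule add_left_mono)
      also have "\<dots> = ennreal ((1 + C powr ?b) * \<mu>)"
        using \<mu> by (simp add: distrib_right)
      finally show "\<exists>W>0. (\<integral>\<^sup>+x\<in>ball z \<rho>. ennreal (\<phi> x t) \<partial>lebesgue) = ennreal W \<and>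
        (\<integral>\<^sup>+y\<in>ball z \<rho>. ennreal ((\<phi> y t * measure lebesgue (ball z \<rho>) / W) powr (- a)) \<partial>lebesgue)
          \<le> ennreal ((1 + C powr ?b) * measure lebesgue (ball z \<rho>))"
        using W(1,2) unfolding \<mu>_def by blast
    qed
    moreover have "0 < 1 + C powr ?b" by (simp add: add_pos_nonneg)
    ultimately show ?thesis by blast
  qed
qed

text \<open>
  For the normalised weight \<open>v\<close> and every \<open>c > 0\<close> one has \<open>1 \<le> c v + (c v)\<^bsup>-a\<^esup>\<close>. Integrating this over \<open>E\<close>
  and choosing \<open>c\<close> gives the usual comparison of relative volume and relative mass, in place of Hoelder's inequality.
\<close>

lemma dual_bound_subset:
  fixes \<phi> :: "real^'n \<Rightarrow> real \<Rightarrow> real"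
  assumes meas: "\<And>t. 0 < t \<Longrightarrow> (\<lambda>x. \<phi> x t) \<in> borel_measurable lebesgue"
    and pos: "\<And>x t. 0 < t \<Longrightarrow> 0 < \<phi> x t"
    and dual: "dual_bound \<phi> a C" and C: "0 < C" and a: "0 < a"
    and t: "0 < t" and \<rho>: "0 < \<rho>" and E: "E \<in> sets lebesgue" "E \<subseteq> ball z \<rho>"
  shows "ennreal ((measure lebesgue E / measure lebesgue (ball z \<rho>)) powr (1 + 1 / a)) *
      (\<integral>\<^sup>+x\<in>ball z \<rho>. ennreal (\<phi> x t) \<partial>lebesgue)
    \<le> ennreal (2 * (2 * C) powr (1 / a)) * (\<integral>\<^sup>+x\<in>E. ennreal (\<phi> x t) \<partial>lebesgue)"
proof -
  define \<mu> where "\<mu> = measure lebesgue (ball z \<rho>)"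
  have \<mu>: "0 < \<mu>" unfolding \<mu>_def by (rule measure_ball_pos[OF \<rho>])
  have [measurable]: "(\<lambda>x. \<phi> x t) \<in> borel_measurable lebesgue" "E \<in> sets lebesgue" by (rule meas[OF t], rule E)
  obtain W where W: "0 < W" "(\<integral>\<^sup>+x\<in>ball z \<rho>. ennreal (\<phi> x t) \<partial>lebesgue) = ennreal W"
    and S: "(\<integral>\<^sup>+y\<in>ball z \<rho>. ennreal ((\<phi> y t * \<mu> / W) powr (- a)) \<partial>lebesgue) \<le> ennreal (C * \<mu>)"
    using dual t \<rho> unfolding dual_bound_def \<mu>_def by blast
  have "(\<integral>\<^sup>+x\<in>E. ennreal (\<phi> x t) \<partial>lebesgue) \<le> ennreal W"
    unfolding W(2)[symmetric] by (rule nn_set_integral_mono_set[OF E(2)])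
  then obtain V where V: "0 \<le> V" "(\<integral>\<^sup>+x\<in>E. ennreal (\<phi> x t) \<partial>lebesgue) = ennreal V"
    by (cases "\<integral>\<^sup>+x\<in>E. ennreal (\<phi> x t) \<partial>lebesgue") (auto simp: top_unique)
  have "emeasure lebesgue E < top"
    by (rule le_less_trans[OF emeasure_mono[OF E(2)]]) (auto simp: emeasure_ball_measure)
  then have emE: "emeasure lebesgue E = ennreal (measure lebesgue E)"
    by (intro emeasure_eq_ennreal_measure) auto
  define \<theta> where "\<theta> = measure lebesgue E / \<mu>"
  have \<theta>: "0 \<le> \<theta>" using \<mu> by (simp add: \<theta>_def)
  have *: "\<theta> \<le> c * (V / W) + C * c powr (- a)" if c: "0 < c" for c
  proof -
    have "ennreal (measure lebesgue E) = (\<integral>\<^sup>+y. indicator E y \<partial>lebesgue)" by (simp add: emE)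
    also have "\<dots> \<le> (\<integral>\<^sup>+y. ennreal (c * \<mu> / W) * (ennreal (\<phi> y t) * indicator E y) +
        ennreal (c powr (- a)) * (ennreal ((\<phi> y t * \<mu> / W) powr (- a)) * indicator (ball z \<rho>) y) \<partial>lebesgue)"
    proof (rule nn_integral_mono)
      fix y
      let ?v = "\<phi> y t * \<mu> / W"
      have v: "0 < ?v" using pos[OF t, of y] \<mu> W(1) by simp
      have "1 \<le> c * ?v + (c * ?v) powr (- a)"
        by (rule one_le_add_powr_minus[OF mult_pos_pos[OF c v] a])
      also have "(c * ?v) powr (- a) = c powr (- a) * ?v powr (- a)"
        by (rule powr_mult)
      also have "c * ?v = c * \<mu> / W * \<phi> y t" by simp
      finally have "ennreal 1 \<le> ennreal (c * \<mu> / W * \<phi> y t + c powr (- a) * ?v powr (- a))"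
        by (rule ennreal_leI)
      also have "\<dots> = ennreal (c * \<mu> / W) * ennreal (\<phi> y t) + ennreal (c powr (- a)) * ennreal (?v powr (- a))"
      proof -
        have "ennreal (c * \<mu> / W * \<phi> y t) = ennreal (c * \<mu> / W) * ennreal (\<phi> y t)"
          "ennreal (c powr (- a) * ?v powr (- a)) = ennreal (c powr (- a)) * ennreal (?v powr (- a))"
          using c \<mu> W(1) pos[OF t, of y] by (intro ennreal_mult; simp)+
        moreover have "ennreal (c * \<mu> / W * \<phi> y t + c powr (- a) * ?v powr (- a)) =
            ennreal (c * \<mu> / W * \<phi> y t) + ennreal (c powr (- a) * ?v powr (- a))"
          using c \<mu> W(1) pos[OF t, of y] by (intro ennreal_plus) auto
        ultimately show ?thesis by (simp only:)
      qed
      finally show "indicator E y \<le> ennreal (c * \<mu> / W) * (ennreal (\<phi> y t) * indicator E y) +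
        ennreal (c powr (- a)) * (ennreal (?v powr (- a)) * indicator (ball z \<rho>) y)"
        using E(2) by (cases "y \<in> E") (auto simp: subset_iff)
    qed
    also have "\<dots> = ennreal (c * \<mu> / W) * ennreal V +
        ennreal (c powr (- a)) * (\<integral>\<^sup>+y\<in>ball z \<rho>. ennreal ((\<phi> y t * \<mu> / W) powr (- a)) \<partial>lebesgue)"
      by (subst nn_integral_add) (auto simp: nn_integral_cmult V(2))
    also have "\<dots> \<le> ennreal (c * \<mu> / W) * ennreal V + ennreal (c powr (- a)) * ennreal (C * \<mu>)"
      by (intro add_left_mono mult_left_mono S) auto
    also have "\<dots> = ennreal (c * \<mu> / W * V + c powr (- a) * (C * \<mu>))"
      using c \<mu> W(1) V(1) C by (simp flip: ennreal_mult ennreal_plus)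
    finally have "measure lebesgue E \<le> c * \<mu> / W * V + c powr (- a) * (C * \<mu>)"
      using c \<mu> W(1) V(1) C by (subst (asm) ennreal_le_iff) auto
    also have "\<dots> = (c * (V / W) + C * c powr (- a)) * \<mu>" by (simp add: algebra_simps)
    finally show ?thesis using \<mu> by (simp add: \<theta>_def pos_divide_le_eq)
  qed
  have "\<theta> powr (1 + 1 / a) * W \<le> 2 * (2 * C) powr (1 / a) * V"
  proof (cases "\<theta> = 0")
    case True
    then show ?thesis using V C by simp
  next
    case False
    with \<theta> have \<theta>: "0 < \<theta>" by simp
    \<comment> \<open>With this choice the second term of \<open>*\<close> equals \<open>\<theta>/2\<close> and can be absorbed.\<close>
    define c where "c = (2 * C / \<theta>) powr (1 / a)"
    have c: "0 < c" using C \<theta> by (simp add: c_def)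
    have "C * c powr (- a) = \<theta> / 2"
      using C \<theta> a by (simp add: c_def powr_powr powr_minus)
    with *[OF c] have "\<theta> \<le> 2 * c * (V / W)" by simp
    then have "\<theta> * W \<le> 2 * c * V" using W(1) by (simp add: pos_le_divide_eq)
    then have "\<theta> powr (1 / a) * (\<theta> * W) \<le> \<theta> powr (1 / a) * (2 * c * V)"
      by (intro mult_left_mono) auto
    moreover have "\<theta> powr (1 / a) * (\<theta> * W) = \<theta> powr (1 + 1 / a) * W"
      using \<theta> by (simp add: powr_add)
    moreover have "\<theta> powr (1 / a) * (2 * c * V) = 2 * (2 * C) powr (1 / a) * V"
      using \<theta> C by (simp add: c_def powr_divide)
    ultimately show ?thesis by simp
  qed
  then have "ennreal (\<theta> powr (1 + 1 / a) * W) \<le> ennreal (2 * (2 * C) powr (1 / a) * V)"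
    by (rule ennreal_leI)
  then show ?thesis
    unfolding W(2) V(2) \<theta>_def[unfolded \<mu>_def, symmetric] using W(1) V(1) C
    by (simp add: ennreal_mult)
qed


section \<open>The norm of a characteristic function\<close>

text \<open>
  The quantitative content of being a growth function, with all constants named. The fact \<open>subset\<close> is a
  Muckenhoupt-type condition of exponent \<open>r\<close>.
\<close>

locale musielak_weight =
  fixes \<phi> :: "real^'n \<Rightarrow> real \<Rightarrow> real" and p Cl Cu r A :: real
  assumes meas: "0 < t \<Longrightarrow> (\<lambda>x. \<phi> x t) \<in> borel_measurable lebesgue"
    and pos: "0 < t \<Longrightarrow> 0 < \<phi> x t"
    and mono: "0 < t \<Longrightarrow> t \<le> t' \<Longrightarrow> \<phi> x t \<le> \<phi> x t'"
    and p: "0 < p"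
    and Cl: "0 < Cl" "0 < t \<Longrightarrow> 0 < \<sigma> \<Longrightarrow> \<sigma> \<le> 1 \<Longrightarrow> \<phi> x (\<sigma> * t) \<le> Cl * \<sigma> powr p * \<phi> x t"
    and Cu: "0 < Cu" "0 < t \<Longrightarrow> 1 \<le> \<sigma> \<Longrightarrow> \<phi> x (\<sigma> * t) \<le> Cu * \<sigma> * \<phi> x t"
    and r: "1 \<le> r" and A: "0 < A"
    and fin: "0 < t \<Longrightarrow> 0 < \<rho> \<Longrightarrow> (\<integral>\<^sup>+x\<in>ball z \<rho>. ennreal (\<phi> x t) \<partial>lebesgue) < \<infinity>"
    and subset: "0 < t \<Longrightarrow> 0 < \<rho> \<Longrightarrow> E \<in> sets lebesgue \<Longrightarrow> E \<subseteq> ball z \<rho> \<Longrightarrow>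
      ennreal ((measure lebesgue E / measure lebesgue (ball z \<rho>)) powr r) * (\<integral>\<^sup>+x\<in>ball z \<rho>. ennreal (\<phi> x t) \<partial>lebesgue)
      \<le> ennreal A * (\<integral>\<^sup>+x\<in>E. ennreal (\<phi> x t) \<partial>lebesgue)"
begin

definition wt :: "real \<Rightarrow> (real^'n) set \<Rightarrow> real" where
  "wt t S = enn2real (\<integral>\<^sup>+x\<in>S. ennreal (\<phi> x t) \<partial>lebesgue)"

lemma wt_eq:
  assumes "0 < t" "0 < \<rho>" "S \<subseteq> ball z \<rho>"
  shows "(\<integral>\<^sup>+x\<in>S. ennreal (\<phi> x t) \<partial>lebesgue) = ennreal (wt t S)"
proof -
  have "(\<integral>\<^sup>+x\<in>S. ennreal (\<phi> x t) \<partial>lebesgue) < \<infinity>"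
    by (rule le_less_trans[OF nn_set_integral_mono_set[OF assms(3)] fin[OF assms(1,2)]])
  then show ?thesis by (simp add: wt_def)
qed

lemma wt_nonneg: "0 \<le> wt t S" by (simp add: wt_def)

lemma wt_pos: "0 < t \<Longrightarrow> 0 < \<rho> \<Longrightarrow> 0 < wt t (ball z \<rho>)"
  using nn_integral_ball_pos[OF meas pos, of t \<rho> z] fin[of t \<rho> z]
  by (simp add: wt_def enn2real_positive_iff)

lemma wt_mono_set:
  assumes "0 < t" "0 < \<rho>" "S \<subseteq> T" "T \<subseteq> ball z \<rho>"
  shows "wt t S \<le> wt t T"
proof -
  have "ennreal (wt t S) \<le> ennreal (wt t T)"
    using nn_set_integral_mono_set[OF assms(3)] wt_eq[OF assms(1,2,4)]
      wt_eq[OF assms(1,2) order_trans[OF assms(3,4)]] by metis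
  then show ?thesis by (simp add: wt_nonneg)
qed

lemma wt_scale_le:
  assumes c: "\<And>x. \<phi> x t' \<le> c * \<phi> x t" "0 \<le> c" and t: "0 < t" "0 < t'" "0 < \<rho>"
  shows "wt t' (ball z \<rho>) \<le> c * wt t (ball z \<rho>)"
proof -
  have [measurable]: "(\<lambda>x. \<phi> x t) \<in> borel_measurable lebesgue" by (rule meas[OF t(1)])
  have "ennreal (wt t' (ball z \<rho>)) = (\<integral>\<^sup>+x\<in>ball z \<rho>. ennreal (\<phi> x t') \<partial>lebesgue)"
    by (rule wt_eq[OF t(2,3) order_refl, symmetric])
  also have "\<dots> \<le> (\<integral>\<^sup>+x. ennreal c * (ennreal (\<phi> x t) * indicator (ball z \<rho>) x) \<partial>lebesgue)"
  proof (rule nn_integral_mono)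
    fix x
    have "ennreal (\<phi> x t') \<le> ennreal c * ennreal (\<phi> x t)"
      using c by (simp add: ennreal_leI flip: ennreal_mult')
    then show "ennreal (\<phi> x t') * indicator (ball z \<rho>) x \<le> ennreal c * (ennreal (\<phi> x t) * indicator (ball z \<rho>) x)"
      by (cases "x \<in> ball z \<rho>") auto
  qed
  also have "\<dots> = ennreal c * ennreal (wt t (ball z \<rho>))"
    by (subst nn_integral_cmult) (auto simp: wt_eq[OF t(1,3) order_refl])
  also have "\<dots> = ennreal (c * wt t (ball z \<rho>))" using c by (simp add: ennreal_mult wt_nonneg)
  finally show ?thesis using c by (simp add: wt_nonneg)
qed

lemma wt_lower:
  "0 < t \<Longrightarrow> 0 < \<sigma> \<Longrightarrow> \<sigma> \<le> 1 \<Longrightarrow> 0 < \<rho> \<Longrightarrow> wt (\<sigma> * t) (ball z \<rho>) \<le> Cl * \<sigma> powr p * wt t (ball z \<rho>)"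
  by (intro wt_scale_le Cl) (use Cl in auto)

lemma wt_upper:
  "0 < t \<Longrightarrow> 1 \<le> \<sigma> \<Longrightarrow> 0 < \<rho> \<Longrightarrow> wt (\<sigma> * t) (ball z \<rho>) \<le> Cu * \<sigma> * wt t (ball z \<rho>)"
  by (intro wt_scale_le Cu) (use Cu in auto)

lemma wt_subset:
  assumes "0 < t" "0 < \<rho>" "E \<in> sets lebesgue" "E \<subseteq> ball z \<rho>"
  shows "(measure lebesgue E / measure lebesgue (ball z \<rho>)) powr r * wt t (ball z \<rho>) \<le> A * wt t E"
proof -
  have "ennreal ((measure lebesgue E / measure lebesgue (ball z \<rho>)) powr r * wt t (ball z \<rho>)) \<le> ennreal (A * wt t E)"
    using subset[OF assms] A unfolding wt_eq[OF assms(1,2) order_refl] wt_eq[OF assms(1,2,4)]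
    by (simp add: ennreal_mult wt_nonneg)
  then show ?thesis using A by (simp add: wt_nonneg)
qed

lemma wt_growth:
  assumes t: "0 < t" and \<rho>: "0 < \<rho>" and R: "1 \<le> R"
  shows "wt t (ball z (R * \<rho>)) \<le> A * R powr (CARD('n) * r) * wt t (ball z \<rho>)"
proof -
  have sub: "ball z \<rho> \<subseteq> ball z (R * \<rho>)" using R \<rho> by (intro subset_ball) simp
  have R\<rho>: "0 < R * \<rho>" using R \<rho> by simp
  have V: "0 < unit_ball_vol (real CARD('n))" by simp
  have "measure lebesgue (ball z \<rho>) / measure lebesgue (ball z (R * \<rho>)) = 1 / R ^ CARD('n)"
    using R \<rho> V by (simp add: content_ball power_mult_distrib less_imp_neq[symmetric] del: unit_ball_vol_pos)
  also have "\<dots> = R powr (- real CARD('n))"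
    using R by (simp add: powr_minus powr_realpow divide_inverse)
  finally have "(R powr (- real CARD('n))) powr r * wt t (ball z (R * \<rho>)) \<le> A * wt t (ball z \<rho>)"
    using wt_subset[OF t R\<rho> _ sub] by simp
  then have "R powr (CARD('n) * r) * (R powr (- (CARD('n) * r)) * wt t (ball z (R * \<rho>))) \<le>
      R powr (CARD('n) * r) * (A * wt t (ball z \<rho>))"
    by (intro mult_left_mono) (auto simp: powr_powr)
  moreover have "R powr (CARD('n) * r) * R powr (- (CARD('n) * r)) = 1"
    using R by (simp flip: powr_add)
  ultimately have "1 * wt t (ball z (R * \<rho>)) \<le> R powr (CARD('n) * r) * (A * wt t (ball z \<rho>))"
    by (simp only: mult.assoc[symmetric])
  then show ?thesis by (simp add: mult_ac)
qed

abbreviation N :: "real^'n \<Rightarrow> real \<Rightarrow> real" where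
  "N z \<rho> \<equiv> chi_norm \<phi> (ball z \<rho>)"

definition admissible :: "real^'n \<Rightarrow> real \<Rightarrow> real set" where
  "admissible z \<rho> = {l. 0 < l \<and> wt (1 / l) (ball z \<rho>) \<le> 1}"

lemma N_eq: "0 < \<rho> \<Longrightarrow> N z \<rho> = Inf (admissible z \<rho>)"
proof -
  assume \<rho>: "0 < \<rho>"
  have "(\<integral>\<^sup>+x\<in>ball z \<rho>. ennreal (\<phi> x (1 / l)) \<partial>lebesgue) \<le> 1 \<longleftrightarrow> wt (1 / l) (ball z \<rho>) \<le> 1" if "0 < l" for l
    using wt_eq[of "1 / l" \<rho> "ball z \<rho>" z] that \<rho> by (simp add: wt_nonneg flip: ennreal_1)
  then have "{l. 0 < l \<and> (\<integral>\<^sup>+x\<in>ball z \<rho>. ennreal (\<phi> x (1 / l)) \<partial>lebesgue) \<le> 1} = admissible z \<rho>"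
    unfolding admissible_def by blast
  then show ?thesis by (simp add: chi_norm_def)
qed

lemma admissible_bdd_below: "bdd_below (admissible z \<rho>)"
  by (rule bdd_belowI[of _ 0]) (auto simp: admissible_def)

lemma admissible_nonempty: "0 < \<rho> \<Longrightarrow> admissible z \<rho> \<noteq> {}"
proof -
  assume \<rho>: "0 < \<rho>"
  define l where "l = max 1 ((Cl * wt 1 (ball z \<rho>)) powr (1 / p))"
  have l: "1 \<le> l" by (simp add: l_def)
  have "Cl * wt 1 (ball z \<rho>) = ((Cl * wt 1 (ball z \<rho>)) powr (1 / p)) powr p"
    using Cl p wt_pos[of 1 \<rho> z] \<rho> by (simp add: powr_powr)
  also have "\<dots> \<le> l powr p" using p by (intro powr_mono2) (auto simp: l_def)
  finally have le: "Cl * wt 1 (ball z \<rho>) \<le> l powr p" .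
  have "wt ((1 / l) * 1) (ball z \<rho>) \<le> Cl * (1 / l) powr p * wt 1 (ball z \<rho>)"
    using l \<rho> by (intro wt_lower) auto
  also have "\<dots> \<le> 1" using le l by (simp add: powr_divide mult_ac)
  finally have "l \<in> admissible z \<rho>" using l by (simp add: admissible_def)
  then show ?thesis by blast
qed

lemma N_pos: assumes \<rho>: "0 < \<rho>" shows "0 < N z \<rho>"
proof -
  define m where "m = min 1 ((wt 1 (ball z \<rho>) / Cl) powr (1 / p))"
  have m: "0 < m" using wt_pos[of 1 \<rho> z] \<rho> Cl by (simp add: m_def)
  have "m \<le> l" if l: "l \<in> admissible z \<rho>" for l
  proof (cases "1 \<le> l")
    case True then show ?thesis by (simp add: m_def)
  next
    case False
    have l0: "0 < l" "wt (1 / l) (ball z \<rho>) \<le> 1" using l by (auto simp: admissible_def)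
    have "wt (l * (1 / l)) (ball z \<rho>) \<le> Cl * l powr p * wt (1 / l) (ball z \<rho>)"
      using l0 False \<rho> by (intro wt_lower) auto
    also have "\<dots> \<le> Cl * l powr p * 1" using l0 Cl by (intro mult_left_mono) auto
    finally have "wt 1 (ball z \<rho>) / Cl \<le> l powr p"
      using l0 Cl by (simp add: pos_divide_le_eq mult_ac)
    then have "(wt 1 (ball z \<rho>) / Cl) powr (1 / p) \<le> (l powr p) powr (1 / p)"
      using p Cl by (intro powr_mono2) (auto simp: wt_nonneg)
    then show ?thesis using l0 p by (simp add: m_def powr_powr min.coboundedI2)
  qed
  then have "m \<le> N z \<rho>" unfolding N_eq[OF \<rho>] by (intro cInf_greatest admissible_nonempty[OF \<rho>])
  with m show ?thesis by linarith
qed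

text \<open>
  The integrals of \<open>\<phi>(\<cdot>, 1/N)\<close> over the ball need not equal 1 since \<open>\<phi>(x, \<cdot>)\<close> may jump, but the upper type allows only jumps by
  a bounded factor.
\<close>

lemma wt_N_upper: assumes \<rho>: "0 < \<rho>" shows "wt (1 / N z \<rho>) (ball z \<rho>) \<le> 2 * Cu"
proof -
  note N = N_pos[OF \<rho>, of z]
  have "Inf (admissible z \<rho>) < 2 * N z \<rho>" using N by (simp add: N_eq[OF \<rho>])
  then obtain l where l: "l \<in> admissible z \<rho>" "l < 2 * N z \<rho>"
    using cInf_lessD[OF admissible_nonempty[OF \<rho>]] by blast
  have Nl: "N z \<rho> \<le> l" unfolding N_eq[OF \<rho>] by (intro cInf_lower l admissible_bdd_below)
  have l0: "0 < l" "wt (1 / l) (ball z \<rho>) \<le> 1" using l by (auto simp: admissible_def)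
  have "wt ((l / N z \<rho>) * (1 / l)) (ball z \<rho>) \<le> Cu * (l / N z \<rho>) * wt (1 / l) (ball z \<rho>)"
    using l0 N Nl \<rho> by (intro wt_upper) auto
  also have "\<dots> \<le> Cu * 2 * 1"
    using l0 l N Cu by (intro mult_mono) (auto simp: pos_divide_le_eq wt_nonneg)
  finally show ?thesis using l0 by simp
qed

lemma wt_N_lower: assumes \<rho>: "0 < \<rho>" shows "1 / (2 * Cu) \<le> wt (1 / N z \<rho>) (ball z \<rho>)"
proof -
  note N = N_pos[OF \<rho>, of z]
  have "N z \<rho> / 2 \<notin> admissible z \<rho>"
  proof
    assume "N z \<rho> / 2 \<in> admissible z \<rho>"
    then have "N z \<rho> \<le> N z \<rho> / 2" by (subst (1) N_eq[OF \<rho>]) (intro cInf_lower admissible_bdd_below)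
    with N show False by simp
  qed
  then have "1 < wt (2 * (1 / N z \<rho>)) (ball z \<rho>)" using N by (simp add: admissible_def)
  also have "\<dots> \<le> Cu * 2 * wt (1 / N z \<rho>) (ball z \<rho>)"
    using N \<rho> by (intro wt_upper) auto
  finally show ?thesis using Cu by (simp add: pos_divide_le_eq mult_ac)
qed

lemma N_mono:
  assumes \<rho>: "0 < \<rho>" and sub: "ball z \<rho> \<subseteq> ball z' \<rho>'"
  shows "N z \<rho> \<le> N z' \<rho>'"
proof -
  have \<rho>': "0 < \<rho>'" using sub \<rho> by (metis ball_eq_empty centre_in_ball empty_iff not_le subsetD)
  have "admissible z' \<rho>' \<subseteq> admissible z \<rho>"
  proof
    fix l assume "l \<in> admissible z' \<rho>'"
    then have l: "0 < l" "wt (1 / l) (ball z' \<rho>') \<le> 1" by (auto simp: admissible_def)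
    then have "wt (1 / l) (ball z \<rho>) \<le> wt (1 / l) (ball z' \<rho>')"
      by (intro wt_mono_set[OF _ \<rho>' sub order_refl]) simp
    with l show "l \<in> admissible z \<rho>" by (simp add: admissible_def)
  qed
  then show ?thesis
    unfolding N_eq[OF \<rho>] N_eq[OF \<rho>'] by (intro cInf_superset_mono admissible_nonempty[OF \<rho>'] admissible_bdd_below)
qed

definition growth_const :: real where
  "growth_const = max 1 ((2 * Cl * Cu * A) powr (1 / p))"

text \<open>
  Dilating the ball by \<open>R\<close> multiplies the mass by at most \<open>R\<^bsup>nr\<^esup>\<close> (\<open>wt_growth\<close>); by the lower type this is compensated by enlarging
  \<open>N\<close> by the factor \<open>R\<^bsup>nr/p\<^esup>\<close>.
\<close>

lemma N_growth:
  assumes \<rho>: "0 < \<rho>" and R: "1 \<le> R"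
  shows "N z (R * \<rho>) \<le> growth_const * R powr (CARD('n) * r / p) * N z \<rho>"
proof -
  note N = N_pos[OF \<rho>, of z]
  have R\<rho>: "0 < R * \<rho>" using R \<rho> by simp
  define l where "l = growth_const * R powr (CARD('n) * r / p)"
  have "1 * 1 \<le> growth_const * R powr (CARD('n) * r / p)"
    using R r p by (intro mult_mono ge_one_powr_ge_zero) (auto simp: growth_const_def)
  then have l: "1 \<le> l" by (simp add: l_def)
  have "2 * Cl * Cu * A = ((2 * Cl * Cu * A) powr (1 / p)) powr p"
    using Cl Cu A p by (simp add: powr_powr)
  also have "\<dots> \<le> growth_const powr p"
    using p by (intro powr_mono2) (auto simp: growth_const_def)
  finally have "2 * Cl * Cu * A * R powr (CARD('n) * r) \<le> growth_const powr p * R powr (CARD('n) * r)"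
    by (intro mult_right_mono) auto
  also have "\<dots> = l powr p" using p by (simp add: l_def powr_mult powr_powr)
  finally have lp: "2 * Cl * Cu * A * R powr (CARD('n) * r) \<le> l powr p" .
  have "wt (1 / l * (1 / N z \<rho>)) (ball z (R * \<rho>)) \<le> Cl * (1 / l) powr p * wt (1 / N z \<rho>) (ball z (R * \<rho>))"
    using l N R\<rho> by (intro wt_lower) auto
  also have "\<dots> \<le> Cl * (1 / l) powr p * (A * R powr (CARD('n) * r) * (2 * Cu))"
    using Cl N \<rho> R A by (intro mult_left_mono order_trans[OF wt_growth] wt_N_upper) auto
  also have "\<dots> = (2 * Cl * Cu * A * R powr (CARD('n) * r)) / l powr p"
    using l by (simp add: powr_divide)
  also have "\<dots> \<le> 1" using lp l by simp
  finally have "l * N z \<rho> \<in> admissible z (R * \<rho>)" using l N by (simp add: admissible_def)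
  then show ?thesis
    unfolding N_eq[OF R\<rho>] l_def[symmetric] by (intro cInf_lower admissible_bdd_below)
qed

text \<open>
  This turns oscillation bounds in terms of \<open>N\<close> into bounds in terms of the single weight that belongs to the larger ball; upper
  type 1 is what makes the dependence on the mass linear.
\<close>

lemma N_le_wt:
  assumes \<rho>: "0 < \<rho>" and \<rho>': "0 < \<rho>'" and sub: "ball z \<rho> \<subseteq> ball z' \<rho>'"
  shows "N z \<rho> \<le> 2 * Cu\<^sup>2 * N z' \<rho>' * wt (1 / N z' \<rho>') (ball z \<rho>)"
proof -
  note N = N_pos[OF \<rho>, of z] N_pos[OF \<rho>', of z'] N_mono[OF \<rho> sub]
  have "1 / (2 * Cu) \<le> wt ((N z' \<rho>' / N z \<rho>) * (1 / N z' \<rho>')) (ball z \<rho>)"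
    using wt_N_lower[OF \<rho>, of z] N by simp
  also have "\<dots> \<le> Cu * (N z' \<rho>' / N z \<rho>) * wt (1 / N z' \<rho>') (ball z \<rho>)"
    using N \<rho> by (intro wt_upper) auto
  finally show ?thesis using N Cu by (simp add: field_simps power2_eq_square)
qed

sublocale ball_functional N growth_const "CARD('n) * r / p"
proof
  show "N z (R * \<rho>) \<le> growth_const * R powr (real CARD('n) * r / p) * N z \<rho>"
    if "0 < \<rho>" "1 \<le> R" for z \<rho> R using N_growth[OF that] by simp
qed (auto intro: N_pos N_mono)

end

section \<open>The John--Nirenberg inequality on balls\<close>

context musielak_weight
begin

lemma one_le_card: "1 \<le> real CARD('n)"
  using zero_less_card_finite[where 'a = 'n] by linarith

text \<open>
  Apply the dyadic inequality in the cube circumscribed about the ball, with the weight \<open>w = \<phi>(\<cdot>, 1/N')\<close> that belongs to a ball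
  of radius \<open>\<rho>'\<close> large enough to contain the balls circumscribed about all subcubes. Passing from \<open>w\<close> to the weight of the original ball is
  possible because \<open>N\<close> is monotone and the exponent \<open>1 - q\<close> is negative.
\<close>

lemma weighted_john_nirenberg_balls:
  assumes q: "1 < q" and dual: "dual_bound \<phi> (q - 1) Cd" and Cd: "0 < Cd"
  shows "\<exists>C>0. \<forall>K>0. \<forall>f\<in>borel_measurable lebesgue. \<forall>P :: real^'n \<Rightarrow> real \<Rightarrow> real^'n \<Rightarrow> 'b::{real_normed_field, euclidean_space}.
    (\<forall>z \<rho>. 0 < \<rho> \<longrightarrow> P z \<rho> \<in> polys_le s \<and>
      (\<integral>\<^sup>+x\<in>ball z \<rho>. ennreal (norm (f x - P z \<rho> x)) \<partial>lebesgue) \<le> ennreal (K * N z \<rho>)) \<longrightarrow>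
    (\<forall>z \<rho>. 0 < \<rho> \<longrightarrow> (\<integral>\<^sup>+x\<in>ball z \<rho>. ennreal (norm (f x - P z \<rho> x) powr q * \<phi> x (1 / N z \<rho>) powr (1 - q)) \<partial>lebesgue)
      \<le> ennreal ((C * K * N z \<rho>) powr q))"
proof -
  obtain C1 where "0 < C1" and C1: "\<And>(z::real^'n) \<rho> M R p. p \<in> (polys_le s :: (real^'n \<Rightarrow> 'b) set) \<Longrightarrow>
    0 < \<rho> \<Longrightarrow> 1 \<le> R \<Longrightarrow> 0 \<le> M \<Longrightarrow>
    (\<integral>\<^sup>+x\<in>ball z \<rho>. ennreal (norm (p x)) \<partial>lebesgue) \<le> ennreal M \<Longrightarrow>
    \<forall>x\<in>ball z (R * \<rho>). norm (p x) \<le> C1 * R ^ s / \<rho> ^ CARD('n) * M"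
    using polys_le_sup_bound[of s, where 'n = 'n and 'b = 'b] by blast
  define n where "n = real CARD('n)"
  have n: "1 \<le> n" unfolding n_def by (rule one_le_card)
  have n24: "1 \<le> 2 * n" "1 \<le> 4 * n" using n by auto
  define V where "V = unit_ball_vol n * n ^ CARD('n)"
  have V: "0 < V" using n by (simp add: V_def n_def)
  define \<kappa>1 where "\<kappa>1 = 2 * Cu\<^sup>2 * (A * (2 * n) powr (n * r))"
  define \<kappa>2 where "\<kappa>2 = growth_const * (4 * n) powr (n * r / p)"
  define \<kappa>3 where "\<kappa>3 = \<kappa>1 * \<kappa>2 * (2 * Cu) + 1"
  define A' where "A' = Cd * V powr q"
  define c where "c = min (1 / 2) ((1 / (2 * V)) powr r / A)"
  define w0 where "w0 = 1 / (A * (4 * n) powr (n * r) * (2 * Cu))"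
  define J where "J = john_nirenberg_const CARD('n) s q A' (1 / 2) (1 - c) C1"
  define B where "B = 2 powr (q - 1) * (J * (\<kappa>1 * \<kappa>2) powr q * (2 * Cu) + (C1 * \<kappa>3) powr q * (2 ^ CARD('n)) powr q * A' * w0 powr (1 - q))"
  have \<kappa>1: "0 < \<kappa>1" using Cu A n by (simp add: \<kappa>1_def)
  have "0 < growth_const" by (simp add: growth_const_def)
  then have \<kappa>2: "0 < \<kappa>2" using n by (simp add: \<kappa>2_def)
  have \<kappa>3: "0 < \<kappa>3" using \<kappa>1 \<kappa>2 Cu by (simp add: \<kappa>3_def add_pos_pos)
  have A': "0 < A'" using Cd V by (simp add: A'_def)
  have c: "0 < c" "c \<le> 1 / 2"
    unfolding c_def using V A by (simp, intro min.cobounded1)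
  have w0: "0 < w0" using A n Cu by (simp add: w0_def)
  have "(1 - c) powr (1 / q) < 1 powr (1 / q)" using c q by (intro powr_less_mono2) auto
  then have J: "0 \<le> J" unfolding J_def john_nirenberg_const_def using A' q by simp
  have B: "0 < B"
    unfolding B_def using J \<kappa>1 \<kappa>2 \<kappa>3 Cu A' w0 \<open>0 < C1\<close>
    by (intro mult_pos_pos add_nonneg_pos mult_nonneg_nonneg) auto
  show ?thesis
  proof (intro exI[of _ "B powr (1 / q)"] conjI allI ballI impI)
    show "0 < B powr (1 / q)" using B by simp
    fix K :: real and f :: "real^'n \<Rightarrow> 'b" and P :: "real^'n \<Rightarrow> real \<Rightarrow> real^'n \<Rightarrow> 'b" and z :: "real^'n" and \<rho> :: real
    assume K: "0 < K" and f [measurable]: "f \<in> borel_measurable lebesgue" and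
      PP: "\<forall>z \<rho>. 0 < \<rho> \<longrightarrow> P z \<rho> \<in> polys_le s \<and>
        (\<integral>\<^sup>+x\<in>ball z \<rho>. ennreal (norm (f x - P z \<rho> x)) \<partial>lebesgue) \<le> ennreal (K * N z \<rho>)" and \<rho>: "0 < \<rho>"
    have P: "\<And>z \<rho>. 0 < \<rho> \<Longrightarrow> P z \<rho> \<in> polys_le s" and osc: "\<And>z \<rho>. 0 < \<rho> \<Longrightarrow>
        (\<integral>\<^sup>+x\<in>ball z \<rho>. ennreal (norm (f x - P z \<rho> x)) \<partial>lebesgue) \<le> ennreal (K * N z \<rho>)"
      using PP by blast+
    interpret dyadic_grid "\<chi> i. z $ i - \<rho>" "2 * \<rho>" by unfold_locales (use \<rho> in simp)
    have side0: "side 0 = 2 * \<rho>" by (simp add: side_def)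
    have idx0: "idx 0 z i = 0" for i using \<rho> by (simp add: idx_def)
    have center0: "center 0 z = z"
      by (simp add: center_def low_def idx0 side0 vec_eq_iff)
    have ball_Q0: "ball z \<rho> \<subseteq> cube 0 z"
      using ball_subset_cube[of 0 z] by (simp add: center0 side0)
    define \<rho>' where "\<rho>' = 4 * n * \<rho>"
    have \<rho>': "0 < \<rho>'" using \<rho> n by (simp add: \<rho>'_def)
    define rad where "rad k = n * side k" for k
    have rad: "0 < rad k" for k using side_pos[of k] n by (simp add: rad_def)
    have cube_ball: "cube k x \<subseteq> ball (center k x) (rad k)" for k x
      using cube_subset_ball[of k x] by (simp add: rad_def n_def)
    have ball_big: "ball (center k x) (rad k) \<subseteq> ball z \<rho>'" if x: "x \<in> cube 0 z" for k x
    proof -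
      have "center k x \<in> cube k x" using ball_subset_cube[of k x] side_pos[of k] by auto
      also have "cube k x \<subseteq> cube 0 z" using cube_antimono[of 0 k x] cube_eq[OF x] by simp
      also have "cube 0 z \<subseteq> ball z (n * (2 * \<rho>))" using cube_ball[of 0 z] by (simp add: center0 rad_def side0)
      finally have "dist z (center k x) < 2 * n * \<rho>" by simp
      moreover have "side k \<le> 2 * \<rho>"
        unfolding side_def using \<rho> by (simp add: divide_le_eq mult_le_cancel_left1)
      then have "rad k \<le> n * (2 * \<rho>)"
        unfolding rad_def using n by (intro mult_left_mono) auto
      ultimately show ?thesis
        using rad[of k] by (subst ball_subset_ball_iff) (auto simp: \<rho>'_def dist_commute)
    qed
    have cube_big: "cube k x \<subseteq> ball z \<rho>'" if "x \<in> cube 0 z" for k x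
      using cube_ball ball_big[OF that] by blast
    define N' where "N' = N z \<rho>'"
    define t where "t = 1 / N'"
    have N': "0 < N'" unfolding N'_def by (rule N_pos[OF \<rho>'])
    have N0: "0 < N z \<rho>" by (rule N_pos[OF \<rho>])
    have t: "0 < t" using N' by (simp add: t_def)
    have NN': "N z \<rho> \<le> N'"
      unfolding N'_def using n \<rho> by (intro N_mono[OF \<rho>] subset_ball) (simp add: \<rho>'_def mult_le_cancel_right1)
    have N'_le: "N' \<le> \<kappa>2 * N z \<rho>"
      unfolding N'_def \<rho>'_def \<kappa>2_def using N_growth[OF \<rho> n24(2), of z] by (simp only: n_def)
    define w where "w x = \<phi> x t" for x
    have w_meas [measurable]: "w \<in> borel_measurable lebesgue" unfolding w_def by (rule meas[OF t])
    have w_pos: "0 < w x" for x unfolding w_def by (rule pos[OF t])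
    have W_cube: "(\<integral>\<^sup>+y\<in>S. ennreal (w y) \<partial>lebesgue) = ennreal (wt t S)" if "S \<subseteq> ball z \<rho>'" for S
      unfolding w_def by (rule wt_eq[OF t \<rho>' that])
    have W_big: "wt t (ball z \<rho>') \<le> 2 * Cu" unfolding t_def N'_def by (rule wt_N_upper[OF \<rho>'])
    have W_Q0: "wt t (cube 0 z) \<le> 2 * Cu"
      by (rule order_trans[OF wt_mono_set[OF t \<rho>' cube_big order_refl] W_big]) simp
    have W_Q0_lower: "w0 \<le> wt t (cube 0 z)"
    proof -
      have "1 / (2 * Cu) \<le> wt t (ball z \<rho>')" unfolding t_def N'_def by (rule wt_N_lower[OF \<rho>'])
      also have "\<dots> \<le> A * (4 * n) powr (n * r) * wt t (ball z \<rho>)"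
        unfolding \<rho>'_def using wt_growth[OF t \<rho> n24(2), of z] by (simp only: n_def)
      also have "\<dots> \<le> A * (4 * n) powr (n * r) * wt t (cube 0 z)"
        using A by (intro mult_left_mono wt_mono_set[OF t \<rho>' ball_Q0 cube_big]) auto
      finally show ?thesis using A n Cu by (simp add: w0_def divide_le_eq mult_ac)
    qed
    define good where "good Q = (\<lambda>(k, x). x \<in> cube 0 z \<and> cube k x = Q)" for Q
    \<comment> \<open>A cube as a set may arise from several points \<open>x\<close>, so a representative has to be chosen before
      the circumscribed ball can be formed.\<close>
    define PQ where "PQ Q = (case SOME kx. good Q kx of (k, x) \<Rightarrow> P (center k x) (rad k))" for Q
    have PQ: "\<exists>k' x'. x' \<in> cube 0 z \<and> cube k' x' = cube k x \<and> PQ (cube k x) = P (center k' x') (rad k')"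
      if "x \<in> cube 0 z" for k x
    proof -
      have "good (cube k x) (k, x)" using that by (simp add: good_def)
      then have "good (cube k x) (SOME kx. good (cube k x) kx)" by (rule someI)
      then show ?thesis unfolding PQ_def good_def by (auto split: prod.splits)
    qed
    define K' where "K' = \<kappa>1 * K * N'"
    have K': "0 < K'" using \<kappa>1 K N' by (simp add: K'_def)
    have PQ_osc: "(\<integral>\<^sup>+y\<in>cube k x. ennreal (norm (f y - PQ (cube k x) y)) \<partial>lebesgue) \<le> ennreal (K' * wt t (cube k x))"
      if x: "x \<in> cube 0 z" for k x
    proof -
      obtain k' x' where x': "x' \<in> cube 0 z" "cube k' x' = cube k x" "PQ (cube k x) = P (center k' x') (rad k')"
        using PQ[OF x] by blast
      let ?b = "ball (center k' x') (rad k')"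
      have "(\<integral>\<^sup>+y\<in>cube k x. ennreal (norm (f y - PQ (cube k x) y)) \<partial>lebesgue) \<le>
          (\<integral>\<^sup>+y\<in>?b. ennreal (norm (f y - P (center k' x') (rad k') y)) \<partial>lebesgue)"
        unfolding x'(3) using cube_ball[of k' x'] x'(2) by (intro nn_set_integral_mono_set) simp
      also have "\<dots> \<le> ennreal (K * N (center k' x') (rad k'))" by (rule osc[OF rad])
      also have "\<dots> \<le> ennreal (K * (2 * Cu\<^sup>2 * N' * wt t ?b))"
        unfolding t_def N'_def using K
        by (intro ennreal_leI mult_left_mono N_le_wt rad \<rho>' ball_big x') auto
      also have "\<dots> \<le> ennreal (K' * wt t (cube k x))"
      proof (rule ennreal_leI)
        have sub: "ball (center k' x') (side k' / 2) \<subseteq> cube k x" using ball_subset_cube[of k' x'] x'(2) by simp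
        have half_pos: "0 < side k' / 2" using side_pos[of k'] by simp
        have "?b = ball (center k' x') ((2 * n) * (side k' / 2))" by (simp add: rad_def)
        then have "wt t ?b \<le> A * (2 * n) powr (n * r) * wt t (ball (center k' x') (side k' / 2))"
          using wt_growth[OF t half_pos n24(1), of "center k' x'"] by (simp only: n_def)
        also have "\<dots> \<le> A * (2 * n) powr (n * r) * wt t (cube k x)"
          using A by (intro mult_left_mono wt_mono_set[OF t \<rho>' sub cube_big[OF x]]) auto
        finally have "K * (2 * Cu\<^sup>2 * N' * wt t ?b) \<le> K * (2 * Cu\<^sup>2 * N' * (A * (2 * n) powr (n * r) * wt t (cube k x)))"
          using K N' by (intro mult_left_mono) auto
        then show "K * (2 * Cu\<^sup>2 * N' * wt t ?b) \<le> K' * wt t (cube k x)"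
          by (simp add: K'_def \<kappa>1_def mult_ac)
      qed
      finally show ?thesis .
    qed
    have PQ_poly: "PQ (cube k x) \<in> polys_le s" if "x \<in> cube 0 z" for k x
      using PQ[OF that, of k] P[OF rad] by auto
    have ball_vol: "measure lebesgue (ball (center k x) (rad k)) = V * side k ^ CARD('n)" for k x
      using rad[of k] by (simp add: content_ball V_def rad_def n_def power_mult_distrib)
    have dualQ: "ennreal ((wt t (cube k x) / side k ^ CARD('n)) powr q) * (\<integral>\<^sup>+y\<in>cube k x. ennreal (w y powr (1 - q)) \<partial>lebesgue)
        \<le> ennreal A' * ennreal (wt t (cube k x))" if x: "x \<in> cube 0 z" for k x
    proof -
      let ?b = "ball (center k x) (rad k)" and ?S = "\<lambda>S. \<integral>\<^sup>+y\<in>S. ennreal (w y powr (1 - q)) \<partial>lebesgue"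
      define \<mu> where "\<mu> = V * side k ^ CARD('n)"
      have \<mu>: "0 < \<mu>" using V side_pos[of k] by (simp add: \<mu>_def)
      obtain W where W: "0 < W" "(\<integral>\<^sup>+x\<in>?b. ennreal (\<phi> x t) \<partial>lebesgue) = ennreal W"
        "(\<integral>\<^sup>+y\<in>?b. ennreal ((\<phi> y t * \<mu> / W) powr (- (q - 1))) \<partial>lebesgue) \<le> ennreal (Cd * \<mu>)"
        using dual t rad[of k] unfolding dual_bound_def ball_vol[of k x, symmetric] \<mu>_def by blast
      have "wt t ?b = W" using W(1,2) by (simp add: wt_def)
      then have QW: "wt t (cube k x) \<le> W" using wt_mono_set[OF t rad cube_ball order_refl, of k x] by simp
      have eq: "(\<phi> y t * \<mu> / W) powr (- (q - 1)) = (W / \<mu>) powr (q - 1) * w y powr (1 - q)" for y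
      proof -
        have "(\<phi> y t * \<mu> / W) powr (- (q - 1)) = (w y / (W / \<mu>)) powr (1 - q)" by (simp add: w_def)
        also have "\<dots> = w y powr (1 - q) / (W / \<mu>) powr (1 - q)" by (rule powr_divide)
        also have "\<dots> = (W / \<mu>) powr (q - 1) * w y powr (1 - q)"
          using W(1) \<mu> powr_minus_divide[of "W / \<mu>" "q - 1"] by simp
        finally show ?thesis .
      qed
      have S: "ennreal ((W / \<mu>) powr (q - 1)) * ?S (cube k x) \<le> ennreal (Cd * \<mu>)"
      proof -
        have "ennreal ((W / \<mu>) powr (q - 1)) * ?S (cube k x) \<le> ennreal ((W / \<mu>) powr (q - 1)) * ?S ?b"
          by (intro mult_left_mono nn_set_integral_mono_set cube_ball) simp
        also have "\<dots> = (\<integral>\<^sup>+y\<in>?b. ennreal ((\<phi> y t * \<mu> / W) powr (- (q - 1))) \<partial>lebesgue)"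
          unfolding eq by (subst nn_integral_cmult[symmetric]) (auto simp: ennreal_mult mult.assoc)
        finally show ?thesis using W(3) by simp
      qed
      let ?l = "side k ^ CARD('n)" and ?w = "wt t (cube k x)"
      have l: "0 < ?l" using side_pos[of k] by simp
      have "(?w / ?l) powr q \<le> (?w / ?l) * V powr (q - 1) * (W / \<mu>) powr (q - 1)"
      proof (cases "?w = 0")
        case False
        then have wpos: "0 < ?w" using wt_nonneg[of t "cube k x"] by simp
        have "(?w / ?l) powr q = (?w / ?l) powr (1 + (q - 1))" by simp
        also have "\<dots> = (?w / ?l) * (?w / ?l) powr (q - 1)"
          using wpos l by (subst powr_add) simp
        also have "\<dots> \<le> (?w / ?l) * (V * (W / \<mu>)) powr (q - 1)"
        proof (intro mult_left_mono powr_mono2)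
          have "V * (W / \<mu>) = W / ?l" using V l by (simp add: \<mu>_def)
          then show "?w / ?l \<le> V * (W / \<mu>)" using QW l by (simp add: divide_right_mono)
        qed (use wpos l q in auto)
        also have "\<dots> = (?w / ?l) * V powr (q - 1) * (W / \<mu>) powr (q - 1)"
          by (simp only: powr_mult mult.assoc)
        finally show ?thesis .
      qed (use W \<mu> l in simp)
      then have "ennreal ((?w / ?l) powr q) * ?S (cube k x) \<le>
          ennreal ((?w / ?l) * V powr (q - 1) * (W / \<mu>) powr (q - 1)) * ?S (cube k x)"
        by (intro mult_right_mono ennreal_leI) auto
      also have "\<dots> = ennreal ((?w / ?l) * V powr (q - 1)) * (ennreal ((W / \<mu>) powr (q - 1)) * ?S (cube k x))"
        using l wt_nonneg[of t "cube k x"] by (subst ennreal_mult) (auto simp: mult.assoc)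
      also have "\<dots> \<le> ennreal ((?w / ?l) * V powr (q - 1)) * ennreal (Cd * \<mu>)"
        by (intro mult_left_mono S) auto
      also have "\<dots> = ennreal ((?w / ?l) * V powr (q - 1) * (Cd * \<mu>))"
        using l wt_nonneg[of t "cube k x"] Cd \<mu> by (intro ennreal_mult[symmetric]) auto
      also have "(?w / ?l) * V powr (q - 1) * (Cd * \<mu>) = A' * ?w"
        using V side_pos[of k] by (simp add: \<mu>_def A'_def powr_diff)
      also have "ennreal (A' * ?w) = ennreal A' * ennreal ?w"
        using A' by (intro ennreal_mult) (auto simp: wt_nonneg)
      finally show ?thesis .
    qed
    have A_inf: "(\<integral>\<^sup>+y\<in>E. ennreal (w y) \<partial>lebesgue) \<le> ennreal (1 - c) * ennreal (wt t (cube k x))"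
      if x: "x \<in> cube 0 z" and E [measurable]: "E \<in> sets lebesgue" and EQ: "E \<subseteq> cube k x"
        and small: "emeasure lebesgue E \<le> ennreal (1 / 2) * emeasure lebesgue (cube k x)" for E k x
    proof -
      let ?Q = "cube k x" and ?b = "ball (center k x) (rad k)" and ?l = "side k ^ CARD('n)"
      have l: "0 < ?l" using side_pos[of k] by simp
      have Qlm: "?Q \<in> lmeasurable" by (simp add: fmeasurable_def emeasure_cube)
      have Elm: "E \<in> lmeasurable" using Qlm EQ E by (rule fmeasurableI2)
      have mQ: "measure lebesgue ?Q = ?l" using emeasure_cube[of k x] l by (simp add: measure_def)
      have "measure lebesgue E \<le> 1 / 2 * ?l"
      proof -
        have "ennreal (measure lebesgue E) \<le> ennreal (1 / 2) * ennreal ?l"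
          using small unfolding emeasure_cube emeasure_eq_measure2[OF Elm] .
        also have "\<dots> = ennreal (1 / 2 * ?l)"
          by (rule ennreal_mult[symmetric]) (use l in auto)
        finally show ?thesis using l by (subst (asm) ennreal_le_iff) auto
      qed
      moreover have "measure lebesgue (?Q - E) = ?l - measure lebesgue E"
        using measurable_measure_Diff[OF Qlm E EQ] mQ by simp
      ultimately have half: "?l / 2 \<le> measure lebesgue (?Q - E)" by simp
      have sub: "?Q - E \<subseteq> ?b" using cube_ball[of k x] by blast
      have "(1 / (2 * V)) powr r * wt t ?Q \<le> (measure lebesgue (?Q - E) / measure lebesgue ?b) powr r * wt t ?b"
      proof (intro mult_mono powr_mono2)
        show "1 / (2 * V) \<le> measure lebesgue (?Q - E) / measure lebesgue ?b"
          using half V l unfolding ball_vol by (simp add: field_simps)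
        show "wt t ?Q \<le> wt t ?b" by (rule wt_mono_set[OF t rad cube_ball order_refl])
      qed (use V r in \<open>auto simp: wt_nonneg\<close>)
      also have "\<dots> \<le> A * wt t (?Q - E)" by (rule wt_subset[OF t rad _ sub]) simp
      finally have "(1 / (2 * V)) powr r / A * wt t ?Q \<le> wt t (?Q - E)" using A by (simp add: pos_divide_le_eq mult_ac)
      moreover have "c * wt t ?Q \<le> (1 / (2 * V)) powr r / A * wt t ?Q"
        by (intro mult_right_mono) (auto simp: c_def wt_nonneg)
      ultimately have low: "c * wt t ?Q \<le> wt t (?Q - E)" by simp
      have "ennreal (wt t ?Q) = ennreal (wt t (?Q - E)) + ennreal (wt t E)"
      proof -
        have "ennreal (wt t ?Q) = (\<integral>\<^sup>+y. ennreal (w y) * indicator (?Q - E) y + ennreal (w y) * indicator E y \<partial>lebesgue)"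
          unfolding W_cube[OF cube_big[OF x], symmetric] using EQ
          by (intro nn_integral_cong) (auto simp: indicator_def)
        also have "\<dots> = (\<integral>\<^sup>+y\<in>?Q - E. ennreal (w y) \<partial>lebesgue) + (\<integral>\<^sup>+y\<in>E. ennreal (w y) \<partial>lebesgue)"
          by (intro nn_integral_add) auto
        also have "\<dots> = ennreal (wt t (?Q - E)) + ennreal (wt t E)"
          using cube_big[OF x, of k] EQ by (subst (1 2) W_cube) auto
        finally show ?thesis .
      qed
      then have "wt t ?Q = wt t (?Q - E) + wt t E"
        by (simp add: wt_nonneg flip: ennreal_plus)
      with low have "wt t E \<le> (1 - c) * wt t ?Q" by (simp add: algebra_simps)
      then have "ennreal (wt t E) \<le> ennreal ((1 - c) * wt t ?Q)" by (rule ennreal_leI)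
      also have "\<dots> = ennreal (1 - c) * ennreal (wt t ?Q)" using c by (intro ennreal_mult) (auto simp: wt_nonneg)
      finally show ?thesis using cube_big[OF x, of k] EQ by (subst W_cube) auto
    qed
    have z0: "z \<in> cube 0 z" by simp
    interpret WO: weighted_oscillation "\<chi> i. z $ i - \<rho>" "2 * \<rho>" w f PQ z K' q A' "1 / 2" "1 - c" C1 s
    proof unfold_locales
      show "(\<integral>\<^sup>+x\<in>cube 0 z. ennreal (w x) \<partial>lebesgue) < \<infinity>"
        by (subst W_cube[OF cube_big]) auto
      show "(\<integral>\<^sup>+y\<in>cube k x. ennreal (norm (f y - PQ (cube k x) y)) \<partial>lebesgue) \<le>
          ennreal K' * (\<integral>\<^sup>+y\<in>cube k x. ennreal (w y) \<partial>lebesgue)" if "x \<in> cube 0 z" for k x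
        using PQ_osc[OF that, of k] K' by (subst W_cube[OF cube_big[OF that]]) (simp add: ennreal_mult wt_nonneg)
      show "ennreal ((enn2real (\<integral>\<^sup>+y\<in>cube k x. ennreal (w y) \<partial>lebesgue) / side k ^ CARD('n)) powr q) *
          (\<integral>\<^sup>+y\<in>cube k x. ennreal (w y powr (1 - q)) \<partial>lebesgue) \<le>
          ennreal A' * (\<integral>\<^sup>+y\<in>cube k x. ennreal (w y) \<partial>lebesgue)" if "x \<in> cube 0 z" for k x
        using dualQ[OF that, of k] by (subst (1 2) W_cube[OF cube_big[OF that]]) (simp add: wt_nonneg)
      show "(\<integral>\<^sup>+y\<in>E. ennreal (w y) \<partial>lebesgue) \<le> ennreal (1 - c) * (\<integral>\<^sup>+y\<in>cube k x. ennreal (w y) \<partial>lebesgue)"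
        if "x \<in> cube 0 z" "E \<in> sets lebesgue" "E \<subseteq> cube k x"
          "emeasure lebesgue E \<le> ennreal (1 / 2) * emeasure lebesgue (cube k x)" for k x E
        using A_inf[OF that] by (subst W_cube[OF cube_big[OF that(1), of k]])
    qed (use w_meas w_pos f q K' A' c \<open>0 < C1\<close> PQ_poly C1 in auto)
    define P1 where "P1 = PQ (cube 0 z)"
    define P0 where "P0 = P z \<rho>"
    have P1: "P1 \<in> polys_le s" unfolding P1_def by (rule PQ_poly[OF z0])
    have P0: "P0 \<in> polys_le s" unfolding P0_def by (rule P[OF \<rho>])
    have [measurable]: "P1 \<in> borel_measurable lebesgue" "P0 \<in> borel_measurable lebesgue"
      using P1 P0 by (auto intro: borel_measurable_polys_le)
    let ?\<sigma> = "\<lambda>y. w y powr (1 - q)"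
    have main: "(\<integral>\<^sup>+y\<in>ball z \<rho>. ennreal (norm (f y - P1 y) powr q * ?\<sigma> y) \<partial>lebesgue) \<le>
        ennreal (J * (\<kappa>1 * \<kappa>2) powr q * (2 * Cu) * (K * N z \<rho>) powr q)"
    proof -
      have "(\<integral>\<^sup>+y\<in>ball z \<rho>. ennreal (norm (f y - P1 y) powr q * ?\<sigma> y) \<partial>lebesgue) \<le>
          (\<integral>\<^sup>+y\<in>cube 0 z. ennreal (norm (f y - P1 y) powr q * ?\<sigma> y) \<partial>lebesgue)"
        by (rule nn_set_integral_mono_set[OF ball_Q0])
      also have "\<dots> \<le> ennreal (J * K' powr q) * ennreal (wt t (cube 0 z))"
        using WO.john_nirenberg[OF z0, of 0] unfolding W_cube[OF cube_big[OF z0]] P1_def J_def .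
      also have "\<dots> = ennreal (J * K' powr q * wt t (cube 0 z))"
        using J by (intro ennreal_mult[symmetric]) (auto simp: wt_nonneg)
      also have "\<dots> \<le> ennreal (J * (\<kappa>1 * \<kappa>2 * (K * N z \<rho>)) powr q * (2 * Cu))"
      proof (intro ennreal_leI mult_mono W_Q0 mult_left_mono powr_mono2)
        have "K' \<le> \<kappa>1 * K * (\<kappa>2 * N z \<rho>)"
          unfolding K'_def using \<kappa>1 K N'_le by (intro mult_left_mono) auto
        then show "K' \<le> \<kappa>1 * \<kappa>2 * (K * N z \<rho>)" by (simp add: mult_ac)
      qed (use J K' q in \<open>auto simp: wt_nonneg\<close>)
      also have "J * (\<kappa>1 * \<kappa>2 * (K * N z \<rho>)) powr q * (2 * Cu) = J * (\<kappa>1 * \<kappa>2) powr q * (2 * Cu) * (K * N z \<rho>) powr q"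
        by (simp add: powr_mult)
      finally show ?thesis .
    qed
    \<comment> \<open>The polynomial of the circumscribed cube may be replaced by that of the ball.\<close>
    have close: "norm (P1 x - P0 x) \<le> C1 * \<kappa>3 * (K * N z \<rho>) / \<rho> ^ CARD('n)" if x: "x \<in> ball z \<rho>" for x
    proof -
      have a: "(\<integral>\<^sup>+y\<in>ball z \<rho>. ennreal (norm (f y - P1 y)) \<partial>lebesgue) \<le> ennreal (\<kappa>1 * \<kappa>2 * (2 * Cu) * (K * N z \<rho>))"
      proof -
        have "(\<integral>\<^sup>+y\<in>ball z \<rho>. ennreal (norm (f y - P1 y)) \<partial>lebesgue) \<le> ennreal (K' * wt t (cube 0 z))"
          unfolding P1_def by (rule order_trans[OF nn_set_integral_mono_set[OF ball_Q0] PQ_osc[OF z0]])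
        also have "\<dots> \<le> ennreal ((\<kappa>1 * K * (\<kappa>2 * N z \<rho>)) * (2 * Cu))"
          unfolding K'_def using \<kappa>1 \<kappa>2 K N0 N' N'_le
          by (intro ennreal_leI mult_mono W_Q0 mult_left_mono) (auto simp: wt_nonneg)
        finally show ?thesis by (simp add: mult_ac)
      qed
      have b: "(\<integral>\<^sup>+y\<in>ball z \<rho>. ennreal (norm (f y - P0 y)) \<partial>lebesgue) \<le> ennreal (K * N z \<rho>)"
        unfolding P0_def by (rule osc[OF \<rho>])
      have "(\<integral>\<^sup>+y\<in>ball z \<rho>. ennreal (norm (P1 y - P0 y)) \<partial>lebesgue) \<le>
          ennreal (\<kappa>1 * \<kappa>2 * (2 * Cu) * (K * N z \<rho>) + K * N z \<rho>)"
        using \<kappa>1 \<kappa>2 Cu K N0 by (intro nn_set_integral_norm_diff_le[OF _ _ _ _ a b]) auto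
      also have "\<kappa>1 * \<kappa>2 * (2 * Cu) * (K * N z \<rho>) + K * N z \<rho> = \<kappa>3 * (K * N z \<rho>)"
        by (simp add: \<kappa>3_def algebra_simps)
      finally have "(\<integral>\<^sup>+y\<in>ball z \<rho>. ennreal (norm (P1 y - P0 y)) \<partial>lebesgue) \<le> ennreal (\<kappa>3 * (K * N z \<rho>))" .
      from C1[OF polys_le_diff[OF P1 P0] \<rho> order_refl _ this]
      have "norm (P1 x - P0 x) \<le> C1 * 1 ^ s / \<rho> ^ CARD('n) * (\<kappa>3 * (K * N z \<rho>))"
        using x \<kappa>3 K N0 by simp
      then show ?thesis by (simp add: mult_ac)
    qed
    have rest: "ennreal ((C1 * \<kappa>3 * (K * N z \<rho>) / \<rho> ^ CARD('n)) powr q) * (\<integral>\<^sup>+y\<in>ball z \<rho>. ennreal (?\<sigma> y) \<partial>lebesgue)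
        \<le> ennreal ((C1 * \<kappa>3) powr q * (2 ^ CARD('n)) powr q * A' * w0 powr (1 - q) * (K * N z \<rho>) powr q)"
    proof -
      let ?W = "wt t (cube 0 z)" and ?k = "C1 * \<kappa>3 * (K * N z \<rho>)" and ?l = "(2 * \<rho>) ^ CARD('n)"
      have W: "0 < ?W" using w0 W_Q0_lower by linarith
      have l: "0 < ?l" using \<rho> by simp
      have k: "0 \<le> ?k" using \<open>0 < C1\<close> \<kappa>3 K N0 by simp
      let ?m = "(?k * 2 ^ CARD('n) / ?W) powr q"
      have "?k / \<rho> ^ CARD('n) = (?k * 2 ^ CARD('n) / ?W) * (?W / ?l)"
        using W \<rho> by (simp add: power_mult_distrib)
      then have "(?k / \<rho> ^ CARD('n)) powr q = ?m * (?W / ?l) powr q"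
        by (simp only: powr_mult)
      then have "ennreal ((?k / \<rho> ^ CARD('n)) powr q) * (\<integral>\<^sup>+y\<in>ball z \<rho>. ennreal (?\<sigma> y) \<partial>lebesgue) \<le>
          ennreal ?m * (ennreal ((?W / ?l) powr q) * (\<integral>\<^sup>+y\<in>cube 0 z. ennreal (?\<sigma> y) \<partial>lebesgue))"
        using nn_set_integral_mono_set[OF ball_Q0, of lebesgue "\<lambda>y. ennreal (?\<sigma> y)"]
        by (simp add: ennreal_mult mult.assoc mult_left_mono)
      also have "\<dots> \<le> ennreal ?m * (ennreal A' * ennreal ?W)"
        using dualQ[OF z0, of 0] unfolding side0 by (intro mult_left_mono) auto
      also have "\<dots> = ennreal (?m * (A' * ?W))"
        using A' W by (simp add: ennreal_mult)
      also have "\<dots> \<le> ennreal ((C1 * \<kappa>3) powr q * (2 ^ CARD('n)) powr q * A' * w0 powr (1 - q) * (K * N z \<rho>) powr q)"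
      proof (rule ennreal_leI)
        have "?m = (?k * 2 ^ CARD('n)) powr q * ?W powr (- q)"
          unfolding powr_divide powr_minus by (simp only: divide_inverse)
        then have "?m * (A' * ?W) = (?k * 2 ^ CARD('n)) powr q * A' * ?W powr (1 - q)"
          using W powr_add[of ?W "- q" 1] by (simp add: mult_ac)
        also have "\<dots> \<le> (?k * 2 ^ CARD('n)) powr q * A' * w0 powr (1 - q)"
          using A' w0 q W_Q0_lower by (intro mult_left_mono powr_mono2') auto
        also have "(?k * 2 ^ CARD('n)) powr q = (C1 * \<kappa>3) powr q * (K * N z \<rho>) powr q * (2 ^ CARD('n)) powr q"
          by (simp only: powr_mult)
        finally show "?m * (A' * ?W) \<le> (C1 * \<kappa>3) powr q * (2 ^ CARD('n)) powr q * A' * w0 powr (1 - q) * (K * N z \<rho>) powr q"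
          by (simp add: mult_ac)
      qed
      finally show ?thesis .
    qed
    let ?h = "2 powr (q - 1)"
    have "(\<integral>\<^sup>+x\<in>ball z \<rho>. ennreal (norm (f x - P z \<rho> x) powr q * \<phi> x (1 / N z \<rho>) powr (1 - q)) \<partial>lebesgue) \<le>
      (\<integral>\<^sup>+x. ennreal ?h * (ennreal (norm (f x - P1 x) powr q * ?\<sigma> x) * indicator (ball z \<rho>) x) +
        ennreal ?h * (ennreal ((C1 * \<kappa>3 * (K * N z \<rho>) / \<rho> ^ CARD('n)) powr q) * (ennreal (?\<sigma> x) * indicator (ball z \<rho>) x)) \<partial>lebesgue)"
    proof (rule nn_integral_mono)
      fix x
      show "ennreal (norm (f x - P z \<rho> x) powr q * \<phi> x (1 / N z \<rho>) powr (1 - q)) * indicator (ball z \<rho>) x \<le>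
        ennreal ?h * (ennreal (norm (f x - P1 x) powr q * ?\<sigma> x) * indicator (ball z \<rho>) x) +
        ennreal ?h * (ennreal ((C1 * \<kappa>3 * (K * N z \<rho>) / \<rho> ^ CARD('n)) powr q) * (ennreal (?\<sigma> x) * indicator (ball z \<rho>) x))"
      proof (cases "x \<in> ball z \<rho>")
        case True
        let ?e = "C1 * \<kappa>3 * (K * N z \<rho>) / \<rho> ^ CARD('n)"
        have e: "0 \<le> ?e" using \<open>0 < C1\<close> \<kappa>3 K N0 \<rho> by simp
        have "norm (f x - P0 x) \<le> norm (f x - P1 x) + norm (P1 x - P0 x)"
          using norm_triangle_ineq[of "f x - P1 x" "P1 x - P0 x"] by simp
        then have "norm (f x - P0 x) \<le> norm (f x - P1 x) + ?e" using close[OF True] by linarith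
        then have "norm (f x - P0 x) powr q \<le> (norm (f x - P1 x) + ?e) powr q"
          using q by (intro powr_mono2) auto
        also have "\<dots> \<le> (1 / 2) powr (1 - q) * norm (f x - P1 x) powr q + (1 - 1 / 2) powr (1 - q) * ?e powr q"
          using q e by (intro powr_add_le_weighted) auto
        also have "\<dots> = ?h * norm (f x - P1 x) powr q + ?h * ?e powr q"
        proof -
          have "(1 / 2 :: real) powr (1 - q) = ?h" using powr_minus_divide[of "2::real" "1 - q"] by (simp add: powr_divide)
          then show ?thesis by simp
        qed
        finally have 1: "norm (f x - P0 x) powr q \<le> ?h * norm (f x - P1 x) powr q + ?h * ?e powr q" .
        have 2: "\<phi> x (1 / N z \<rho>) powr (1 - q) \<le> ?\<sigma> x"
        proof (rule powr_mono2')
          show "w x \<le> \<phi> x (1 / N z \<rho>)"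
            unfolding w_def using N0 NN' N' t by (intro mono) (auto simp: t_def frac_le)
        qed (use q w_pos in auto)
        have "norm (f x - P0 x) powr q * \<phi> x (1 / N z \<rho>) powr (1 - q) \<le>
            (?h * norm (f x - P1 x) powr q + ?h * ?e powr q) * ?\<sigma> x"
          using 1 2 by (intro mult_mono) auto
        also have "\<dots> = ?h * (norm (f x - P1 x) powr q * ?\<sigma> x) + ?h * (?e powr q * ?\<sigma> x)"
          by (simp only: distrib_right mult.assoc)
        finally have "ennreal (norm (f x - P0 x) powr q * \<phi> x (1 / N z \<rho>) powr (1 - q)) \<le>
            ennreal (?h * (norm (f x - P1 x) powr q * ?\<sigma> x) + ?h * (?e powr q * ?\<sigma> x))"
          by (rule ennreal_leI)
        also have "\<dots> = ennreal ?h * ennreal (norm (f x - P1 x) powr q * ?\<sigma> x) + ennreal ?h * (ennreal (?e powr q) * ennreal (?\<sigma> x))"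
          by (simp only: ennreal_plus ennreal_mult powr_ge_zero mult_nonneg_nonneg)
        finally show ?thesis using True by (simp add: P0_def)
      qed simp
    qed
    also have "\<dots> = ennreal ?h * (\<integral>\<^sup>+x\<in>ball z \<rho>. ennreal (norm (f x - P1 x) powr q * ?\<sigma> x) \<partial>lebesgue) +
        ennreal ?h * (ennreal ((C1 * \<kappa>3 * (K * N z \<rho>) / \<rho> ^ CARD('n)) powr q) * (\<integral>\<^sup>+x\<in>ball z \<rho>. ennreal (?\<sigma> x) \<partial>lebesgue))"
      by (subst nn_integral_add) (auto simp: nn_integral_cmult)
    also have "\<dots> \<le> ennreal ?h * ennreal (J * (\<kappa>1 * \<kappa>2) powr q * (2 * Cu) * (K * N z \<rho>) powr q) +
        ennreal ?h * ennreal ((C1 * \<kappa>3) powr q * (2 ^ CARD('n)) powr q * A' * w0 powr (1 - q) * (K * N z \<rho>) powr q)"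
      by (intro add_mono mult_left_mono main rest) auto
    also have "\<dots> = ennreal (B * (K * N z \<rho>) powr q)"
    proof -
      have "0 \<le> J * (\<kappa>1 * \<kappa>2) powr q * (2 * Cu) * (K * N z \<rho>) powr q" using J Cu by simp
      moreover have "0 \<le> (C1 * \<kappa>3) powr q * (2 ^ CARD('n)) powr q * A' * w0 powr (1 - q) * (K * N z \<rho>) powr q"
        using A' by simp
      moreover have "ennreal h * ennreal u + ennreal h * ennreal v = ennreal (h * (u + v))" if "0 \<le> h" "0 \<le> u" "0 \<le> v" for h u v
        using that by (simp add: ennreal_mult distrib_left)
      moreover have "?h * (J * (\<kappa>1 * \<kappa>2) powr q * (2 * Cu) * (K * N z \<rho>) powr q +
          (C1 * \<kappa>3) powr q * (2 ^ CARD('n)) powr q * A' * w0 powr (1 - q) * (K * N z \<rho>) powr q) = B * (K * N z \<rho>) powr q"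
        unfolding B_def distrib_right[symmetric] by (simp only: mult.assoc)
      ultimately show ?thesis by simp
    qed
    also have "B * (K * N z \<rho>) powr q = (B powr (1 / q) * K * N z \<rho>) powr q"
      using B q by (simp add: powr_mult powr_powr mult.assoc)
    finally show "(\<integral>\<^sup>+x\<in>ball z \<rho>. ennreal (norm (f x - P z \<rho> x) powr q * \<phi> x (1 / N z \<rho>) powr (1 - q)) \<partial>lebesgue)
      \<le> ennreal ((B powr (1 / q) * K * N z \<rho>) powr q)" .
  qed
qed

end

section \<open>Comparison of Campanato norms\<close>

lemma locally_integrable_ball:
  fixes f :: "real^'n \<Rightarrow> 'b::{real_normed_field, euclidean_space}"
  assumes "locally_integrable f"
  shows "integrable (lebesgue_on (ball z \<rho>)) f"
proof -
  have "set_integrable lebesgue (cball z \<rho>) f"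
    using assms by (simp add: locally_integrable_def)
  then have "set_integrable lebesgue (ball z \<rho>) f"
    by (rule set_integrable_subset) auto
  then show ?thesis by (simp add: integrable_restrict_space set_integrable_def)
qed

lemma locally_integrable_measurable:
  fixes f :: "real^'n \<Rightarrow> 'b::{real_normed_field, euclidean_space}"
  assumes "locally_integrable f"
  shows "f \<in> borel_measurable lebesgue"
proof (rule borel_measurable_LIMSEQ_metric)
  fix n :: nat
  have "set_integrable lebesgue (cball 0 (real n)) f" using assms by (simp add: locally_integrable_def)
  then show "(\<lambda>x. indicator (cball 0 (real n)) x *\<^sub>R f x) \<in> borel_measurable lebesgue"
    unfolding set_integrable_def by (rule borel_measurable_integrable)
next
  fix x :: "real^'n"
  obtain n0 :: nat where n0: "norm x < real n0" using reals_Archimedean2 by blast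
  have "eventually (\<lambda>n. indicator (cball 0 (real n)) x *\<^sub>R f x = f x) sequentially"
    using eventually_ge_at_top[of n0] by eventually_elim (use n0 in auto)
  then show "(\<lambda>n. indicator (cball 0 (real n)) x *\<^sub>R f x) \<longlonglongrightarrow> f x"
    by (rule tendsto_eventually)
qed

lemma locally_integrable_polys_le:
  fixes p :: "real^'n \<Rightarrow> 'b::{real_normed_field, euclidean_space}"
  assumes "p \<in> polys_le s"
  shows "locally_integrable p"
  unfolding locally_integrable_def
proof (intro allI impI)
  fix K :: "(real^'n) set" assume "compact K"
  then obtain \<rho> where \<rho>: "K \<subseteq> ball 0 \<rho>" using bounded_subset_ballD[OF compact_imp_bounded] by blast
  have "set_integrable lebesgue (ball 0 \<rho>) p"
    using integrable_polys_le[OF assms] by (simp add: integrable_restrict_space set_integrable_def)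
  then show "set_integrable lebesgue K p"
    by (rule set_integrable_subset) (use \<rho> \<open>compact K\<close> in \<open>auto simp: borel_compact\<close>)
qed

lemma locally_integrable_diff:
  "locally_integrable f \<Longrightarrow> locally_integrable g \<Longrightarrow> locally_integrable (\<lambda>x. f x - g x)"
  unfolding locally_integrable_def by (auto intro: set_integral_diff(1))

lemma ennreal_powr_le_iff:
  assumes N: "0 < N" and q: "0 < q" and K: "0 \<le> K"
  shows "ennreal (1 / N) * ennreal_powr I (1 / q) \<le> ennreal K \<longleftrightarrow> I \<le> ennreal ((K * N) powr q)"
proof (cases I)
  case (real i)
  have "ennreal (1 / N) * ennreal_powr I (1 / q) = ennreal (1 / N * i powr (1 / q))"
  proof -
    have "ennreal (1 / N * i powr (1 / q)) = ennreal (1 / N) * ennreal (i powr (1 / q))"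
      by (rule ennreal_mult) (use N in auto)
    then show ?thesis using real by (simp add: ennreal_powr_def)
  qed
  then have "ennreal (1 / N) * ennreal_powr I (1 / q) \<le> ennreal K \<longleftrightarrow> 1 / N * i powr (1 / q) \<le> K"
    using K by (simp add: ennreal_le_iff)
  also have "\<dots> \<longleftrightarrow> i powr (1 / q) \<le> K * N" using N by (simp add: field_simps)
  also have "\<dots> \<longleftrightarrow> i \<le> (K * N) powr q"
  proof
    assume "i powr (1 / q) \<le> K * N"
    then have "(i powr (1 / q)) powr q \<le> (K * N) powr q" using q by (intro powr_mono2) auto
    then show "i \<le> (K * N) powr q" using q real by (simp add: powr_powr)
  next
    assume "i \<le> (K * N) powr q"
    then have "i powr (1 / q) \<le> ((K * N) powr q) powr (1 / q)" using q real by (intro powr_mono2) auto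
    then show "i powr (1 / q) \<le> K * N" using q K N by (simp add: powr_powr)
  qed
  also have "\<dots> \<longleftrightarrow> I \<le> ennreal ((K * N) powr q)" using real by simp
  finally show ?thesis .
next
  case top
  then show ?thesis using N by (simp add: ennreal_powr_def ennreal_mult_top top_unique)
qed

text \<open>
  An estimate for all positive \<open>K\<close> above the first norm carries over to the norm itself, including norm 0, by letting \<open>K\<close> decrease to it.
\<close>

lemma ennreal_le_cmultI:
  assumes C: "0 < C" and le: "\<And>K. 0 < K \<Longrightarrow> a \<le> ennreal K \<Longrightarrow> b \<le> ennreal (C * K)"
  shows "b \<le> ennreal C * a"
proof (cases a)
  case (real \<alpha>)
  show ?thesis
  proof (rule ennreal_le_epsilon)
    fix e :: real assume e: "0 < e"
    have "b \<le> ennreal (C * (\<alpha> + e / C))"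
      using real C e by (intro le ennreal_leI add_nonneg_pos) auto
    also have "C * (\<alpha> + e / C) = C * \<alpha> + e" using C by (simp add: distrib_left)
    also have "ennreal (C * \<alpha> + e) = ennreal C * a + ennreal e"
      using C e real by (simp add: ennreal_mult)
    finally show "b \<le> ennreal C * a + ennreal e" .
  qed
next
  case top
  then show ?thesis using C by (simp add: ennreal_mult_top)
qed

context musielak_weight
begin

lemma campanato_norm_le_iff:
  fixes f :: "real^'n \<Rightarrow> 'b::{real_normed_field, euclidean_space}"
  assumes q: "1 \<le> q" and K: "0 \<le> K"
  shows "campanato_norm \<phi> q s f \<le> ennreal K \<longleftrightarrow> (\<forall>z \<rho>. 0 < \<rho> \<longrightarrow>
    (\<integral>\<^sup>+x\<in>ball z \<rho>. ennreal (norm (f x - poly_proj s (ball z \<rho>) f x) powr q * \<phi> x (1 / N z \<rho>) powr (1 - q)) \<partial>lebesgue)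
      \<le> ennreal ((K * N z \<rho>) powr q))"
proof -
  have ball: "(let B = ball z \<rho>; N = chi_norm \<phi> B in
        ennreal (1 / N) *
        ennreal_powr
          (\<integral>\<^sup>+x\<in>B. ennreal ((norm (f x - poly_proj s B f x) / \<phi> x (1 / N)) powr q * \<phi> x (1 / N)) \<partial>lebesgue)
          (1 / q)) \<le> ennreal K \<longleftrightarrow>
    (\<integral>\<^sup>+x\<in>ball z \<rho>. ennreal (norm (f x - poly_proj s (ball z \<rho>) f x) powr q * \<phi> x (1 / N z \<rho>) powr (1 - q)) \<partial>lebesgue)
      \<le> ennreal ((K * N z \<rho>) powr q)" if \<rho>: "0 < \<rho>" for z \<rho>
  proof -
    note N = N_pos[OF \<rho>, of z]
    have "(u / \<phi> x (1 / N z \<rho>)) powr q * \<phi> x (1 / N z \<rho>) = u powr q * \<phi> x (1 / N z \<rho>) powr (1 - q)" for u x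
      using pos[of "1 / N z \<rho>" x] N by (simp add: powr_divide powr_diff)
    then show ?thesis
      unfolding Let_def using ennreal_powr_le_iff[OF N, of q K] q K by simp
  qed
  show ?thesis
    unfolding campanato_norm_def SUP_le_iff using ball by auto
qed

lemma campanato_norm_1_le_iff:
  fixes f :: "real^'n \<Rightarrow> 'b::{real_normed_field, euclidean_space}"
  assumes K: "0 \<le> K"
  shows "campanato_norm \<phi> 1 s f \<le> ennreal K \<longleftrightarrow> (\<forall>z \<rho>. 0 < \<rho> \<longrightarrow>
    (\<integral>\<^sup>+x\<in>ball z \<rho>. ennreal (norm (f x - poly_proj s (ball z \<rho>) f x)) \<partial>lebesgue) \<le> ennreal (K * N z \<rho>))"
proof -
  have "norm (f x - poly_proj s (ball z \<rho>) f x) powr 1 * \<phi> x (1 / N z \<rho>) powr (1 - 1) =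
      norm (f x - poly_proj s (ball z \<rho>) f x)" if "0 < \<rho>" for x z \<rho>
    using pos[of "1 / N z \<rho>" x] N_pos[OF that, of z] by simp
  then have int: "(\<integral>\<^sup>+x\<in>ball z \<rho>. ennreal (norm (f x - poly_proj s (ball z \<rho>) f x) powr 1 * \<phi> x (1 / N z \<rho>) powr (1 - 1)) \<partial>lebesgue) =
      (\<integral>\<^sup>+x\<in>ball z \<rho>. ennreal (norm (f x - poly_proj s (ball z \<rho>) f x)) \<partial>lebesgue)" if "0 < \<rho>" for z \<rho>
    using that by presburger
  have "(K * N z \<rho>) powr 1 = K * N z \<rho>" if "0 < \<rho>" for z \<rho>
    using K N_pos[OF that, of z] by simp
  with int show ?thesis
    unfolding campanato_norm_le_iff[OF order_refl K] by (simp only: cong: imp_cong)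
qed

lemma poly_proj_in_polys_le:
  fixes f :: "real^'n \<Rightarrow> 'b::{real_normed_field, euclidean_space}"
  assumes "locally_integrable f" "0 < \<rho>"
  shows "poly_proj s (ball z \<rho>) f \<in> polys_le s"
  using poly_proj_near_optimal[of s, where 'n = 'n and 'b = 'b]
    locally_integrable_ball[OF assms(1), of z \<rho>] assms(2) by blast

text \<open>
  Any approximating polynomials may be used to bound the norm, by \<open>poly_proj_near_optimal\<close>.
\<close>

lemma campanato_norm_1_le:
  "\<exists>C>0. \<forall>K\<ge>0. \<forall>f :: real^'n \<Rightarrow> 'b::{real_normed_field, euclidean_space}. locally_integrable f \<longrightarrow>
    (\<forall>z \<rho>. 0 < \<rho> \<longrightarrow> (\<exists>u\<in>polys_le s. (\<integral>\<^sup>+x\<in>ball z \<rho>. ennreal (norm (f x - u x)) \<partial>lebesgue) \<le> ennreal (K * N z \<rho>))) \<longrightarrow>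
    campanato_norm \<phi> 1 s f \<le> ennreal (C * K)"
proof -
  obtain C where "0 < C" and C: "\<And>(z::real^'n) \<rho> (f :: real^'n \<Rightarrow> 'b). 0 < \<rho> \<Longrightarrow>
    integrable (lebesgue_on (ball z \<rho>)) f \<Longrightarrow> poly_proj s (ball z \<rho>) f \<in> polys_le s \<and>
    (\<forall>p\<in>polys_le s. \<forall>M\<ge>0. (\<integral>\<^sup>+x\<in>ball z \<rho>. ennreal (norm (f x - p x)) \<partial>lebesgue) \<le> ennreal M \<longrightarrow>
      (\<forall>x\<in>ball z \<rho>. norm (poly_proj s (ball z \<rho>) f x - p x) \<le> C / \<rho> ^ CARD('n) * M))"
    using poly_proj_near_optimal[of s, where 'n = 'n and 'b = 'b] by blast
  let ?V = "unit_ball_vol (real CARD('n))"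
  have V: "0 < ?V" by simp
  show ?thesis
  proof (intro exI[of _ "1 + ?V * C"] conjI allI impI)
    show "0 < 1 + ?V * C" using \<open>0 < C\<close> V by (simp add: add_pos_pos del: unit_ball_vol_pos)
    fix K :: real and f :: "real^'n \<Rightarrow> 'b"
    assume K: "0 \<le> K" and f: "locally_integrable f" and
      ex: "\<forall>z \<rho>. 0 < \<rho> \<longrightarrow> (\<exists>u\<in>polys_le s. (\<integral>\<^sup>+x\<in>ball z \<rho>. ennreal (norm (f x - u x)) \<partial>lebesgue) \<le> ennreal (K * N z \<rho>))"
    have CK: "0 \<le> (1 + ?V * C) * K" using K \<open>0 < C\<close> V by (simp del: unit_ball_vol_pos)
    show "campanato_norm \<phi> 1 s f \<le> ennreal ((1 + ?V * C) * K)"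
      unfolding campanato_norm_1_le_iff[OF CK]
    proof (intro allI impI)
      fix z :: "real^'n" and \<rho> :: real assume \<rho>: "0 < \<rho>"
      let ?M = "K * N z \<rho>" and ?B = "ball z \<rho>"
      have M: "0 \<le> ?M" using K N_pos[OF \<rho>, of z] by simp
      obtain u where u: "u \<in> polys_le s" "(\<integral>\<^sup>+x\<in>?B. ennreal (norm (f x - u x)) \<partial>lebesgue) \<le> ennreal ?M"
        using ex \<rho> by blast
      let ?P = "poly_proj s ?B f"
      have P: "?P \<in> polys_le s" "\<And>x. x \<in> ?B \<Longrightarrow> norm (?P x - u x) \<le> C / \<rho> ^ CARD('n) * ?M"
        using C[OF \<rho> locally_integrable_ball[OF f]] u M by blast+
      have [measurable]: "f \<in> borel_measurable lebesgue" "u \<in> borel_measurable lebesgue" "?P \<in> borel_measurable lebesgue"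
        using locally_integrable_measurable[OF f] borel_measurable_polys_le[OF u(1)] borel_measurable_polys_le[OF P(1)] by auto
      have "(\<integral>\<^sup>+x\<in>?B. ennreal (norm (f x - ?P x)) \<partial>lebesgue) =
          (\<integral>\<^sup>+x\<in>?B. ennreal (norm ((f x - u x) + (u x - ?P x))) \<partial>lebesgue)" by simp
      also have "\<dots> \<le> (\<integral>\<^sup>+x\<in>?B. ennreal (norm (f x - u x)) \<partial>lebesgue) + (\<integral>\<^sup>+x\<in>?B. ennreal (norm (u x - ?P x)) \<partial>lebesgue)"
        by (rule nn_set_integral_norm_triangle) auto
      also have "\<dots> \<le> ennreal ?M + ennreal (?V * \<rho> ^ CARD('n) * (C / \<rho> ^ CARD('n) * ?M))"
      proof (intro add_mono u(2) nn_integral_ball_le_sup)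
        show "norm (u x - ?P x) \<le> C / \<rho> ^ CARD('n) * ?M" if "x \<in> ?B" for x
          using P(2)[OF that] by (simp add: norm_minus_commute)
        show "0 \<le> C / \<rho> ^ CARD('n) * ?M" using \<open>0 < C\<close> \<rho> K N_pos[OF \<rho>, of z] by simp
        show "0 \<le> \<rho>" using \<rho> by simp
      qed
      also have "?V * \<rho> ^ CARD('n) * (C / \<rho> ^ CARD('n) * ?M) = ?V * C * ?M" using \<rho> by simp
      also have "ennreal ?M + ennreal (?V * C * ?M) = ennreal ((1 + ?V * C) * K * N z \<rho>)"
      proof -
        have "0 \<le> ?V * C * ?M" using \<open>0 < C\<close> by (intro mult_nonneg_nonneg[OF _ M]) simp
        then have "ennreal ?M + ennreal (?V * C * ?M) = ennreal (?M + ?V * C * ?M)" using M by (intro ennreal_plus[symmetric])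
        then show ?thesis by (simp add: algebra_simps)
      qed
      finally show "(\<integral>\<^sup>+x\<in>?B. ennreal (norm (f x - ?P x)) \<partial>lebesgue) \<le> ennreal ((1 + ?V * C) * K * N z \<rho>)" .
    qed
  qed
qed

lemma campanato_norm_1_degree_mono:
  assumes ms: "m \<le> s"
  shows "\<exists>C>0. \<forall>K\<ge>0. \<forall>f :: real^'n \<Rightarrow> 'b::{real_normed_field, euclidean_space}. locally_integrable f \<longrightarrow>
    campanato_norm \<phi> 1 m f \<le> ennreal K \<longrightarrow> campanato_norm \<phi> 1 s f \<le> ennreal (C * K)"
proof -
  obtain C where "0 < C" and C: "\<And>K (f :: real^'n \<Rightarrow> 'b). 0 \<le> K \<Longrightarrow> locally_integrable f \<Longrightarrow>
    \<forall>z \<rho>. 0 < \<rho> \<longrightarrow> (\<exists>u\<in>polys_le s. (\<integral>\<^sup>+x\<in>ball z \<rho>. ennreal (norm (f x - u x)) \<partial>lebesgue) \<le> ennreal (K * N z \<rho>)) \<Longrightarrow>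
    campanato_norm \<phi> 1 s f \<le> ennreal (C * K)"
    using campanato_norm_1_le[of s, where 'b = 'b] by blast
  show ?thesis
  proof (intro exI[of _ C] conjI \<open>0 < C\<close> allI impI)
    fix K :: real and f :: "real^'n \<Rightarrow> 'b"
    assume K: "0 \<le> K" and f: "locally_integrable f" and le: "campanato_norm \<phi> 1 m f \<le> ennreal K"
    show "campanato_norm \<phi> 1 s f \<le> ennreal (C * K)"
    proof (rule C[OF K f], intro allI impI)
      fix z :: "real^'n" and \<rho> :: real assume \<rho>: "0 < \<rho>"
      have "poly_proj m (ball z \<rho>) f \<in> polys_le s"
        using poly_proj_in_polys_le[OF f \<rho>, of m z] polys_le_mono[OF ms] by blast
      then show "\<exists>u\<in>polys_le s. (\<integral>\<^sup>+x\<in>ball z \<rho>. ennreal (norm (f x - u x)) \<partial>lebesgue) \<le> ennreal (K * N z \<rho>)"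
        using le[unfolded campanato_norm_1_le_iff[OF K]] \<rho> by blast
    qed
  qed
qed

text \<open>
  Hoelder's inequality for the measure \<open>w dx\<close>, whose mass on the ball is at most \<open>2 Cu\<close>. It is used in the pointwise form
  \<open>v \<le> 1 + v\<^sup>q\<close> for \<open>v = \<bar>f - P\<bar> / (l w)\<close>.
\<close>

lemma campanato_norm_1_le_q:
  fixes f :: "real^'n \<Rightarrow> 'b::{real_normed_field, euclidean_space}"
  assumes q: "1 \<le> q" and K: "0 < K" and f: "locally_integrable f"
    and le: "campanato_norm \<phi> q s f \<le> ennreal K"
  shows "campanato_norm \<phi> 1 s f \<le> ennreal ((2 * Cu + 1) * K)"
proof -
  have K': "0 \<le> (2 * Cu + 1) * K" using K Cu by simp
  show ?thesis
    unfolding campanato_norm_1_le_iff[OF K']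
  proof (intro allI impI)
    fix z :: "real^'n" and \<rho> :: real assume \<rho>: "0 < \<rho>"
    let ?B = "ball z \<rho>"
    define w where "w x = \<phi> x (1 / N z \<rho>)" for x
    define l where "l = K * N z \<rho>"
    have N: "0 < 1 / N z \<rho>" using N_pos[OF \<rho>, of z] by simp
    have l: "0 < l" using K N_pos[OF \<rho>, of z] by (simp add: l_def)
    have w: "0 < w x" for x unfolding w_def by (rule pos[OF N])
    have [measurable]: "w \<in> borel_measurable lebesgue" unfolding w_def by (rule meas[OF N])
    let ?u = "\<lambda>x. norm (f x - poly_proj s ?B f x)"
    have [measurable]: "f \<in> borel_measurable lebesgue" "poly_proj s ?B f \<in> borel_measurable lebesgue"
      using locally_integrable_measurable[OF f] borel_measurable_polys_le[OF poly_proj_in_polys_le[OF f \<rho>]] by auto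
    have I: "(\<integral>\<^sup>+x\<in>?B. ennreal (?u x powr q * w x powr (1 - q)) \<partial>lebesgue) \<le> ennreal (l powr q)"
      using le[unfolded campanato_norm_le_iff[OF q less_imp_le[OF K]]] \<rho> by (simp add: w_def l_def)
    have pointwise: "?u x \<le> l * w x + l powr (1 - q) * (?u x powr q * w x powr (1 - q))" for x
    proof -
      define v where "v = ?u x / (l * w x)"
      have v: "0 \<le> v" using l w[of x] by (simp add: v_def)
      have "v \<le> 1 + v powr q"
      proof (cases "v \<le> 1")
        case False
        then have "v powr 1 \<le> v powr q" using q by (intro powr_mono) auto
        then show ?thesis using v by simp
      qed (simp add: add_increasing2)
      then have "l * w x * v \<le> l * w x * (1 + v powr q)" using l w[of x] by (intro mult_left_mono) auto
      also have "l * w x * v = ?u x" using l w[of x] by (simp add: v_def)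
      also have "l * w x * (1 + v powr q) = l * w x + l powr (1 - q) * (?u x powr q * w x powr (1 - q))"
        using l w[of x] by (simp add: v_def powr_divide powr_mult powr_diff field_simps)
      finally show ?thesis .
    qed
    have "(\<integral>\<^sup>+x\<in>?B. ennreal (?u x) \<partial>lebesgue) \<le> (\<integral>\<^sup>+x. ennreal l * (ennreal (w x) * indicator ?B x) +
        ennreal (l powr (1 - q)) * (ennreal (?u x powr q * w x powr (1 - q)) * indicator ?B x) \<partial>lebesgue)"
    proof (rule nn_integral_mono)
      fix x
      have "ennreal (?u x) \<le> ennreal (l * w x + l powr (1 - q) * (?u x powr q * w x powr (1 - q)))"
        by (rule ennreal_leI[OF pointwise])
      also have "\<dots> = ennreal l * ennreal (w x) + ennreal (l powr (1 - q)) * ennreal (?u x powr q * w x powr (1 - q))"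
        using l w[of x] by (simp only: ennreal_plus ennreal_mult powr_ge_zero mult_nonneg_nonneg less_imp_le)
      finally show "ennreal (?u x) * indicator ?B x \<le> ennreal l * (ennreal (w x) * indicator ?B x) +
        ennreal (l powr (1 - q)) * (ennreal (?u x powr q * w x powr (1 - q)) * indicator ?B x)"
        by (cases "x \<in> ?B") auto
    qed
    also have "\<dots> = ennreal l * ennreal (wt (1 / N z \<rho>) ?B) +
        ennreal (l powr (1 - q)) * (\<integral>\<^sup>+x\<in>?B. ennreal (?u x powr q * w x powr (1 - q)) \<partial>lebesgue)"
      using wt_eq[OF N \<rho> order_refl, of z] by (subst nn_integral_add) (auto simp: nn_integral_cmult w_def[symmetric])
    also have "\<dots> \<le> ennreal l * ennreal (2 * Cu) + ennreal (l powr (1 - q)) * ennreal (l powr q)"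
      by (intro add_mono mult_left_mono I ennreal_leI wt_N_upper[OF \<rho>]) auto
    also have "\<dots> = ennreal (l * (2 * Cu) + l powr (1 - q) * l powr q)"
      using l Cu by (simp only: ennreal_plus ennreal_mult powr_ge_zero mult_nonneg_nonneg less_imp_le zero_le_numeral)
    also have "l * (2 * Cu) + l powr (1 - q) * l powr q = (2 * Cu + 1) * K * N z \<rho>"
      using l powr_add[of l "1 - q" q] by (simp add: l_def algebra_simps)
    finally show "(\<integral>\<^sup>+x\<in>?B. ennreal (?u x) \<partial>lebesgue) \<le> ennreal ((2 * Cu + 1) * K * N z \<rho>)" .
  qed
qed

lemma campanato_norm_q_le_1:
  assumes q: "1 \<le> q" and dual: "1 < q \<Longrightarrow> \<exists>C>0. dual_bound \<phi> (q - 1) C"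
  shows "\<exists>C>0. \<forall>K>0. \<forall>f :: real^'n \<Rightarrow> 'b::{real_normed_field, euclidean_space}. locally_integrable f \<longrightarrow>
    campanato_norm \<phi> 1 s f \<le> ennreal K \<longrightarrow> campanato_norm \<phi> q s f \<le> ennreal (C * K)"
proof (cases "q = 1")
  case True
  then show ?thesis by (intro exI[of _ 1]) auto
next
  case False
  with q have q1: "1 < q" by simp
  then obtain Cd where "0 < Cd" "dual_bound \<phi> (q - 1) Cd" using dual by blast
  from weighted_john_nirenberg_balls[OF q1 this(2,1), of s, where 'b = 'b]
  obtain C where "0 < C" and C: "\<forall>K>0. \<forall>f\<in>borel_measurable lebesgue. \<forall>P :: real^'n \<Rightarrow> real \<Rightarrow> real^'n \<Rightarrow> 'b.
    (\<forall>z \<rho>. 0 < \<rho> \<longrightarrow> P z \<rho> \<in> polys_le s \<and>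
      (\<integral>\<^sup>+x\<in>ball z \<rho>. ennreal (norm (f x - P z \<rho> x)) \<partial>lebesgue) \<le> ennreal (K * N z \<rho>)) \<longrightarrow>
    (\<forall>z \<rho>. 0 < \<rho> \<longrightarrow> (\<integral>\<^sup>+x\<in>ball z \<rho>. ennreal (norm (f x - P z \<rho> x) powr q * \<phi> x (1 / N z \<rho>) powr (1 - q)) \<partial>lebesgue)
      \<le> ennreal ((C * K * N z \<rho>) powr q))"
    by (elim exE conjE) (rule that)
  show ?thesis
  proof (intro exI[of _ C] conjI \<open>0 < C\<close> allI impI)
    fix K :: real and f :: "real^'n \<Rightarrow> 'b"
    assume K: "0 < K" and f: "locally_integrable f" and le: "campanato_norm \<phi> 1 s f \<le> ennreal K"
    have CK: "0 \<le> C * K" using K \<open>0 < C\<close> by simp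
    have "\<forall>z \<rho>. 0 < \<rho> \<longrightarrow> poly_proj s (ball z \<rho>) f \<in> polys_le s \<and>
      (\<integral>\<^sup>+x\<in>ball z \<rho>. ennreal (norm (f x - poly_proj s (ball z \<rho>) f x)) \<partial>lebesgue) \<le> ennreal (K * N z \<rho>)"
      using poly_proj_in_polys_le[OF f] le[unfolded campanato_norm_1_le_iff[OF less_imp_le[OF K]]] by blast
    then show "campanato_norm \<phi> q s f \<le> ennreal (C * K)"
      unfolding campanato_norm_le_iff[OF q CK]
      by (rule C[THEN spec, THEN mp, OF K, THEN bspec, OF locally_integrable_measurable[OF f], THEN spec,
          of "\<lambda>z \<rho>. poly_proj s (ball z \<rho>) f", THEN mp])
  qed
qed

text \<open>
  The last clause covers functions whose limit polynomial is of low degree: then \<open>R\<close> itself can be absorbed into the approximating polynomials.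
\<close>

lemma campanato_degree_reduction:
  assumes ms: "m \<le> s" and \<kappa>: "CARD('n) * r / p < CARD('n) + m + 1"
  shows "\<exists>C>0. \<forall>K\<ge>0. \<forall>f :: real^'n \<Rightarrow> 'b::{real_normed_field, euclidean_space}. locally_integrable f \<longrightarrow>
    campanato_norm \<phi> 1 s f \<le> ennreal K \<longrightarrow>
    (\<exists>R\<in>polys_le s. campanato_norm \<phi> 1 m (\<lambda>x. f x - R x) \<le> ennreal (C * K) \<and>
      (R \<in> polys_le m \<longrightarrow> campanato_norm \<phi> 1 m f \<le> ennreal (C * K)))"
proof -
  interpret high_degree_decay N growth_const "CARD('n) * r / p" m
    by unfold_locales (use \<kappa> in simp)
  obtain C1 where "0 < C1" and C1: "\<And>K f (P :: real^'n \<Rightarrow> real \<Rightarrow> real^'n \<Rightarrow> 'b). 0 \<le> K \<Longrightarrow> f \<in> borel_measurable lebesgue \<Longrightarrow>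
    \<forall>z \<rho>. 0 < \<rho> \<longrightarrow> P z \<rho> \<in> polys_le s \<and>
      (\<integral>\<^sup>+x\<in>ball z \<rho>. ennreal (norm (f x - P z \<rho> x)) \<partial>lebesgue) \<le> ennreal (K * N z \<rho>) \<Longrightarrow>
    \<exists>R\<in>polys_le s. \<forall>z \<rho>. 0 < \<rho> \<longrightarrow>
      near_polys m z \<rho> (\<lambda>x. P z \<rho> x - R x) (C1 * K * N z \<rho> / \<rho> ^ CARD('n))"
    using degree_reduction[OF ms, where 'b = 'b] by blast
  obtain C2 where "0 < C2" and C2: "\<And>K (f :: real^'n \<Rightarrow> 'b). 0 \<le> K \<Longrightarrow> locally_integrable f \<Longrightarrow>
    \<forall>z \<rho>. 0 < \<rho> \<longrightarrow> (\<exists>u\<in>polys_le m. (\<integral>\<^sup>+x\<in>ball z \<rho>. ennreal (norm (f x - u x)) \<partial>lebesgue) \<le> ennreal (K * N z \<rho>)) \<Longrightarrow>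
    campanato_norm \<phi> 1 m f \<le> ennreal (C2 * K)"
    using campanato_norm_1_le[of m, where 'b = 'b] by blast
  let ?V = "unit_ball_vol (real CARD('n))"
  have V: "0 < ?V" by simp
  define C where "C = C2 * (1 + ?V * C1)"
  have VC: "0 < 1 + ?V * C1" using V \<open>0 < C1\<close> by (intro add_pos_pos mult_pos_pos) auto
  show ?thesis
  proof (intro exI[of _ C] conjI allI impI)
    show "0 < C" unfolding C_def using \<open>0 < C2\<close> VC by simp
    fix K :: real and f :: "real^'n \<Rightarrow> 'b"
    assume K: "0 \<le> K" and f: "locally_integrable f" and le: "campanato_norm \<phi> 1 s f \<le> ennreal K"
    let ?P = "\<lambda>z \<rho>. poly_proj s (ball z \<rho>) f"
    have P: "?P z \<rho> \<in> polys_le s" if "0 < \<rho>" for z \<rho> using poly_proj_in_polys_le[OF f that] .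
    have osc: "(\<integral>\<^sup>+x\<in>ball z \<rho>. ennreal (norm (f x - ?P z \<rho> x)) \<partial>lebesgue) \<le> ennreal (K * N z \<rho>)" if "0 < \<rho>" for z \<rho>
      using le[unfolded campanato_norm_1_le_iff[OF K]] that by blast
    obtain R where R: "R \<in> polys_le s" and near: "\<And>z \<rho>. 0 < \<rho> \<Longrightarrow>
      near_polys m z \<rho> (\<lambda>x. ?P z \<rho> x - R x) (C1 * K * N z \<rho> / \<rho> ^ CARD('n))"
      using C1[OF K locally_integrable_measurable[OF f], of ?P] P osc by blast
    have VK: "0 \<le> (1 + ?V * C1) * K" using VC K by simp
    have approx: "\<exists>u\<in>polys_le m. (\<integral>\<^sup>+x\<in>ball z \<rho>. ennreal (norm (f x - R x - u x)) \<partial>lebesgue) \<le> ennreal ((1 + ?V * C1) * K * N z \<rho>)"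
      if \<rho>: "0 < \<rho>" for z \<rho>
    proof -
      let ?\<delta> = "C1 * K * N z \<rho> / \<rho> ^ CARD('n)"
      have N: "0 < N z \<rho>" by (rule N_pos[OF \<rho>])
      obtain u where u: "u \<in> polys_le m" and pu: "\<And>x. x \<in> ball z \<rho> \<Longrightarrow> norm (?P z \<rho> x - R x - u x) \<le> ?\<delta>"
        using near[OF \<rho>, of z] unfolding near_polys_def by blast
      have [measurable]: "f \<in> borel_measurable lebesgue" "u \<in> borel_measurable lebesgue" "?P z \<rho> \<in> borel_measurable lebesgue" "R \<in> borel_measurable lebesgue"
        using locally_integrable_measurable[OF f] borel_measurable_polys_le[OF u]
          borel_measurable_polys_le[OF P[OF \<rho>]] borel_measurable_polys_le[OF R] by auto
      have "(\<integral>\<^sup>+x\<in>ball z \<rho>. ennreal (norm (f x - R x - u x)) \<partial>lebesgue) =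
          (\<integral>\<^sup>+x\<in>ball z \<rho>. ennreal (norm ((f x - ?P z \<rho> x) + (?P z \<rho> x - R x - u x))) \<partial>lebesgue)"
        by (simp add: algebra_simps)
      also have "\<dots> \<le> (\<integral>\<^sup>+x\<in>ball z \<rho>. ennreal (norm (f x - ?P z \<rho> x)) \<partial>lebesgue) +
          (\<integral>\<^sup>+x\<in>ball z \<rho>. ennreal (norm (?P z \<rho> x - R x - u x)) \<partial>lebesgue)"
        by (rule nn_set_integral_norm_triangle) auto
      also have "\<dots> \<le> ennreal (K * N z \<rho>) + ennreal (?V * \<rho> ^ CARD('n) * ?\<delta>)"
        using \<open>0 < C1\<close> K N \<rho> by (intro add_mono osc[OF \<rho>] nn_integral_ball_le_sup pu) auto
      also have "?V * \<rho> ^ CARD('n) * ?\<delta> = ?V * C1 * (K * N z \<rho>)" using \<rho> by simp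
      also have "ennreal (K * N z \<rho>) + ennreal (?V * C1 * (K * N z \<rho>)) = ennreal ((1 + ?V * C1) * K * N z \<rho>)"
      proof -
        have "0 \<le> K * N z \<rho>" "0 \<le> ?V * C1 * (K * N z \<rho>)"
          using V \<open>0 < C1\<close> K N by (auto intro!: mult_nonneg_nonneg)
        then have "ennreal (K * N z \<rho>) + ennreal (?V * C1 * (K * N z \<rho>)) = ennreal (K * N z \<rho> + ?V * C1 * (K * N z \<rho>))"
          by (intro ennreal_plus[symmetric])
        then show ?thesis by (simp add: algebra_simps)
      qed
      finally show ?thesis using u by blast
    qed
    show "\<exists>R\<in>polys_le s. campanato_norm \<phi> 1 m (\<lambda>x. f x - R x) \<le> ennreal (C * K) \<and>
      (R \<in> polys_le m \<longrightarrow> campanato_norm \<phi> 1 m f \<le> ennreal (C * K))"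
    proof (intro bexI[of _ R] conjI impI R)
      have "campanato_norm \<phi> 1 m (\<lambda>x. f x - R x) \<le> ennreal (C2 * ((1 + ?V * C1) * K))"
        using approx by (intro C2[OF VK] locally_integrable_diff f locally_integrable_polys_le[OF R]) blast
      then show "campanato_norm \<phi> 1 m (\<lambda>x. f x - R x) \<le> ennreal (C * K)" by (simp add: C_def mult.assoc)
      assume Rm: "R \<in> polys_le m"
      have "campanato_norm \<phi> 1 m f \<le> ennreal (C2 * ((1 + ?V * C1) * K))"
      proof (rule C2[OF VK f], intro allI impI)
        fix z :: "real^'n" and \<rho> :: real assume "0 < \<rho>"
        from approx[OF this, of z] obtain u where u: "u \<in> polys_le m"
          "(\<integral>\<^sup>+x\<in>ball z \<rho>. ennreal (norm (f x - R x - u x)) \<partial>lebesgue) \<le> ennreal ((1 + ?V * C1) * K * N z \<rho>)" by blast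
        then show "\<exists>u\<in>polys_le m. (\<integral>\<^sup>+x\<in>ball z \<rho>. ennreal (norm (f x - u x)) \<partial>lebesgue) \<le> ennreal ((1 + ?V * C1) * K * N z \<rho>)"
          by (intro bexI[of _ "\<lambda>x. R x + u x"] polys_le_add Rm) (simp_all add: diff_diff_eq)
      qed
      then show "campanato_norm \<phi> 1 m f \<le> ennreal (C * K)" by (simp add: C_def mult.assoc)
    qed
  qed
qed

text \<open>
  If \<open>f\<close> and \<open>f + R\<close> are both well approximated by polynomials of degree \<open>m\<close>, then so is \<open>R\<close>.
\<close>

lemma campanato_rigidity:
  fixes f g R :: "real^'n \<Rightarrow> 'b::{real_normed_field, euclidean_space}"
  assumes ms: "m \<le> s" and \<kappa>: "CARD('n) * r / p < CARD('n) + m + 1"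
    and f: "f \<in> campanato \<phi> 1 m" and g: "g \<in> campanato \<phi> 1 m"
    and R: "R \<in> polys_le s" and ae: "AE x in lebesgue. g x = f x + R x"
  shows "R \<in> polys_le m"
proof -
  interpret high_degree_decay N growth_const "CARD('n) * r / p" m
    by unfold_locales (use \<kappa> in simp)
  have loc: "locally_integrable f" "locally_integrable g" using f g by (auto simp: campanato_def)
  define a where "a = enn2real (campanato_norm \<phi> 1 m f)"
  define b where "b = enn2real (campanato_norm \<phi> 1 m g)"
  have ab: "0 \<le> a" "0 \<le> b" by (simp_all add: a_def b_def)
  have fa: "campanato_norm \<phi> 1 m f \<le> ennreal a" and gb: "campanato_norm \<phi> 1 m g \<le> ennreal b"
    using f g by (auto simp: campanato_def a_def b_def)
  obtain C1 where "0 < C1" and C1: "\<And>(z::real^'n) \<rho> M R p. p \<in> (polys_le s :: (real^'n \<Rightarrow> 'b) set) \<Longrightarrow>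
    0 < \<rho> \<Longrightarrow> 1 \<le> R \<Longrightarrow> 0 \<le> M \<Longrightarrow>
    (\<integral>\<^sup>+x\<in>ball z \<rho>. ennreal (norm (p x)) \<partial>lebesgue) \<le> ennreal M \<Longrightarrow>
    \<forall>x\<in>ball z (R * \<rho>). norm (p x) \<le> C1 * R ^ s / \<rho> ^ CARD('n) * M"
    using polys_le_sup_bound[of s, where 'n = 'n and 'b = 'b] by blast
  show ?thesis
  proof (rule rigidity[OF ms R, of "C1 * (a + b)"])
    show "0 \<le> C1 * (a + b)" using ab \<open>0 < C1\<close> by simp
    fix \<rho> :: real assume "1 \<le> \<rho>"
    then have \<rho>: "0 < \<rho>" by simp
    let ?B = "ball (0::real^'n) \<rho>"
    let ?P = "poly_proj m ?B f" and ?Q = "poly_proj m ?B g"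
    have N: "0 < N 0 \<rho>" by (rule N_pos[OF \<rho>])
    have PQ: "?P \<in> polys_le m" "?Q \<in> polys_le m" using poly_proj_in_polys_le loc \<rho> by blast+
    have [measurable]: "f \<in> borel_measurable lebesgue" "R \<in> borel_measurable lebesgue"
      "?P \<in> borel_measurable lebesgue" "?Q \<in> borel_measurable lebesgue"
      using locally_integrable_measurable[OF loc(1)] borel_measurable_polys_le[OF R]
        borel_measurable_polys_le[OF PQ(1)] borel_measurable_polys_le[OF PQ(2)] by auto
    have 1: "(\<integral>\<^sup>+x\<in>?B. ennreal (norm (f x - ?P x)) \<partial>lebesgue) \<le> ennreal (a * N 0 \<rho>)"
      using fa[unfolded campanato_norm_1_le_iff[OF ab(1)]] \<rho> by blast
    have "(\<integral>\<^sup>+x\<in>?B. ennreal (norm (f x - (?Q x - R x))) \<partial>lebesgue) = (\<integral>\<^sup>+x\<in>?B. ennreal (norm (g x - ?Q x)) \<partial>lebesgue)"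
      using ae by (intro nn_integral_cong_AE) (auto elim!: eventually_mono simp: algebra_simps)
    also have "\<dots> \<le> ennreal (b * N 0 \<rho>)"
      using gb[unfolded campanato_norm_1_le_iff[OF ab(2)]] \<rho> by blast
    finally have 2: "(\<integral>\<^sup>+x\<in>?B. ennreal (norm (f x - (?Q x - R x))) \<partial>lebesgue) \<le> ennreal (b * N 0 \<rho>)" .
    have "(\<integral>\<^sup>+x\<in>?B. ennreal (norm (?P x - (?Q x - R x))) \<partial>lebesgue) \<le> ennreal (a * N 0 \<rho> + b * N 0 \<rho>)"
      using ab N by (intro nn_set_integral_norm_diff_le[OF _ _ _ _ 1 2]) auto
    moreover have in_s: "(\<lambda>x. ?P x - (?Q x - R x)) \<in> polys_le s"
      using PQ polys_le_mono[OF ms] R by (intro polys_le_diff) auto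
    ultimately have sup: "\<forall>x\<in>ball 0 (1 * \<rho>). norm (?P x - (?Q x - R x)) \<le> C1 * 1 ^ s / \<rho> ^ CARD('n) * (a * N 0 \<rho> + b * N 0 \<rho>)"
      using ab N by (intro C1[OF in_s \<rho>]) auto
    show "near_polys m 0 \<rho> R (C1 * (a + b) * N 0 \<rho> / \<rho> ^ CARD('n))"
      unfolding near_polys_def
    proof (intro bexI[of _ "\<lambda>x. ?Q x - ?P x"] polys_le_diff PQ ballI)
      fix x assume "x \<in> ?B"
      then have "norm (?P x - (?Q x - R x)) \<le> C1 * 1 ^ s / \<rho> ^ CARD('n) * (a * N 0 \<rho> + b * N 0 \<rho>)"
        using sup by simp
      then show "norm (R x - (?Q x - ?P x)) \<le> C1 * (a + b) * N 0 \<rho> / \<rho> ^ CARD('n)"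
        by (simp add: algebra_simps add_divide_distrib)
    qed
  qed
qed

end

section \<open>Coincidence of the Campanato spaces\<close>

lemma equiv_campanato_rel:
  fixes \<phi> :: "real^'n \<Rightarrow> real \<Rightarrow> real"
  shows "equiv (campanato \<phi> q s :: (real^'n \<Rightarrow> 'b::{real_normed_field, euclidean_space}) set) (campanato_rel \<phi> q s)"
proof (rule equivI)
  show "campanato_rel \<phi> q s \<subseteq> campanato \<phi> q s \<times> (campanato \<phi> q s :: (real^'n \<Rightarrow> 'b) set)"
    by (auto simp: campanato_rel_def)
  show "refl_on (campanato \<phi> q s :: (real^'n \<Rightarrow> 'b) set) (campanato_rel \<phi> q s)"
    by (auto simp: refl_on_def campanato_rel_def intro!: bexI[of _ "\<lambda>_. 0"] polys_le_zero)
  show "sym (campanato_rel \<phi> q s :: ((real^'n \<Rightarrow> 'b) \<times> (real^'n \<Rightarrow> 'b)) set)"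
  proof (rule symI)
    fix f g :: "real^'n \<Rightarrow> 'b" assume "(f, g) \<in> campanato_rel \<phi> q s"
    then obtain P where fg: "f \<in> campanato \<phi> q s" "g \<in> campanato \<phi> q s" and P: "P \<in> polys_le s" "AE x in lebesgue. g x = f x + P x"
      by (auto simp: campanato_rel_def)
    from P(2) have "AE x in lebesgue. f x = g x + - P x" by eventually_elim simp
    with fg polys_le_uminus[OF P(1)] show "(g, f) \<in> campanato_rel \<phi> q s"
      by (auto simp: campanato_rel_def intro!: bexI[of _ "\<lambda>x. - P x"])
  qed
  show "trans (campanato_rel \<phi> q s :: ((real^'n \<Rightarrow> 'b) \<times> (real^'n \<Rightarrow> 'b)) set)"
  proof (rule transI)
    fix f g h :: "real^'n \<Rightarrow> 'b" assume "(f, g) \<in> campanato_rel \<phi> q s" "(g, h) \<in> campanato_rel \<phi> q s"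
    then obtain P Q where fh: "f \<in> campanato \<phi> q s" "h \<in> campanato \<phi> q s"
      and PQ: "P \<in> polys_le s" "Q \<in> polys_le s" "AE x in lebesgue. g x = f x + P x" "AE x in lebesgue. h x = g x + Q x"
      by (auto simp: campanato_rel_def)
    from PQ(3,4) have "AE x in lebesgue. h x = f x + (P x + Q x)" by eventually_elim simp
    with fh polys_le_add[OF PQ(1,2)] show "(f, h) \<in> campanato_rel \<phi> q s"
      by (auto simp: campanato_rel_def intro!: bexI[of _ "\<lambda>x. P x + Q x"])
  qed
qed

lemma quotient_bijection:
  assumes E1: "equiv A r" and E2: "equiv B t" and AB: "A \<subseteq> B" and rt: "r \<subseteq> t"
    and inj: "\<And>f g. f \<in> A \<Longrightarrow> g \<in> A \<Longrightarrow> (f, g) \<in> t \<Longrightarrow> (f, g) \<in> r"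
    and surj: "\<And>f. f \<in> B \<Longrightarrow> \<exists>g\<in>A. (g, f) \<in> t"
  shows "\<exists>T. (\<forall>f\<in>A. T (r `` {f}) = t `` {f}) \<and> bij_betw T (A // r) (B // t)"
proof (intro exI[of _ "\<lambda>X. t `` X"] conjI ballI)
  have T: "t `` (r `` {f}) = t `` {f}" if f: "f \<in> A" for f
  proof
    have "trans t" using E2 by (simp add: equiv_def)
    then show "t `` (r `` {f}) \<subseteq> t `` {f}" using rt by (auto dest: transD)
    have "(f, f) \<in> r" using E1 f by (simp add: equiv_def refl_on_def)
    then show "t `` {f} \<subseteq> t `` (r `` {f})" by blast
  qed
  show "t `` (r `` {f}) = t `` {f}" if "f \<in> A" for f by (rule T[OF that])
  show "bij_betw (\<lambda>X. t `` X) (A // r) (B // t)"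
  proof (rule bij_betwI')
    fix X Y assume "X \<in> A // r" "Y \<in> A // r"
    then obtain f g where fg: "f \<in> A" "g \<in> A" "X = r `` {f}" "Y = r `` {g}" by (auto simp: quotient_def)
    show "(t `` X = t `` Y) = (X = Y)"
    proof
      assume "t `` X = t `` Y"
      then have "t `` {f} = t `` {g}" using fg T by simp
      then have "(f, g) \<in> t" using eq_equiv_class[OF _ E2, of f g] fg AB by blast
      then have "(f, g) \<in> r" using inj fg by blast
      then show "X = Y" using fg equiv_class_eq[OF E1] by simp
    qed simp
  next
    fix X assume "X \<in> A // r"
    then obtain f where "f \<in> A" "X = r `` {f}" by (auto simp: quotient_def)
    then show "t `` X \<in> B // t" using T AB by (auto intro: quotientI)
  next
    fix Y assume "Y \<in> B // t"
    then obtain f where f: "f \<in> B" "Y = t `` {f}" by (auto simp: quotient_def)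
    then obtain g where g: "g \<in> A" "(g, f) \<in> t" using surj by blast
    then have "Y = t `` (r `` {g})" using f T equiv_class_eq[OF E2 g(2)] by simp
    then show "\<exists>X\<in>A // r. Y = t `` X" using g by (auto intro: quotientI)
  qed
qed

text \<open>
  A larger lower type would contradict upper type 1 for large arguments. Hence the supremum that defines
  \<^const>\<open>lower_type_index\<close> is taken over a bounded set.
\<close>

lemma lower_type_le_1:
  assumes o: "\<And>x. orlicz_function (\<phi> x)" and low: "uniformly_lower_type p \<phi>" and up: "uniformly_upper_type 1 \<phi>"
  shows "p \<le> 1"
proof (rule ccontr)
  assume "\<not> p \<le> 1"
  then have p: "1 < p" by simp
  obtain C where C: "0 < C" "\<And>x t \<sigma>. 0 \<le> t \<Longrightarrow> \<sigma> \<in> {0..1} \<Longrightarrow> \<phi> x (\<sigma> * t) \<le> C * \<sigma> powr p * \<phi> x t"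
    using low unfolding uniformly_lower_type_def by blast
  obtain D where D: "0 < D" "\<And>x t \<sigma>. 0 \<le> t \<Longrightarrow> 1 \<le> \<sigma> \<Longrightarrow> \<phi> x (\<sigma> * t) \<le> D * \<sigma> powr 1 * \<phi> x t"
    using up unfolding uniformly_upper_type_def by blast
  have pos: "0 < \<phi> x 1" for x using o[of x] by (simp add: orlicz_function_def)
  have "1 \<le> C * D * l powr (1 - p)" if l: "1 \<le> l" for l
  proof -
    have "\<phi> 0 (l * (1 / l)) \<le> D * l powr 1 * \<phi> 0 (1 / l)" using l by (intro D) auto
    also have "\<dots> \<le> D * l powr 1 * (C * (1 / l) powr p * \<phi> 0 1)"
      using C(2)[of 1 "1 / l" 0] l D by (intro mult_left_mono) auto
    also have "\<dots> = C * D * l powr (1 - p) * \<phi> 0 1"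
      using l by (simp add: powr_divide powr_diff)
    finally show ?thesis using l pos[of 0] by simp
  qed
  note * = this[of "max 1 ((2 * C * D) powr (1 / (p - 1)))"]
  define l where "l = max 1 ((2 * C * D) powr (1 / (p - 1)))"
  have l: "1 \<le> l" by (simp add: l_def)
  have "2 * C * D = ((2 * C * D) powr (1 / (p - 1))) powr (p - 1)" using C D p by (simp add: powr_powr)
  also have "\<dots> \<le> l powr (p - 1)" using p by (intro powr_mono2) (auto simp: l_def)
  finally have "2 * C * D * l powr (1 - p) \<le> l powr (p - 1) * l powr (1 - p)" by (intro mult_right_mono) auto
  also have "\<dots> = 1" using l by (simp flip: powr_add)
  finally show False using *[folded l_def, OF l] by simp
qed

text \<open>
  The strict inequality \<open>q(\<phi>)/i(\<phi>) < (n + m + 1)/n\<close>, which holds by the definition of \<open>m\<close> as an integer part, leaves room to choose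
  \<open>r > q(\<phi>)\<close> and a lower type \<open>p\<close> near \<open>i(\<phi>)\<close>.
\<close>

lemma growth_function_parameters:
  fixes \<phi> :: "real^'n \<Rightarrow> real \<Rightarrow> real"
  assumes growth: "growth_function \<phi>"
  obtains p Cl Cu r A where "musielak_weight \<phi> p Cl Cu r A"
    "real CARD('n) * r / p < real (CARD('n) + moment_index \<phi> + 1)"
proof -
  have o: "\<And>x. orlicz_function (\<phi> x)" using growth by (simp add: growth_function_def)
  have pos: "0 < \<phi> x t" if "0 < t" for x t using o[of x] that by (simp add: orlicz_function_def)
  have meas: "(\<lambda>x. \<phi> x t) \<in> borel_measurable lebesgue" if "0 < t" for t
    using growth that by (simp add: growth_function_def)
  have mono: "\<phi> x t \<le> \<phi> x t'" if "0 < t" "t \<le> t'" for x t t'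
  proof -
    have "mono_on {0..} (\<phi> x)" using o[of x] by (simp add: orlicz_function_def)
    then show ?thesis by (rule mono_onD) (use that in auto)
  qed
  have up: "uniformly_upper_type 1 \<phi>" using growth by (simp add: growth_function_def)
  let ?S = "{p. 0 < p \<and> uniformly_lower_type p \<phi>}" and ?T = "{q. 1 \<le> q \<and> muckenhoupt q \<phi>}"
  let ?i = "lower_type_index \<phi>" and ?q = "muckenhoupt_index \<phi>" and ?n = "real CARD('n)"
  have S0: "?S \<noteq> {}" using growth by (auto simp: growth_function_def)
  have Sb: "bdd_above ?S" using lower_type_le_1[OF o _ up] by (intro bdd_aboveI[of _ 1]) auto
  have T0: "?T \<noteq> {}" using growth by (auto simp: growth_function_def muckenhoupt_infty_def)
  obtain p0 where p0: "p0 \<in> ?S" using S0 by blast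
  then have "p0 \<le> ?i" unfolding lower_type_index_def by (intro cSup_upper Sb)
  with p0 have i: "0 < ?i" by simp
  have q1: "1 \<le> ?q" unfolding muckenhoupt_index_def by (rule cInf_greatest[OF T0]) simp
  define \<beta> where "\<beta> = (?n + real (moment_index \<phi>) + 1) / ?n"
  have n: "1 \<le> ?n" using zero_less_card_finite[where 'a = 'n] by linarith
  have \<beta>: "0 < \<beta>" using n by (simp add: \<beta>_def)
  have "?n * (?q / ?i - 1) < real (moment_index \<phi>) + 1"
  proof -
    have "x < real (nat \<lfloor>x\<rfloor>) + 1" for x :: real by linarith
    then show ?thesis unfolding moment_index_def .
  qed
  then have "?n * (?q / ?i) < ?n + real (moment_index \<phi>) + 1" by (simp add: algebra_simps)
  then have "?q / ?i < \<beta>" using n by (simp add: \<beta>_def pos_less_divide_eq mult.commute)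
  then have "?q < \<beta> * ?i" using i by (simp add: pos_divide_less_eq)
  then obtain r where r: "?q < r" "r < \<beta> * ?i" using dense by blast
  have "r / \<beta> < Sup ?S"
    using r(2) \<beta> by (simp add: lower_type_index_def[symmetric] pos_divide_less_eq mult.commute)
  then obtain p where p: "0 < p" "uniformly_lower_type p \<phi>" "r / \<beta> < p"
    using less_cSup_iff[OF S0 Sb] by auto
  have "r < \<beta> * p" using p(3) \<beta> by (simp add: pos_divide_less_eq mult.commute)
  then have "?n * r < (?n + real (moment_index \<phi>) + 1) * p"
    using n by (simp add: \<beta>_def pos_less_divide_eq mult.commute)
  then have rp: "?n * r / p < ?n + real (moment_index \<phi>) + 1"
    using p(1) by (simp add: pos_divide_less_eq)
  have r1: "1 < r" using q1 r by simp
  have "Inf ?T < r" using r(1) by (simp add: muckenhoupt_index_def)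
  then obtain r0 where r0: "1 \<le> r0" "muckenhoupt r0 \<phi>" "r0 < r" using cInf_lessD[OF T0] by blast
  define a where "a = 1 / (r - 1)"
  have a: "0 < a" "a * (r0 - 1) < 1" "1 + 1 / a = r" using r1 r0 by (auto simp: a_def)
  obtain Cd where Cd: "0 < Cd" "dual_bound \<phi> a Cd"
    using muckenhoupt_dual_bound[OF meas pos r0(2,1) a(1,2)] by blast
  obtain Cl where Cl: "0 < Cl" "\<And>x t \<sigma>. 0 \<le> t \<Longrightarrow> \<sigma> \<in> {0..1} \<Longrightarrow> \<phi> x (\<sigma> * t) \<le> Cl * \<sigma> powr p * \<phi> x t"
    using p(2) unfolding uniformly_lower_type_def by blast
  obtain Cu where Cu: "0 < Cu" "\<And>x t \<sigma>. 0 \<le> t \<Longrightarrow> 1 \<le> \<sigma> \<Longrightarrow> \<phi> x (\<sigma> * t) \<le> Cu * \<sigma> powr 1 * \<phi> x t"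
    using up unfolding uniformly_upper_type_def by blast
  have "musielak_weight \<phi> p Cl Cu r (2 * (2 * Cd) powr (1 / a))"
  proof
    fix t \<rho> :: real and z :: "real^'n" assume t: "0 < t" and \<rho>: "0 < \<rho>"
    obtain W where "(\<integral>\<^sup>+x\<in>ball z \<rho>. ennreal (\<phi> x t) \<partial>lebesgue) = ennreal W"
      using Cd(2) t \<rho> unfolding dual_bound_def by blast
    then show "(\<integral>\<^sup>+x\<in>ball z \<rho>. ennreal (\<phi> x t) \<partial>lebesgue) < \<infinity>" by simp
    fix E assume "E \<in> sets lebesgue" "E \<subseteq> ball z \<rho>"
    from dual_bound_subset[OF meas pos Cd(2,1) a(1) t \<rho> this]
    show "ennreal ((measure lebesgue E / measure lebesgue (ball z \<rho>)) powr r) *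
        (\<integral>\<^sup>+x\<in>ball z \<rho>. ennreal (\<phi> x t) \<partial>lebesgue)
      \<le> ennreal (2 * (2 * Cd) powr (1 / a)) * (\<integral>\<^sup>+x\<in>E. ennreal (\<phi> x t) \<partial>lebesgue)"
      unfolding a(3) .
  next
    fix t \<sigma> :: real and x assume "0 < t" "0 < \<sigma>" "\<sigma> \<le> 1"
    then show "\<phi> x (\<sigma> * t) \<le> Cl * \<sigma> powr p * \<phi> x t" by (intro Cl) auto
  next
    fix t \<sigma> :: real and x assume "0 < t" "1 \<le> \<sigma>"
    then show "\<phi> x (\<sigma> * t) \<le> Cu * \<sigma> * \<phi> x t" using Cu(2)[of t \<sigma> x] by simp
  qed (use meas pos mono p Cl Cu r1 Cd in auto)
  then show ?thesis by (rule that) (use rp in simp)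
qed

text \<open>
  The condition \<open>q < q(\<phi>)'\<close> is equivalent to \<open>q(\<phi>) < q'\<close>, and \<open>q - 1 = 1/(q' - 1)\<close> is the dual exponent that belongs to \<open>q'\<close>.
\<close>

lemma growth_function_dual_bound:
  fixes \<phi> :: "real^'n \<Rightarrow> real \<Rightarrow> real"
  assumes growth: "growth_function \<phi>" and q: "1 < q" "ereal q < conjugate_index (muckenhoupt_index \<phi>)"
  shows "\<exists>C>0. dual_bound \<phi> (q - 1) C"
proof -
  have o: "\<And>x. orlicz_function (\<phi> x)" using growth by (simp add: growth_function_def)
  have pos: "0 < \<phi> x t" if "0 < t" for x t using o[of x] that by (simp add: orlicz_function_def)
  have meas: "(\<lambda>x. \<phi> x t) \<in> borel_measurable lebesgue" if "0 < t" for t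
    using growth that by (simp add: growth_function_def)
  let ?T = "{q. 1 \<le> q \<and> muckenhoupt q \<phi>}" and ?q = "muckenhoupt_index \<phi>"
  have T0: "?T \<noteq> {}" using growth by (auto simp: growth_function_def muckenhoupt_infty_def)
  have q1: "1 \<le> ?q" unfolding muckenhoupt_index_def by (rule cInf_greatest[OF T0]) simp
  have "?q < q / (q - 1)"
  proof (cases "?q = 1")
    case True
    then show ?thesis using q(1) by (simp add: pos_less_divide_eq)
  next
    case False
    with q1 q(2) have "q < ?q / (?q - 1)" "1 < ?q" by (auto simp: conjugate_index_def)
    then have "q * (?q - 1) < ?q" by (simp add: pos_less_divide_eq)
    then have "?q * (q - 1) < q" by (simp add: algebra_simps)
    then show ?thesis using q(1) by (simp add: pos_less_divide_eq)
  qed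
  then have "Inf ?T < q / (q - 1)" by (simp add: muckenhoupt_index_def)
  then obtain r where r: "1 \<le> r" "muckenhoupt r \<phi>" "r < q / (q - 1)" using cInf_lessD[OF T0] by blast
  have "r * (q - 1) < q" using r(3) q(1) by (simp add: pos_less_divide_eq)
  then have "(q - 1) * (r - 1) < 1" by (simp add: algebra_simps)
  then show ?thesis using q(1) by (intro muckenhoupt_dual_bound[OF meas pos r(2,1)]) auto
qed

theorem corollary3p7:
  fixes \<phi> :: "real^'n \<Rightarrow> real \<Rightarrow> real" and q :: real and s :: nat
  assumes "growth_function \<phi>"
    and "uniformly_locally_dominated_convergence \<phi>"
    and "1 \<le> q" and "ereal q < conjugate_index (muckenhoupt_index \<phi>)"
    and "moment_index \<phi> \<le> s"
  defines "m \<equiv> moment_index \<phi>"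
  defines "L1 \<equiv> (campanato \<phi> 1 m :: (real^'n \<Rightarrow> 'b::{real_normed_field, euclidean_space}) set)"
    and "Lq \<equiv> (campanato \<phi> q s :: (real^'n \<Rightarrow> 'b) set)"
    and "R1 \<equiv> (campanato_rel \<phi> 1 m :: ((real^'n \<Rightarrow> 'b) \<times> (real^'n \<Rightarrow> 'b)) set)"
    and "Rq \<equiv> (campanato_rel \<phi> q s :: ((real^'n \<Rightarrow> 'b) \<times> (real^'n \<Rightarrow> 'b)) set)"
  shows "L1 \<subseteq> Lq \<and>
    (\<exists>T. (\<forall>f\<in>L1. T (R1 `` {f}) = Rq `` {f}) \<and> bij_betw T (L1 // R1) (Lq // Rq)) \<and>
    (\<exists>C1>0. \<exists>C2>0. \<forall>f\<in>L1.
       campanato_norm \<phi> q s f \<le> ennreal C1 * campanato_norm \<phi> 1 m f \<and>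
       campanato_norm \<phi> 1 m f \<le> ennreal C2 * campanato_norm \<phi> q s f)"
proof -
  obtain p Cl Cu r A where weight: "musielak_weight \<phi> p Cl Cu r A"
    and \<kappa>: "real CARD('n) * r / p < real (CARD('n) + m + 1)"
    using growth_function_parameters[OF assms(1)] unfolding m_def by blast
  interpret musielak_weight \<phi> p Cl Cu r A by (rule weight)
  have ms: "m \<le> s" using assms(5) by (simp add: m_def)
  note dual = growth_function_dual_bound[OF assms(1) _ assms(4)]
  obtain Ca where "0 < Ca" and Ca: "\<And>K (f :: real^'n \<Rightarrow> 'b). 0 \<le> K \<Longrightarrow> locally_integrable f \<Longrightarrow>
      campanato_norm \<phi> 1 m f \<le> ennreal K \<Longrightarrow> campanato_norm \<phi> 1 s f \<le> ennreal (Ca * K)"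
    using campanato_norm_1_degree_mono[OF ms, where 'b = 'b] by blast
  obtain Cb where "0 < Cb" and Cb: "\<And>K (f :: real^'n \<Rightarrow> 'b). 0 < K \<Longrightarrow> locally_integrable f \<Longrightarrow>
      campanato_norm \<phi> 1 s f \<le> ennreal K \<Longrightarrow> campanato_norm \<phi> q s f \<le> ennreal (Cb * K)"
    using campanato_norm_q_le_1[OF assms(3) dual, of s, where 'b = 'b] by blast
  obtain Cc where "0 < Cc" and Cc: "\<And>K (f :: real^'n \<Rightarrow> 'b). 0 \<le> K \<Longrightarrow> locally_integrable f \<Longrightarrow>
      campanato_norm \<phi> 1 s f \<le> ennreal K \<Longrightarrow>
      \<exists>R\<in>polys_le s. campanato_norm \<phi> 1 m (\<lambda>x. f x - R x) \<le> ennreal (Cc * K) \<and>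
        (R \<in> polys_le m \<longrightarrow> campanato_norm \<phi> 1 m f \<le> ennreal (Cc * K))"
    using campanato_degree_reduction[OF ms \<kappa>, where 'b = 'b] by blast
  have reduce: "\<exists>R\<in>polys_le s. (\<lambda>x. f x - R x) \<in> L1 \<and>
      (R \<in> polys_le m \<longrightarrow> campanato_norm \<phi> 1 m f \<le> ennreal (Cc * (2 * Cu + 1) * K))"
    if K: "0 < K" and f: "locally_integrable f" and le: "campanato_norm \<phi> q s f \<le> ennreal K"
    for K and f :: "real^'n \<Rightarrow> 'b"
  proof -
    have "0 \<le> (2 * Cu + 1) * K" using Cu(1) K by simp
    from Cc[OF this f campanato_norm_1_le_q[OF assms(3) K f le]]
    obtain R where R: "R \<in> polys_le s" "campanato_norm \<phi> 1 m (\<lambda>x. f x - R x) \<le> ennreal (Cc * ((2 * Cu + 1) * K))"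
      "R \<in> polys_le m \<longrightarrow> campanato_norm \<phi> 1 m f \<le> ennreal (Cc * ((2 * Cu + 1) * K))" by blast
    have "(\<lambda>x. f x - R x) \<in> L1"
      unfolding L1_def campanato_def
      using locally_integrable_diff[OF f locally_integrable_polys_le[OF R(1)]] le_less_trans[OF R(2)] by simp
    with R show ?thesis by (auto simp: mult.assoc)
  qed
  have upper: "campanato_norm \<phi> q s f \<le> ennreal (Cb * Ca) * campanato_norm \<phi> 1 m f" if f: "f \<in> L1" for f
  proof (rule ennreal_le_cmultI)
    show "0 < Cb * Ca" using \<open>0 < Ca\<close> \<open>0 < Cb\<close> by simp
    fix K :: real assume K: "0 < K" "campanato_norm \<phi> 1 m f \<le> ennreal K"
    have loc: "locally_integrable f" using f by (simp add: L1_def campanato_def)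
    show "campanato_norm \<phi> q s f \<le> ennreal (Cb * Ca * K)"
      using Cb[OF _ loc Ca[OF _ loc K(2)]] K(1) \<open>0 < Ca\<close> by (simp add: mult.assoc)
  qed
  have sub: "L1 \<subseteq> Lq"
  proof
    fix f assume f: "f \<in> L1"
    then have "campanato_norm \<phi> 1 m f < top" by (simp add: L1_def campanato_def)
    then have "ennreal (Cb * Ca) * campanato_norm \<phi> 1 m f < top" by (simp add: ennreal_mult_less_top)
    with upper[OF f] have "campanato_norm \<phi> q s f < top" by (rule le_less_trans)
    then show "f \<in> Lq" using f by (simp add: L1_def Lq_def campanato_def)
  qed
  have lower: "campanato_norm \<phi> 1 m f \<le> ennreal (Cc * (2 * Cu + 1)) * campanato_norm \<phi> q s f" if f: "f \<in> L1" for f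
  proof (rule ennreal_le_cmultI)
    show "0 < Cc * (2 * Cu + 1)" using \<open>0 < Cc\<close> Cu(1) by simp
    fix K :: real assume K: "0 < K" "campanato_norm \<phi> q s f \<le> ennreal K"
    have "locally_integrable f" using f by (simp add: L1_def campanato_def)
    from reduce[OF K(1) this K(2)] obtain R where R: "R \<in> polys_le s" "(\<lambda>x. f x - R x) \<in> L1"
      "R \<in> polys_le m \<Longrightarrow> campanato_norm \<phi> 1 m f \<le> ennreal (Cc * (2 * Cu + 1) * K)" by blast
    have "R \<in> polys_le m"
      by (rule campanato_rigidity[OF ms \<kappa> R(2)[unfolded L1_def] f[unfolded L1_def] R(1)]) simp
    then show "campanato_norm \<phi> 1 m f \<le> ennreal (Cc * (2 * Cu + 1) * K)" by (rule R(3))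
  qed
  have "\<exists>T. (\<forall>f\<in>L1. T (R1 `` {f}) = Rq `` {f}) \<and> bij_betw T (L1 // R1) (Lq // Rq)"
  proof (rule quotient_bijection[OF _ _ sub])
    show "equiv L1 R1" "equiv Lq Rq" unfolding L1_def R1_def Lq_def Rq_def by (rule equiv_campanato_rel)+
    have "R \<in> polys_le s" if "R \<in> polys_le m" for R :: "real^'n \<Rightarrow> 'b"
      using that polys_le_mono[OF ms] by blast
    then show "R1 \<subseteq> Rq"
      using sub unfolding R1_def Rq_def campanato_rel_def L1_def Lq_def by blast
    show "(f, g) \<in> R1" if fg: "f \<in> L1" "g \<in> L1" "(f, g) \<in> Rq" for f g
    proof -
      obtain R where R: "R \<in> polys_le s" "AE x in lebesgue. g x = f x + R x"
        using fg(3) by (auto simp: Rq_def campanato_rel_def)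
      have "R \<in> polys_le m"
        by (rule campanato_rigidity[OF ms \<kappa> fg(1,2)[unfolded L1_def] R])
      with R(2) fg(1,2) show ?thesis unfolding R1_def campanato_rel_def L1_def by blast
    qed
    show "\<exists>g\<in>L1. (g, f) \<in> Rq" if f: "f \<in> Lq" for f
    proof -
      define K where "K = enn2real (campanato_norm \<phi> q s f) + 1"
      have loc: "locally_integrable f" and fin: "campanato_norm \<phi> q s f < top"
        using f by (auto simp: Lq_def campanato_def)
      have K: "0 < K" by (simp add: K_def add_nonneg_pos)
      have "campanato_norm \<phi> q s f = ennreal (enn2real (campanato_norm \<phi> q s f))" using fin by simp
      also have "\<dots> \<le> ennreal K" by (intro ennreal_leI) (simp add: K_def)
      finally obtain R where R: "R \<in> polys_le s" "(\<lambda>x. f x - R x) \<in> L1"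
        using reduce[OF K loc] by blast
      have "(\<lambda>x. f x - R x) \<in> Lq" using R(2) sub by blast
      then have "((\<lambda>x. f x - R x), f) \<in> Rq"
        using f R(1) unfolding Rq_def campanato_rel_def Lq_def by (auto intro!: bexI[of _ R])
      with R(2) show ?thesis by blast
    qed
  qed
  moreover have "\<exists>C1>0. \<exists>C2>0. \<forall>f\<in>L1.
       campanato_norm \<phi> q s f \<le> ennreal C1 * campanato_norm \<phi> 1 m f \<and>
       campanato_norm \<phi> 1 m f \<le> ennreal C2 * campanato_norm \<phi> q s f"
    using upper lower \<open>0 < Ca\<close> \<open>0 < Cb\<close> \<open>0 < Cc\<close> Cu(1)
    by (intro exI[of _ "Cb * Ca"] exI[of _ "Cc * (2 * Cu + 1)"] conjI ballI) (auto intro: mult_pos_pos)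
  ultimately show ?thesis using sub by blast
qed

end
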